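(* Assume the following three conditions on the SPDE with additive noise $dX(t)=\mathcal A(X(t))dt+dL(t)$, $X(0)=x$, described in the context. (1) For every $x\in H$ there exists a unique global solution $X^x=(X^x(t))_{t\ge 0}$, and $\{X^x, x\in H\}$ forms a strong Markov process. (2) For every $h\in H$ there exists $\eta_h>0$ such that for every $\eta\in(0,\eta_h]$ there exist $\epsilon\in(0,\frac{\eta}{2}]$ and $t\in(0,\infty)$ with $\inf_{\tilde h\in B(h,\epsilon)}\mathbb{P}(\tau^{\eta}_{\tilde h,h}\ge t)>0$, where $\tau^{\eta}_{x,y}=\inf\{s\ge 0: X^x(s)\notin B(y,\eta)\}$. (3) For every $h\in H$ and $\eta_h>0$ there exist $n\in\mathbb N$, strictly positive numbers $\eta_1,\dots,\eta_n$ and $a_1,\dots,a_n\in H\setminus\{0\}$ such that $0\notin\overline{B(a_i,\eta_i)}$ and $\nu(B(a_i,\eta_i))>0$ for $i=1,\dots,n$, and $\sum_{i=1}^nB(a_i,\eta_i):=\{\sum_{i=1}^nh_i: h_i\in B(a_i,\eta_i),\ 1\le i\le n\}\subset B(h,\eta_h)$. Then the Markov process $\{X^x, x\in H\}$ is irreducible in $H$, that is, for every $t>0$ and $x\in H$, $\mathbb{P}(X^x(t)\in B)>0$ for every non-empty open set $B\subset H$.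
   Context: Let $V\subset H\simeq H^*\subset V^*$ be a Gelfand triple: $(H,\langle\cdot,\cdot\rangle_H)$ is a separable Hilbert space identified with its dual, $V$ is a reflexive Banach space continuously and densely embedded into $H$, and ${}_{V^*}\langle u,v\rangle_V=\langle u,v\rangle_H$ for $u\in H$, $v\in V$. Let $(\Omega,\mathcal F,\mathbb F=\{\mathcal F_t\}_{t\ge0},\mathbb P)$ be a filtered probability space satisfying the usual conditions. $B(x,l)=\{y\in H:\|y-x\|_H<l\}$, $\overline{B(x,l)}=\{y\in H:\|y-x\|_H\le l\}$. Let $\nu$ be a $\sigma$-finite intensity measure of a Lévy process on $H$, i.e. $\nu(\{0\})=0$ and $\int_H(\|z\|_H^2\wedge1)\nu(dz)<\infty$. Let $N$ be the time homogeneous Poisson random measure on $H$ with intensity measure $\nu$, $\tilde N(dz,dt)=N(dz,dt)-\nu(dz)dt$, and $$L(t)=\int_0^t\int_{0<\|z\|_H\le1}z\,\tilde N(dz,ds)+\int_0^t\int_{\|z\|_H>1}z\,N(dz,ds),\quad t\ge0,$$ an $H$-valued Lévy process. $\mathcal A:V\to V^*$ is Borel measurable. A solution of $dX(t)=\mathcal A(X(t))dt+dL(t)$, $X(0)=x$, is an $H$-valued càdlàg $\mathbb F$-adapted process $X$ with $X(t,\omega)\in V$ for $dt\otimes\mathbb P$-almost all $(t,\omega)$, $\int_0^t\|\mathcal A(X(s))\|_{V^*}ds<\infty$ for all $t\ge0$ $\mathbb P$-a.s., and $\mathbb P$-a.s. $X(t)=x+\int_0^t\mathcal A(X(s))ds+L(t)$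 for all $t\ge0$ as an equation in $V^*$. $X^x$ denotes the solution starting from $x$. *)

theory Defs
  imports "HOL-Probability.Probability"
begin

section \<open>Gelfand triple\<close>

text \<open>
  \<open>H\<close> is a type \<open>'h\<close> of sort \<open>{real_inner, banach, second_countable_topology}\<close> (a separable Hilbert
  space), \<open>V\<close> is a type \<open>'v\<close> of sort \<open>banach\<close>, \<open>V*\<close> is \<open>'v \<Rightarrow>\<^sub>L real\<close>, and the inclusion of \<open>V\<close> in
  \<open>H\<close> is an explicit map \<open>J\<close>.
\<close>

definition reflexive :: "'v::real_normed_vector itself \<Rightarrow> bool" where
  "reflexive _ \<longleftrightarrow> (\<forall>\<phi> :: ('v \<Rightarrow>\<^sub>L real) \<Rightarrow>\<^sub>L real. \<exists>v::'v. \<forall>f. blinfun_apply \<phi> f = blinfun_apply f v)"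

definition gelfand_triple ::
    "('v::banach \<Rightarrow>\<^sub>L 'h::{real_inner,banach,second_countable_topology}) \<Rightarrow> bool" where
  "gelfand_triple J \<longleftrightarrow>
     reflexive TYPE('v) \<and> inj (blinfun_apply J) \<and> closure (range (blinfun_apply J)) = UNIV"

text \<open>The embedding of \<open>H\<close> in \<open>V*\<close> for which the duality of \<open>V*\<close> and \<open>V\<close> restricts to the inner
  product of \<open>H\<close>.\<close>

definition to_dual ::
    "('v::banach \<Rightarrow>\<^sub>L 'h::{real_inner,banach,second_countable_topology}) \<Rightarrow> 'h \<Rightarrow> ('v \<Rightarrow>\<^sub>L real)" where
  "to_dual J h = blinfun_inner_right h o\<^sub>L J"

text \<open>\<open>\<A>(y)\<close> for \<open>y \<in> H\<close> that lies in \<open>V\<close>; the value \<open>0\<close> off \<open>V\<close> is a convention, only met by a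
  solution on a null set of times.\<close>

definition on_H ::
    "('v::banach \<Rightarrow>\<^sub>L 'h::{real_inner,banach,second_countable_topology}) \<Rightarrow>
      ('v \<Rightarrow> ('v \<Rightarrow>\<^sub>L real)) \<Rightarrow> 'h \<Rightarrow> ('v \<Rightarrow>\<^sub>L real)" where
  "on_H J A y = (if y \<in> range (blinfun_apply J) then A (inv (blinfun_apply J) y) else 0)"

text \<open>
  The Bochner integral. This is the definition of \<^const>\<open>has_bochner_integral\<close> with the class
  constraint \<open>second_countable_topology\<close> dropped, since the type \<open>'v \<Rightarrow>\<^sub>L real\<close> is not an instance of
  that class.
\<close>

definition bochner_integral_is :: "'a measure \<Rightarrow> ('a \<Rightarrow> 'b) \<Rightarrow> 'b::real_normed_vector \<Rightarrow> bool" where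
  "bochner_integral_is M f x \<longleftrightarrow>
     f \<in> borel_measurable M \<and>
     (\<exists>s. (\<forall>i::nat. Bochner_Integration.simple_bochner_integrable M (s i)) \<and>
          (\<lambda>i. \<integral>\<^sup>+y. ennreal (norm (f y - s i y)) \<partial>M) \<longlonglongrightarrow> 0 \<and>
          (\<lambda>i. Bochner_Integration.simple_bochner_integral M (s i)) \<longlonglongrightarrow> x)"


section \<open>Filtrations and processes\<close>

text \<open>Time is \<open>real\<close>; everything is required on \<open>[0,\<infinity>)\<close> only. The library notion \<^locale>\<open>filtration\<close>
  also asks for \<open>F t\<close> with \<open>t < 0\<close>, for which \<open>F 0\<close> can be taken.\<close>

definition usual_filtered_prob_space :: "'w measure \<Rightarrow> (real \<Rightarrow> 'w measure) \<Rightarrow> bool" where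
  "usual_filtered_prob_space M F \<longleftrightarrow>
     prob_space M \<and> filtration (space M) F \<and> (\<forall>t. subalgebra M (F t)) \<and>
     (\<forall>t\<ge>0. (\<Inter>s\<in>{t<..}. sets (F s)) = sets (F t)) \<and>
     (\<forall>S\<in>null_sets M. \<forall>S'\<subseteq>S. S' \<in> sets (F 0))"

definition cadlag :: "(real \<Rightarrow> 'a::topological_space) \<Rightarrow> bool" where
  "cadlag f \<longleftrightarrow>
     (\<forall>t\<ge>0. continuous (at_right t) f) \<and> (\<forall>t>0. \<exists>l. (f \<longlongrightarrow> l) (at_left t))"

definition cadlag_paths :: "'w measure \<Rightarrow> (real \<Rightarrow> 'w \<Rightarrow> 'a::topological_space) \<Rightarrow> bool" where
  "cadlag_paths M X \<longleftrightarrow> (\<forall>\<omega>\<in>space M. cadlag (\<lambda>t. X t \<omega>))"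

definition adapted :: "(real \<Rightarrow> 'w measure) \<Rightarrow> (real \<Rightarrow> 'w \<Rightarrow> 'a::topological_space) \<Rightarrow> bool" where
  "adapted F X \<longleftrightarrow> (\<forall>t\<ge>0. X t \<in> borel_measurable (F t))"

definition indistinguishable :: "'w measure \<Rightarrow> (real \<Rightarrow> 'w \<Rightarrow> 'a) \<Rightarrow> (real \<Rightarrow> 'w \<Rightarrow> 'a) \<Rightarrow> bool" where
  "indistinguishable M X Y \<longleftrightarrow> (AE \<omega> in M. \<forall>t\<ge>0. X t \<omega> = Y t \<omega>)"

text \<open>The strong Markov property relative to \<open>F\<close>: for every starting point \<open>x\<close> and every finite
  stopping time \<open>T\<close>, the conditional law of \<open>X x (T + t)\<close> given the \<open>\<sigma>\<close>-algebra at time \<open>T\<close> is the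
  transition probability \<open>P\<^sub>t\<close> from the point \<open>X x T\<close>, where \<open>P\<^sub>t y B\<close> is the probability of
  \<open>X y t \<in> B\<close>.\<close>

definition transition_prob ::
    "'w measure \<Rightarrow> ('h \<Rightarrow> real \<Rightarrow> 'w \<Rightarrow> 'h) \<Rightarrow> real \<Rightarrow> 'h \<Rightarrow> 'h set \<Rightarrow> real" where
  "transition_prob M X t y B = measure M {\<omega>\<in>space M. X y t \<omega> \<in> B}"

definition strong_markov ::
    "'w measure \<Rightarrow> (real \<Rightarrow> 'w measure) \<Rightarrow> ('h::topological_space \<Rightarrow> real \<Rightarrow> 'w \<Rightarrow> 'h) \<Rightarrow> bool" where
  "strong_markov M F X \<longleftrightarrow>
     (\<forall>t\<ge>0. \<forall>B\<in>sets borel. (\<lambda>y. transition_prob M X t y B) \<in> borel_measurable borel) \<and>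
     (\<forall>x T. stopping_time F T \<and> (\<forall>\<omega>\<in>space M. 0 \<le> T \<omega>) \<longrightarrow>
        (\<forall>t\<ge>0. \<forall>B\<in>sets borel.
           AE \<omega> in M.
             real_cond_exp M (filtration.pre_sigma (space M) F T)
               (\<lambda>\<omega>'. indicator B (X x (T \<omega>' + t) \<omega>')) \<omega>
             = transition_prob M X t (X x (T \<omega>) \<omega>) B))"


section \<open>Poisson random measure and the Levy process\<close>

definition levy_measure :: "'h::{real_inner,banach,second_countable_topology} measure \<Rightarrow> bool" where
  "levy_measure \<nu> \<longleftrightarrow>
     sets \<nu> = sets borel \<and> sigma_finite_measure \<nu> \<and> emeasure \<nu> {0} = 0 \<and>
     (\<integral>\<^sup>+z. ennreal (min ((norm z)\<^sup>2) 1) \<partial>\<nu>) < \<infinity>"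

definition intensity ::
    "'h::{real_inner,banach,second_countable_topology} measure \<Rightarrow> ('h \<times> real) measure" where
  "intensity \<nu> = \<nu> \<Otimes>\<^sub>M restrict_space lborel {0..}"

text \<open>\<open>N\<close> is a time homogeneous Poisson random measure over the filtered probability space: besides
  the Poisson laws and the independent scattering, \<open>N\<close> up to time \<open>t\<close> is \<open>F t\<close>-measurable and \<open>N\<close>
  after time \<open>t\<close> is independent of \<open>F t\<close>.\<close>

definition poisson_random_measure ::
    "'w measure \<Rightarrow> (real \<Rightarrow> 'w measure) \<Rightarrow> 'h::{real_inner,banach,second_countable_topology} measure \<Rightarrow>
      ('w \<Rightarrow> ('h \<times> real) measure) \<Rightarrow> bool" where
  "poisson_random_measure M F \<nu> N \<longleftrightarrow>
     (\<forall>\<omega>\<in>space M. sets (N \<omega>) = sets (intensity \<nu>) \<and>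
        (\<forall>B\<in>sets (intensity \<nu>). emeasure (N \<omega>) B \<in> insert \<infinity> (range of_nat))) \<and>
     (\<forall>B\<in>sets (intensity \<nu>). (\<lambda>\<omega>. emeasure (N \<omega>) B) \<in> borel_measurable M) \<and>
     (\<forall>B\<in>sets (intensity \<nu>). emeasure (intensity \<nu>) B < \<infinity> \<longrightarrow>
        (\<forall>k::nat. measure M {\<omega>\<in>space M. emeasure (N \<omega>) B = of_nat k} =
            measure (intensity \<nu>) B ^ k / fact k * exp (- measure (intensity \<nu>) B))) \<and>
     (\<forall>B\<in>sets (intensity \<nu>). emeasure (intensity \<nu>) B = \<infinity> \<longrightarrow>
        (AE \<omega> in M. emeasure (N \<omega>) B = \<infinity>)) \<and>
     (\<forall>B::nat \<Rightarrow> ('h \<times> real) set. range B \<subseteq> sets (intensity \<nu>) \<and> disjoint_family B \<longrightarrow>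
        prob_space.indep_vars M (\<lambda>_. borel) (\<lambda>i \<omega>. emeasure (N \<omega>) (B i)) UNIV) \<and>
     (\<forall>t\<ge>0. \<forall>B\<in>sets (intensity \<nu>). B \<subseteq> UNIV \<times> {0..t} \<longrightarrow>
        (\<lambda>\<omega>. emeasure (N \<omega>) B) \<in> borel_measurable (F t)) \<and>
     (\<forall>t\<ge>0. prob_space.indep_set M (sets (F t))
        (sigma_sets (space M)
          {{\<omega>\<in>space M. emeasure (N \<omega>) B \<in> C} | B C.
             B \<in> sets (intensity \<nu>) \<and> B \<subseteq> UNIV \<times> {t<..} \<and> C \<in> sets borel}))"

text \<open>The integral of a deterministic square integrable \<open>f\<close> against the compensated measure
  \<open>N(dz,ds) - \<nu>(dz)ds\<close>, defined by extending the pathwise integral of absolutely integrable functions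
  along the Ito isometry: \<open>Z\<close> is the limit in \<open>L\<^sup>2(M)\<close> of the integrals of some (by the isometry,
  equivalently any) absolutely integrable functions that converge to \<open>f\<close> in \<open>L\<^sup>2\<close>.\<close>

definition compensated_integral_is ::
    "'w measure \<Rightarrow> 'h::{real_inner,banach,second_countable_topology} measure \<Rightarrow>
      ('w \<Rightarrow> ('h \<times> real) measure) \<Rightarrow> ('h \<times> real \<Rightarrow> 'h) \<Rightarrow> ('w \<Rightarrow> 'h) \<Rightarrow> bool" where
  "compensated_integral_is M \<nu> N f Z \<longleftrightarrow>
     Z \<in> borel_measurable M \<and>
     (\<exists>g. (\<forall>n::nat. integrable (intensity \<nu>) (g n)) \<and>
          (\<lambda>n. \<integral>\<^sup>+p. ennreal ((norm (g n p - f p))\<^sup>2) \<partial>intensity \<nu>) \<longlonglongrightarrow> 0 \<and>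
          (\<lambda>n. \<integral>\<^sup>+\<omega>. ennreal ((norm ((\<integral>p. g n p \<partial>N \<omega>) - (\<integral>p. g n p \<partial>intensity \<nu>) - Z \<omega>))\<^sup>2) \<partial>M)
            \<longlonglongrightarrow> 0)"

definition levy_process_of ::
    "'w measure \<Rightarrow> 'h::{real_inner,banach,second_countable_topology} measure \<Rightarrow>
      ('w \<Rightarrow> ('h \<times> real) measure) \<Rightarrow> (real \<Rightarrow> 'w \<Rightarrow> 'h) \<Rightarrow> bool" where
  "levy_process_of M \<nu> N L \<longleftrightarrow>
     cadlag_paths M L \<and>
     (\<forall>t\<ge>0. \<exists>Z.
        compensated_integral_is M \<nu> N
          (\<lambda>(z, s). indicator ({z. 0 < norm z \<and> norm z \<le> 1} \<times> {0<..t}) (z, s) *\<^sub>R z) Z \<and>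
        (AE \<omega> in M. L t \<omega> =
           Z \<omega> + (\<integral>(z, s). indicator ({z. 1 < norm z} \<times> {0<..t}) (z, s) *\<^sub>R z \<partial>N \<omega>)))"


section \<open>Solutions and exit times\<close>

definition is_solution ::
    "('v::banach \<Rightarrow>\<^sub>L 'h::{real_inner,banach,second_countable_topology}) \<Rightarrow> 'w measure \<Rightarrow>
      (real \<Rightarrow> 'w measure) \<Rightarrow> ('v \<Rightarrow> ('v \<Rightarrow>\<^sub>L real)) \<Rightarrow> (real \<Rightarrow> 'w \<Rightarrow> 'h) \<Rightarrow> 'h \<Rightarrow>
      (real \<Rightarrow> 'w \<Rightarrow> 'h) \<Rightarrow> bool" where
  "is_solution J M F A L x X \<longleftrightarrow>
     cadlag_paths M X \<and> adapted F X \<and>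
     (AE p in restrict_space lborel {0..} \<Otimes>\<^sub>M M. X (fst p) (snd p) \<in> range (blinfun_apply J)) \<and>
     (AE \<omega> in M. \<forall>t\<ge>0.
        (\<integral>\<^sup>+s. ennreal (norm (on_H J A (X s \<omega>))) \<partial>restrict_space lborel {0..t}) < \<infinity>) \<and>
     (AE \<omega> in M. \<forall>t\<ge>0. \<exists>I.
        bochner_integral_is (restrict_space lborel {0..t}) (\<lambda>s. on_H J A (X s \<omega>)) I \<and>
        to_dual J (X t \<omega>) = to_dual J x + I + to_dual J (L t \<omega>))"

text \<open>The infimum of the empty set is \<open>\<infinity>\<close>.\<close>

definition exit_time ::
    "('h::metric_space \<Rightarrow> real \<Rightarrow> 'w \<Rightarrow> 'h) \<Rightarrow> real \<Rightarrow> 'h \<Rightarrow> 'h \<Rightarrow> 'w \<Rightarrow> ennreal" where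
  "exit_time X \<eta> x y \<omega> = Inf (ennreal ` {s. 0 \<le> s \<and> X x s \<omega> \<notin> ball y \<eta>})"

definition irreducible_process ::
    "'w measure \<Rightarrow> ('h::topological_space \<Rightarrow> real \<Rightarrow> 'w \<Rightarrow> 'h) \<Rightarrow> bool" where
  "irreducible_process M X \<longleftrightarrow>
     (\<forall>t>0. \<forall>x. \<forall>B. open B \<and> B \<noteq> {} \<longrightarrow> measure M {\<omega>\<in>space M. X x t \<omega> \<in> B} > 0)"

end

theory Submission
  imports Defs
begin

text \<open>
The process reaches a target ball by waiting and then jumping. Shortly before the time \<open>T\<close> it is,
with positive probability, as close as desired to some point \<open>h\<close>: any \<open>h\<close> in the support of the law of
the left limit at \<open>T\<close> will do (\<open>law_before_has_support_point\<close>). The third hypothesis writes the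
displacement from \<open>h\<close> to the target as a sum of finitely many jump sizes, which may be moved into the
support of \<open>\<nu>\<close>, because a ball of positive measure meets the support (\<open>support_point_exists\<close>). By the
second hypothesis the process that starts close to one of the intermediate positions stays close to it
for a while, and during this while the noise can carry out the next jump (\<open>reaches_one_jump\<close>). This
happens within an arbitrarily short time, so that all the jumps fit in before \<open>T\<close>, and the process then
stays near its last position until \<open>T\<close>. The pieces are glued by the Markov property. Since paths are
right continuous, every landing is still visible at a later rational time; hence deterministic times and
one-dimensional transition probabilities suffice (\<open>markov_positive\<close>).

The core is a single jump (\<open>reaches_by_jump\<close>), where staying and jumping are not independent events.
Put a grid on a short time interval. That the process has stayed up to a grid time \<open>u\<close> is an event of
the past of \<open>u\<close>, whereas an increment of \<open>L\<close> close to \<open>b\<close> on the next grid cell is an event of the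
future, and it has a probability of at least a constant times the mesh (\<open>levy_increment_event\<close>). A
first success argument then bounds from below, uniformly in the mesh, the probability that in some cell
the process has stayed so far and the noise makes the wanted increment (\<open>prob_first_success_ge\<close>). So with
positive probability this happens on infinitely many grids; by compactness the cells accumulate at a time
where \<open>L\<close> has a genuine jump close to \<open>b\<close> and before which the process has stayed
(\<open>cadlag_jump_between\<close>). The drift is an integral over time, hence continuous in \<open>V*\<close>, and the solution
jumps together with \<open>L\<close> (\<open>solution_jump_eq\<close>).

The lower bound for an increment comes from the event that the Poisson random measure has exactly one
point with jump size in a small ball around \<open>b\<close> and no other point with jump size larger than \<open>\<kappa>\<close>. The
compensated jumps of size at most \<open>\<kappa>\<close> then have to be small. By the Chebyshev inequality they fail to be so
with a probability of at most a constant times the mesh times the integral of \<open>\<parallel>z\<parallel>\<^sup>2\<close> over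
\<open>\<parallel>z\<parallel> \<le> \<kappa>\<close>; for small \<open>\<kappa>\<close> this is a fraction of the probability of the first event, and a union bound is
enough. This uses the Ito isometry (\<open>isometry_le\<close>), which also identifies the compensated integral, given
only as a limit along some approximations, with the limit of the integrals over jumps larger than \<open>e\<close> as
\<open>e\<close> tends to \<open>0\<close> (\<open>small_jump_approximation\<close>).
\<close>

section \<open>Events of positive probability\<close>

text \<open>
If every point of \<open>S\<close> had a null ball around it, then by Lindelof countably many of these balls would
cover \<open>S\<close>. Applied to \<open>\<nu>\<close> this gives jump sizes that occur with arbitrary precision, and applied to a law
it gives a point that the process approaches.
\<close>

lemma support_point_exists:
  fixes \<mu> :: "'a::{metric_space, second_countable_topology} measure"
  assumes sets: "sets \<mu> = sets borel" and S: "open S" and pos: "emeasure \<mu> S \<noteq> 0"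
  obtains b where "b \<in> S" "\<And>r. r > 0 \<Longrightarrow> emeasure \<mu> (ball b r) > 0"
proof (rule ccontr)
  assume "\<not> thesis"
  then have "\<forall>b\<in>S. \<exists>r>0. emeasure \<mu> (ball b r) = 0"
    using that by (meson not_gr_zero)
  then obtain r where r: "\<And>b. b \<in> S \<Longrightarrow> r b > 0 \<and> emeasure \<mu> (ball b (r b)) = 0"
    by metis
  define \<F> where "\<F> = (\<lambda>b. ball b (r b)) ` S"
  have "\<And>T. T \<in> \<F> \<Longrightarrow> open T" by (auto simp: \<F>_def)
  then obtain \<F>' where F': "\<F>' \<subseteq> \<F>" "countable \<F>'" "\<Union>\<F>' = \<Union>\<F>"
    by (rule Lindelof)
  have "\<Union>\<F>' \<in> null_sets \<mu>"
  proof -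
    have "T \<in> null_sets \<mu>" if "T \<in> \<F>'" for T
      using that F'(1) r sets by (auto simp: \<F>_def null_sets_def)
    with F'(2) show ?thesis using null_sets_UN'[of \<F>' "\<lambda>T. T" \<mu>] by simp
  qed
  moreover have "S \<subseteq> \<Union>\<F>'" using r F'(3) by (force simp: \<F>_def)
  moreover have "S \<in> sets \<mu>" using S sets by auto
  ultimately have "S \<in> null_sets \<mu>" by (metis null_sets_subset)
  with pos show False by auto
qed

text \<open>
Bounds that are uniform in the mesh of a grid pass to the event that something happens on infinitely many
grids.
\<close>

lemma (in prob_space) prob_limsup_ge:
  fixes E :: "nat \<Rightarrow> 'a set"
  assumes E: "\<And>n. E n \<in> events" and ge: "\<And>n. n \<ge> n0 \<Longrightarrow> c \<le> prob (E n)"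
  shows "c \<le> prob (\<Inter>n. \<Union>m\<in>{n..}. E m)"
proof -
  let ?U = "\<lambda>n::nat. \<Union>m\<in>{n..}. E m"
  have "(\<lambda>n. prob (?U n)) \<longlonglongrightarrow> prob (\<Inter>n. ?U n)"
  proof (rule finite_Lim_measure_decseq)
    show "range ?U \<subseteq> events" using E by (auto intro!: sets.countable_UN')
    show "decseq ?U" by (rule decseq_SucI) (auto intro: Suc_leD)
  qed
  moreover have "c \<le> prob (?U n)" if "n \<ge> n0" for n
  proof -
    have "c \<le> prob (E n)" by (rule ge) fact
    also have "\<dots> \<le> prob (?U n)"
      using E by (intro finite_measure_mono) (auto intro!: sets.countable_UN')
    finally show ?thesis .
  qed
  then have "eventually (\<lambda>n. c \<le> prob (?U n)) sequentially"
    by (auto simp: eventually_sequentially)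
  ultimately show ?thesis by (rule tendsto_lowerbound) simp
qed

text \<open>
\<open>D j\<close> is the success of the trial \<open>j\<close>, independent of its past \<open>G j\<close>, and \<open>C j\<close> says that a run has
lasted up to the trial \<open>j\<close>. Splitting according to the first success makes the events disjoint:
\<open>Q j = C j - (\<Union>i<j. D i)\<close> belongs to the past of the trial \<open>j\<close>, so that
\<open>prob (Q j \<inter> D j) = prob (Q j) * prob (D j)\<close>. On \<open>C m\<close> either some trial succeeds while the run lasts, or
\<open>Q j\<close> holds for all \<open>j\<close>. The number of trials enters only through \<open>m * d\<close>, so that the bound survives a
refinement of the grid.
\<close>

lemma (in prob_space) prob_first_success_ge:
  fixes C D :: "nat \<Rightarrow> 'a set" and G :: "nat \<Rightarrow> 'a measure"
  assumes sub: "\<And>j. subalgebra M (G j)" and mono: "\<And>i j. i \<le> j \<Longrightarrow> j \<le> m \<Longrightarrow> sets (G i) \<subseteq> sets (G j)"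
    and C: "\<And>j. j \<le> m \<Longrightarrow> C j \<in> sets (G j)" and Cm: "\<And>j. j \<le> m \<Longrightarrow> C m \<subseteq> C j"
    and D: "\<And>j. j < m \<Longrightarrow> D j \<in> sets (G (Suc j))"
    and indep: "\<And>j K. j < m \<Longrightarrow> K \<in> sets (G j) \<Longrightarrow> prob (K \<inter> D j) = prob K * prob (D j)"
    and d: "\<And>j. j < m \<Longrightarrow> d \<le> prob (D j)" and d0: "0 \<le> d"
  shows "m * d * (prob (C m) - prob (\<Union>j<m. C j \<inter> D j)) \<le> prob (\<Union>j<m. C j \<inter> D j)"
proof -
  let ?E = "\<Union>j<m. C j \<inter> D j"
  define Q where "Q j = C j - (\<Union>i<j. D i)" for j
  have ev: "A \<in> events" if "A \<in> sets (G j)" for A j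
    using that sub by (auto simp: subalgebra_def)
  have Q: "Q j \<in> sets (G j)" if "j \<le> m" for j
    unfolding Q_def
  proof (intro sets.Diff C sets.finite_UN that)
    show "D i \<in> sets (G j)" if "i \<in> {..<j}" for i
      using D[of i] mono[of "Suc i" j] that \<open>j \<le> m\<close> by auto
  qed auto
  have Ev: "?E \<in> events"
    using ev C D by (intro sets.finite_UN sets.Int) (auto intro: ev less_imp_le)
  have Qge: "prob (C m) - prob ?E \<le> prob (Q j)" if "j \<le> m" for j
  proof -
    have "C m \<subseteq> Q j \<union> ?E"
    proof
      fix \<omega> assume w: "\<omega> \<in> C m"
      show "\<omega> \<in> Q j \<union> ?E"
      proof (cases "\<exists>i<j. \<omega> \<in> D i")
        case True
        then obtain i where i: "i < j" "\<omega> \<in> D i" by blast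
        then have "\<omega> \<in> C i" using w Cm[of i] that by auto
        with i that show ?thesis by auto
      next
        case False
        then show ?thesis using w Cm[OF that] by (auto simp: Q_def)
      qed
    qed
    then have "prob (C m) \<le> prob (Q j \<union> ?E)"
      using Q[OF that] Ev ev by (intro finite_measure_mono) auto
    also have "\<dots> \<le> prob (Q j) + prob ?E"
      using Q[OF that] Ev ev by (intro measure_subadditive) auto
    finally show ?thesis by simp
  qed
  have "m * d * (prob (C m) - prob ?E) = (\<Sum>j<m. (prob (C m) - prob ?E) * d)"
    by simp
  also have "\<dots> \<le> (\<Sum>j<m. prob (Q j) * prob (D j))"
  proof (rule sum_mono)
    fix j assume j: "j \<in> {..<m}"
    have "(prob (C m) - prob ?E) * d \<le> prob (Q j) * d"
      using Qge[of j] j d0 by (intro mult_right_mono) auto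
    also have "\<dots> \<le> prob (Q j) * prob (D j)"
      using d[of j] j by (intro mult_left_mono) auto
    finally show "(prob (C m) - prob ?E) * d \<le> prob (Q j) * prob (D j)" .
  qed
  also have "\<dots> = (\<Sum>j<m. prob (Q j \<inter> D j))"
    using indep Q by (intro sum.cong) auto
  also have "\<dots> = prob (\<Union>j<m. Q j \<inter> D j)"
  proof (rule finite_measure_finite_Union[symmetric])
    show "(\<lambda>j. Q j \<inter> D j) ` {..<m} \<subseteq> events"
      using Q D ev by (auto intro!: sets.Int intro: ev less_imp_le)
    show "disjoint_family_on (\<lambda>j. Q j \<inter> D j) {..<m}"
      unfolding disjoint_family_on_def Q_def
      by (intro ballI impI, rename_tac i j, case_tac "i < j") auto
  qed auto
  also have "\<dots> \<le> prob ?E"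
    using Ev by (intro finite_measure_mono) (auto simp: Q_def)
  finally show ?thesis .
qed

lemma measurable_Collect_ball:
  "f \<in> borel_measurable M \<Longrightarrow> {\<omega>\<in>space M. f \<omega> \<in> ball a r} \<in> sets M"
  using measurable_sets[of f M borel "ball a r"] by (simp add: vimage_def Int_def conj_commute)

text \<open>
Used to replace a random rational time by a deterministic one.
\<close>

lemma (in prob_space) exists_prob_pos:
  assumes Q: "countable Q" and A: "\<And>q. q \<in> Q \<Longrightarrow> A q \<in> events"
    and S: "0 < prob S" and cover: "AE \<omega> in M. \<omega> \<in> S \<longrightarrow> (\<exists>q\<in>Q. \<omega> \<in> A q)"
  shows "\<exists>q\<in>Q. 0 < prob (A q)"
proof (rule ccontr)
  assume neg: "\<not> ?thesis"
  have SM: "S \<in> events" using S measure_notin_sets by fastforce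
  have "AE \<omega> in M. \<forall>q\<in>Q. \<omega> \<notin> A q"
  proof (rule AE_ball_countable[THEN iffD2, OF Q], rule ballI)
    fix q assume q: "q \<in> Q"
    then have "prob (A q) = 0" using neg by (auto simp: zero_less_measure_iff)
    then have "A q \<in> null_sets M" using A[OF q] by (simp add: null_sets_def emeasure_eq_measure)
    then show "AE \<omega> in M. \<omega> \<notin> A q" by (rule AE_not_in)
  qed
  with cover have "AE \<omega> in M. \<omega> \<notin> S" by eventually_elim blast
  then have "prob S = 0" using SM by (simp add: prob_eq_0)
  with S show False by simp
qed

section \<open>Jumps of cadlag paths\<close>

lemma cadlag_right_tendsto:
  assumes "cadlag f" "0 \<le> s" "x \<longlonglongrightarrow> s" "\<And>k. s \<le> x k"
  shows "(\<lambda>k. f (x k)) \<longlonglongrightarrow> f s"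
proof -
  have "at s within {s..} = at_right s"
    by (simp add: at_within_def) (metis (no_types, lifting) Diff_insert_absorb atLeast_Suc_greaterThan greaterThan_iff ivl_disj_un_singleton(1) less_irrefl insert_is_Un)
  then have "continuous (at s within {s..}) f"
    using assms(1,2) by (auto simp: cadlag_def)
  from continuous_within_tendsto_compose'[OF this] assms(3,4) show ?thesis by auto
qed

text \<open>
A subsequence of the left end points converges to some \<open>\<sigma>\<close>, and the right end points have the same limit.
If infinitely many of the intervals were on one side of \<open>\<sigma>\<close>, then the increments over them would tend to
\<open>0\<close>, by right continuity or by the existence of the left limit; but they lie in a closed set that omits
\<open>0\<close>. So finally the intervals contain \<open>\<sigma>\<close>, and the increments tend to the jump at \<open>\<sigma>\<close>.
\<close>

lemma cadlag_jump_between: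
  fixes f :: "real \<Rightarrow> 'a::real_normed_vector"
  assumes f: "cadlag f" and K: "closed K" "0 \<notin> K"
    and uv: "\<And>k::nat. 0 \<le> u k \<and> u k < v k \<and> v k \<le> s" and gap: "(\<lambda>k. v k - u k) \<longlonglongrightarrow> 0"
    and inK: "\<And>k. f (v k) - f (u k) \<in> K"
  obtains \<sigma> l r where "0 < \<sigma>" "\<sigma> \<le> s" "(f \<longlongrightarrow> l) (at_left \<sigma>)" "f \<sigma> - l \<in> K"
    "strict_mono (r :: nat \<Rightarrow> nat)" "\<And>k. u (r k) < \<sigma>" "(\<lambda>k. u (r k)) \<longlonglongrightarrow> \<sigma>"
proof -
  have "\<And>k. u k \<in> {0..s}" using uv by (meson atLeastAtMost_iff less_imp_le order_trans)
  then have "\<exists>\<sigma>\<in>{0..s}. \<exists>r. strict_mono r \<and> (u \<circ> r) \<longlonglongrightarrow> \<sigma>"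
    by (rule compact_Icc[unfolded compact_def, rule_format])
  then obtain \<sigma> r0 where \<sigma>: "\<sigma> \<in> {0..s}"
    and r0: "strict_mono (r0 :: nat \<Rightarrow> nat)" "(u \<circ> r0) \<longlonglongrightarrow> \<sigma>" by (elim bexE exE conjE)
  have ulim: "(\<lambda>k. u (r k)) \<longlonglongrightarrow> \<sigma>" "(\<lambda>k. v (r k)) \<longlonglongrightarrow> \<sigma>"
    if ex: "\<exists>r1 :: nat \<Rightarrow> nat. strict_mono r1 \<and> r = r0 \<circ> r1" for r
  proof -
    obtain r1 :: "nat \<Rightarrow> nat" where r1: "strict_mono r1" "r = r0 \<circ> r1" using ex by blast
    then show u: "(\<lambda>k. u (r k)) \<longlonglongrightarrow> \<sigma>"
      using LIMSEQ_subseq_LIMSEQ[OF r0(2) r1(1)] by (simp add: o_def)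
    have "strict_mono r" using r1 r0 by (auto intro: strict_mono_o)
    from LIMSEQ_subseq_LIMSEQ[OF gap this] have "(\<lambda>k. v (r k) - u (r k)) \<longlonglongrightarrow> 0" by (simp add: o_def)
    from tendsto_add[OF this u] show "(\<lambda>k. v (r k)) \<longlonglongrightarrow> \<sigma>" by simp
  qed
  have no0: "\<not> (\<lambda>k. f (v (r k)) - f (u (r k))) \<longlonglongrightarrow> 0" for r :: "nat \<Rightarrow> nat"
    using closed_sequentially[OF K(1), of "\<lambda>k. f (v (r k)) - f (u (r k))" 0] inK K(2) by auto
  have ev1: "eventually (\<lambda>k. u (r0 k) < \<sigma>) sequentially"
  proof (rule ccontr)
    assume "\<not> ?thesis"
    from not_eventually_sequentiallyD[OF this] obtain r1 where
      r1: "strict_mono (r1 :: nat \<Rightarrow> nat)" "\<And>n. \<sigma> \<le> u (r0 (r1 n))" unfolding not_less by metis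
    let ?r = "r0 \<circ> r1"
    note lims = ulim[of ?r]
    have v: "\<sigma> \<le> v (?r n)" for n using r1(2)[of n] uv[of "?r n"] by simp
    have "(\<lambda>k. f (u (?r k))) \<longlonglongrightarrow> f \<sigma>" "(\<lambda>k. f (v (?r k))) \<longlonglongrightarrow> f \<sigma>"
      using lims r1 v \<sigma> by (auto intro!: cadlag_right_tendsto[OF f])
    from tendsto_diff[OF this(2,1)] no0[of ?r] show False by simp
  qed
  then have "\<exists>k. u (r0 k) < \<sigma>" using eventually_happens by force
  then have \<sigma>0: "0 < \<sigma>" using uv by (meson le_less_trans)
  then obtain l where l: "(f \<longlongrightarrow> l) (at_left \<sigma>)" using f by (auto simp: cadlag_def)
  have left: "(\<lambda>k. f (x k)) \<longlonglongrightarrow> l" if "x \<longlonglongrightarrow> \<sigma>" "\<And>k. x k < \<sigma>" for x :: "nat \<Rightarrow> real"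
    using that by (intro filterlim_compose[OF l] tendsto_imp_filterlim_at_left) auto
  have ev2: "eventually (\<lambda>k. \<sigma> \<le> v (r0 k)) sequentially"
  proof (rule ccontr)
    assume "\<not> ?thesis"
    from not_eventually_sequentiallyD[OF this] obtain r1 where
      r1: "strict_mono (r1 :: nat \<Rightarrow> nat)" "\<And>n. v (r0 (r1 n)) < \<sigma>" unfolding not_le by metis
    let ?r = "r0 \<circ> r1"
    note lims = ulim[of ?r]
    have u: "u (?r n) < \<sigma>" for n using r1(2)[of n] uv[of "?r n"] by simp
    have "(\<lambda>k. f (u (?r k))) \<longlonglongrightarrow> l" "(\<lambda>k. f (v (?r k))) \<longlonglongrightarrow> l"
      using lims r1 u by (auto intro!: left)
    from tendsto_diff[OF this(2,1)] no0[of ?r] show False by simp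
  qed
  obtain k0 where k0: "\<And>k. k \<ge> k0 \<Longrightarrow> u (r0 k) < \<sigma> \<and> \<sigma> \<le> v (r0 k)"
    using eventually_conj[OF ev1 ev2] by (auto simp: eventually_sequentially)
  define r where "r = r0 \<circ> (\<lambda>k. k + k0)"
  have sm: "strict_mono (\<lambda>k::nat. k + k0)" by (auto simp: strict_mono_def)
  then have ex: "\<exists>r1 :: nat \<Rightarrow> nat. strict_mono r1 \<and> r = r0 \<circ> r1" by (auto simp: r_def)
  note lims = ulim[OF ex]
  have u: "u (r k) < \<sigma>" and v: "\<sigma> \<le> v (r k)" for k using k0 by (auto simp: r_def)
  have "(\<lambda>k. f (v (r k)) - f (u (r k))) \<longlonglongrightarrow> f \<sigma> - l"
    by (intro tendsto_diff left lims u cadlag_right_tendsto[OF f] v less_imp_le[OF \<sigma>0])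
  then have "f \<sigma> - l \<in> K" using closed_sequentially[OF K(1), of "\<lambda>k. f (v (r k)) - f (u (r k))"] inK by auto
  moreover have "strict_mono r" unfolding r_def by (intro strict_mono_o r0 sm)
  ultimately show thesis using that[of \<sigma> l r] \<sigma>0 \<sigma> l u lims by auto
qed

lemma rational_in_eventually:
  fixes a b :: real
  assumes "a < b"
  shows "eventually P (at_right a) \<Longrightarrow> \<exists>q\<in>\<rat>. a < q \<and> q < b \<and> P q"
    and "eventually P (at_left b) \<Longrightarrow> \<exists>q\<in>\<rat>. a < q \<and> q < b \<and> P q"
proof -
  assume "eventually P (at_right a)"
  then obtain c where c: "a < c" "\<And>y. a < y \<Longrightarrow> y < c \<Longrightarrow> P y"
    unfolding eventually_at_right_field by blast
  with assms have "a < min b c" by simp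
  from Rats_dense_in_real[OF this] c show "\<exists>q\<in>\<rat>. a < q \<and> q < b \<and> P q" by auto
next
  assume "eventually P (at_left b)"
  then obtain c where c: "c < b" "\<And>y. c < y \<Longrightarrow> y < b \<Longrightarrow> P y"
    unfolding eventually_at_left_field by blast
  with assms have "max a c < b" by simp
  from Rats_dense_in_real[OF this] c show "\<exists>q\<in>\<rat>. a < q \<and> q < b \<and> P q" by auto
qed

text \<open>
All that happens path by path. Staying is asked for at rational times only, which makes it a measurable
event; the left limit at the jump time then lies in the closed ball, and this is why the radii have to
satisfy the strict inequality \<open>\<eta> + \<rho> < \<epsilon>\<close>. By right continuity the landing is still visible at a rational
time.
\<close>

lemma jump_lands_in_ball:
  fixes X L :: "real \<Rightarrow> 'h::real_normed_vector"
  assumes X: "cadlag X" and L: "cadlag L"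
    and jump: "\<And>\<sigma> lX lL. 0 < \<sigma> \<Longrightarrow> (X \<longlongrightarrow> lX) (at_left \<sigma>) \<Longrightarrow> (L \<longlongrightarrow> lL) (at_left \<sigma>) \<Longrightarrow> X \<sigma> - lX = L \<sigma> - lL"
    and uv: "\<And>k::nat. 0 \<le> u k \<and> u k < v k \<and> v k \<le> S" and gap: "(\<lambda>k. v k - u k) \<longlonglongrightarrow> 0"
    and stay: "\<And>k q. q \<in> \<rat> \<Longrightarrow> 0 \<le> q \<Longrightarrow> q < u k \<Longrightarrow> X q \<in> ball h \<eta>"
    and incr: "\<And>k. L (v k) - L (u k) \<in> cball b \<rho>" and \<rho>: "\<rho> < norm b" and \<epsilon>: "\<eta> + \<rho> < \<epsilon>" and s: "S < s"
  shows "\<exists>q\<in>\<rat>. 0 < q \<and> q < s \<and> X q \<in> ball (h + b) \<epsilon>"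
proof -
  have "0 \<notin> cball b \<rho>" using \<rho> by simp
  from cadlag_jump_between[OF L closed_cball this uv gap incr]
  obtain \<sigma> l r where \<sigma>: "0 < \<sigma>" "\<sigma> \<le> S" and l: "(L \<longlongrightarrow> l) (at_left \<sigma>)" "L \<sigma> - l \<in> cball b \<rho>"
    and u: "(\<lambda>k. u (r k)) \<longlonglongrightarrow> \<sigma>" by metis
  obtain lX where lX: "(X \<longlongrightarrow> lX) (at_left \<sigma>)" using X \<sigma> by (auto simp: cadlag_def)
  have before: "X q \<in> ball h \<eta>" if "q \<in> \<rat>" "0 < q" "q < \<sigma>" for q
  proof -
    from order_tendstoD(1)[OF u \<open>q < \<sigma>\<close>] obtain k where "q < u (r k)"
      using eventually_happens by force
    with stay[of q "r k"] that show ?thesis by simp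
  qed
  have "lX \<in> cball h \<eta>"
  proof (rule ccontr)
    assume "lX \<notin> cball h \<eta>"
    then have "eventually (\<lambda>t. X t \<in> - cball h \<eta>) (at_left \<sigma>)"
      by (intro topological_tendstoD[OF lX]) auto
    from rational_in_eventually(2)[OF \<sigma>(1) this] obtain q where "q \<in> \<rat>" "0 < q" "q < \<sigma>" "X q \<in> - cball h \<eta>"
      by blast
    with before[of q] show False by simp
  qed
  moreover have "X \<sigma> - (h + b) = (lX - h) + ((L \<sigma> - l) - b)"
    using jump[OF \<sigma>(1) lX l(1)] by (simp add: algebra_simps)
  then have "norm (X \<sigma> - (h + b)) \<le> norm (lX - h) + norm ((L \<sigma> - l) - b)"
    by (simp only: norm_triangle_ineq)
  ultimately have "X \<sigma> \<in> ball (h + b) \<epsilon>"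
    using l(2) \<epsilon> by (simp add: dist_norm norm_minus_commute)
  moreover have "(X \<longlongrightarrow> X \<sigma>) (at_right \<sigma>)"
    using X \<sigma> by (auto simp: cadlag_def continuous_within)
  ultimately have "eventually (\<lambda>t. X t \<in> ball (h + b) \<epsilon>) (at_right \<sigma>)"
    by (intro topological_tendstoD) auto
  moreover have "\<sigma> < s" using \<sigma> s by simp
  ultimately obtain q where "q \<in> \<rat>" "\<sigma> < q" "q < s" "X q \<in> ball (h + b) \<epsilon>"
    using rational_in_eventually(1) by blast
  then show ?thesis using \<sigma> by (intro bexI[of _ q]) auto
qed

section \<open>Solutions jump together with the noise\<close>

text \<open>
Evaluation at a vector of norm at most \<open>1\<close> is a contraction, so that the approximating simple functions
approximate the evaluated function as well. It turns an integral in \<open>V*\<close> into real integrals.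
\<close>

lemma has_bochner_integral_apply:
  fixes f :: "'a \<Rightarrow> ('v::real_normed_vector \<Rightarrow>\<^sub>L real)"
  assumes f: "bochner_integral_is M f x" and w: "norm w \<le> 1"
  shows "has_bochner_integral M (\<lambda>y. blinfun_apply (f y) w) (blinfun_apply x w)"
proof -
  let ?T = "\<lambda>\<phi> :: 'v \<Rightarrow>\<^sub>L real. blinfun_apply \<phi> w"
  obtain s where fm: "f \<in> borel_measurable M"
    and s: "\<And>i::nat. Bochner_Integration.simple_bochner_integrable M (s i)"
    and fs: "(\<lambda>i. \<integral>\<^sup>+y. ennreal (norm (f y - s i y)) \<partial>M) \<longlonglongrightarrow> 0"
    and sx: "(\<lambda>i. Bochner_Integration.simple_bochner_integral M (s i)) \<longlonglongrightarrow> x"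
    using f by (auto simp: bochner_integral_is_def)
  have lin: "linear ?T" by (intro linearI) (auto simp: blinfun.add_left blinfun.scaleR_left)
  show ?thesis
  proof (rule has_bochner_integral.intros)
    have "?T \<in> borel_measurable borel"
      by (intro borel_measurable_continuous_onI continuous_intros)
    then show "(\<lambda>y. ?T (f y)) \<in> borel_measurable M" by (rule measurable_compose[OF fm])
    show "Bochner_Integration.simple_bochner_integrable M (\<lambda>y. ?T (s i y))" for i
      using simple_bochner_integrable_compose2[OF _ s[of i] s[of i], of "\<lambda>a b. ?T a"] by simp
    show "(\<lambda>i. \<integral>\<^sup>+y. ennreal (norm (?T (f y) - ?T (s i y))) \<partial>M) \<longlonglongrightarrow> 0"
    proof (rule tendsto_sandwich[OF _ _ tendsto_const fs])
      show "\<forall>\<^sub>F i in sequentially. (\<integral>\<^sup>+y. ennreal (norm (?T (f y) - ?T (s i y))) \<partial>M) \<le>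
          (\<integral>\<^sup>+y. ennreal (norm (f y - s i y)) \<partial>M)"
      proof (intro always_eventually allI nn_integral_mono ennreal_leI)
        fix i y
        have "norm (?T (f y - s i y)) \<le> norm (f y - s i y) * norm w" by (rule norm_blinfun)
        also have "\<dots> \<le> norm (f y - s i y) * 1" using w by (intro mult_left_mono) auto
        finally show "norm (?T (f y) - ?T (s i y)) \<le> norm (f y - s i y)"
          by (simp add: blinfun.diff_left)
      qed
    qed simp
    show "(\<lambda>i. Bochner_Integration.simple_bochner_integral M (\<lambda>y. ?T (s i y))) \<longlonglongrightarrow> ?T x"
      unfolding simple_bochner_integral_linear[OF lin s] by (intro tendsto_intros sx)
  qed
qed

lemma tendsto_integral_at_left:
  fixes g :: "real \<Rightarrow> real"
  assumes g: "integrable (restrict_space lborel {0..\<sigma>}) g" and \<sigma>: "0 < \<sigma>"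
  shows "((\<lambda>t. \<integral>s. g s \<partial>restrict_space lborel {0..t}) \<longlongrightarrow> (\<integral>s. g s \<partial>restrict_space lborel {0..\<sigma>})) (at_left \<sigma>)"
proof -
  have si: "set_integrable lborel {0..\<sigma>} g"
    using g by (simp add: integrable_restrict_space set_integrable_def)
  have eq: "(\<integral>s. g s \<partial>restrict_space lborel {0..t}) = integral {0..t} g" if "t \<in> {0..\<sigma>}" for t
  proof -
    have "set_integrable lborel {0..t} g" using that by (intro set_integrable_subset[OF si]) auto
    from set_borel_integral_eq_integral(2)[OF this] show ?thesis
      by (simp add: integral_restrict_space set_lebesgue_integral_def)
  qed
  have "continuous_on {0..\<sigma>} (\<lambda>t. integral {0..t} g)"
    by (intro indefinite_integral_continuous_1 set_borel_integral_eq_integral(1)[OF si])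
  then have "((\<lambda>t. integral {0..t} g) \<longlongrightarrow> integral {0..\<sigma>} g) (at \<sigma> within {0..\<sigma>})"
    using \<sigma> by (auto simp: continuous_on_def)
  then have "((\<lambda>t. integral {0..t} g) \<longlongrightarrow> integral {0..\<sigma>} g) (at_left \<sigma>)"
    using \<sigma> by (simp add: at_within_Icc_at_left)
  moreover have "eventually (\<lambda>t. integral {0..t} g = (\<integral>s. g s \<partial>restrict_space lborel {0..t})) (at_left \<sigma>)"
    using eventually_at_left_real[OF \<sigma>] by eventually_elim (simp add: eq)
  ultimately show ?thesis using \<sigma> by (simp add: eq Lim_transform_eventually)
qed

lemma dense_range_inner_eq_0:
  fixes J :: "'v::banach \<Rightarrow>\<^sub>L 'h::{real_inner,banach,second_countable_topology}"
  assumes J: "closure (range (blinfun_apply J)) = UNIV"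
    and z: "\<And>w. norm w \<le> 1 \<Longrightarrow> z \<bullet> blinfun_apply J w = 0"
  shows "z = 0"
proof -
  have "z \<bullet> blinfun_apply J w = 0" for w
  proof (cases "w = 0")
    case False
    have "z \<bullet> blinfun_apply J ((1 / norm w) *\<^sub>R w) = 0" by (rule z) simp
    with False show ?thesis by (simp add: blinfun.scaleR_right)
  qed (simp add: blinfun.zero_right)
  then have "range (blinfun_apply J) \<subseteq> {y. z \<bullet> y = 0}" by auto
  moreover have "closed {y. z \<bullet> y = 0}" by (intro closed_Collect_eq continuous_intros)
  ultimately have "closure (range (blinfun_apply J)) \<subseteq> {y. z \<bullet> y = 0}" by (rule closure_minimal)
  then have "z \<in> {y. z \<bullet> y = 0}" unfolding J by blast
  then show ?thesis by simp
qed

text \<open>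
Tested against \<open>w \<in> V\<close>, the equation says that \<open>X - L\<close> differs from a constant by an indefinite integral
of a real function, which is continuous. So the jump of \<open>X - L\<close> is orthogonal to the dense range of \<open>J\<close>.
The exceptional null set is that of the equation and does not depend on \<open>\<sigma>\<close>.
\<close>

lemma solution_jump_eq:
  fixes J :: "'v::banach \<Rightarrow>\<^sub>L 'h::{real_inner,banach,second_countable_topology}"
  assumes J: "gelfand_triple J" and X: "is_solution J M F A L x X"
  shows "AE \<omega> in M. \<forall>\<sigma> lX lL. 0 < \<sigma> \<longrightarrow> ((\<lambda>t. X t \<omega>) \<longlongrightarrow> lX) (at_left \<sigma>) \<longrightarrow>
    ((\<lambda>t. L t \<omega>) \<longlongrightarrow> lL) (at_left \<sigma>) \<longrightarrow> X \<sigma> \<omega> - lX = L \<sigma> \<omega> - lL"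
proof -
  have "AE \<omega> in M. \<forall>t\<ge>0. \<exists>I.
        bochner_integral_is (restrict_space lborel {0..t}) (\<lambda>s. on_H J A (X s \<omega>)) I \<and>
        to_dual J (X t \<omega>) = to_dual J x + I + to_dual J (L t \<omega>)"
    using X by (simp add: is_solution_def)
  then show ?thesis
  proof (eventually_elim, intro allI impI)
    fix \<omega> \<sigma> lX lL
    assume sol: "\<forall>t\<ge>0. \<exists>I. bochner_integral_is (restrict_space lborel {0..t}) (\<lambda>s. on_H J A (X s \<omega>)) I \<and>
        to_dual J (X t \<omega>) = to_dual J x + I + to_dual J (L t \<omega>)"
      and \<sigma>: "0 < \<sigma>" and lX: "((\<lambda>t. X t \<omega>) \<longlongrightarrow> lX) (at_left \<sigma>)" and lL: "((\<lambda>t. L t \<omega>) \<longlongrightarrow> lL) (at_left \<sigma>)"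
    have *: "(X \<sigma> \<omega> - lX - (L \<sigma> \<omega> - lL)) \<bullet> blinfun_apply J w = 0" if w: "norm w \<le> 1" for w
    proof -
      let ?g = "\<lambda>s. blinfun_apply (on_H J A (X s \<omega>)) w"
      let ?Y = "\<lambda>t. X t \<omega> \<bullet> blinfun_apply J w - x \<bullet> blinfun_apply J w - L t \<omega> \<bullet> blinfun_apply J w"
      have hbi: "has_bochner_integral (restrict_space lborel {0..t}) ?g (?Y t)" if t: "0 \<le> t" for t
      proof -
        obtain I where I: "bochner_integral_is (restrict_space lborel {0..t}) (\<lambda>s. on_H J A (X s \<omega>)) I"
          "to_dual J (X t \<omega>) = to_dual J x + I + to_dual J (L t \<omega>)" using sol t by blast
        have "blinfun_apply (to_dual J (X t \<omega>)) w = blinfun_apply (to_dual J x + I + to_dual J (L t \<omega>)) w"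
          using I(2) by simp
        then have "blinfun_apply I w = ?Y t"
          by (simp add: to_dual_def blinfun.add_left)
        with has_bochner_integral_apply[OF I(1) w] show ?thesis by simp
      qed
      have "(?Y \<longlongrightarrow> ?Y \<sigma>) (at_left \<sigma>)"
      proof (rule Lim_transform_eventually)
        show "((\<lambda>t. \<integral>s. ?g s \<partial>restrict_space lborel {0..t}) \<longlongrightarrow> ?Y \<sigma>) (at_left \<sigma>)"
          using tendsto_integral_at_left[of \<sigma> ?g] hbi[of \<sigma>] \<sigma>
          by (simp add: has_bochner_integral_iff)
        show "eventually (\<lambda>t. (\<integral>s. ?g s \<partial>restrict_space lborel {0..t}) = ?Y t) (at_left \<sigma>)"
          using eventually_at_left_real[OF \<sigma>]
          by eventually_elim (rule has_bochner_integral_integral_eq, rule hbi, simp)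
      qed
      moreover have "(?Y \<longlongrightarrow> lX \<bullet> blinfun_apply J w - x \<bullet> blinfun_apply J w - lL \<bullet> blinfun_apply J w) (at_left \<sigma>)"
        by (intro tendsto_intros lX lL)
      ultimately have "?Y \<sigma> = lX \<bullet> blinfun_apply J w - x \<bullet> blinfun_apply J w - lL \<bullet> blinfun_apply J w"
        by (rule tendsto_unique[rotated]) simp
      then show ?thesis by (simp add: inner_diff_left)
    qed
    have "closure (range (blinfun_apply J)) = UNIV" using J unfolding gelfand_triple_def by blast
    from dense_range_inner_eq_0[OF this *] have "X \<sigma> \<omega> - lX - (L \<sigma> \<omega> - lL) = 0" .
    then show "X \<sigma> \<omega> - lX = L \<sigma> \<omega> - lL" by simp
  qed
qed

section \<open>Integrals against a Poisson random measure\<close>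

definition poisson_weight :: "real \<Rightarrow> nat \<Rightarrow> real" where
  "poisson_weight l k = l ^ k / fact k * exp (- l)"

lemma poisson_weight_sums: "poisson_weight l sums 1"
proof -
  have "(\<lambda>k. l ^ k /\<^sub>R fact k) sums exp l" by (rule exp_converges)
  from sums_mult2[OF this, of "exp (-l)"] show ?thesis
    unfolding poisson_weight_def by (simp add: divide_inverse mult_ac exp_minus)
qed

lemma poisson_weight_Suc: "real (Suc k) * poisson_weight l (Suc k) = l * poisson_weight l k"
  by (simp add: poisson_weight_def divide_simps)

lemma poisson_weight_mean: "(\<lambda>k. real k * poisson_weight l k) sums l"
proof -
  have "(\<lambda>k. real (Suc k) * poisson_weight l (Suc k)) sums (l * 1)"
    unfolding poisson_weight_Suc by (intro sums_mult poisson_weight_sums)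
  then show ?thesis by (subst (asm) sums_Suc_iff) simp
qed

lemma poisson_weight_variance: "(\<lambda>k. (real k - l)\<^sup>2 * poisson_weight l k) sums l"
proof -
  have "(\<lambda>k. (real (Suc k))\<^sup>2 * poisson_weight l (Suc k)) =
      (\<lambda>k. l * (real k * poisson_weight l k + poisson_weight l k))"
    by (rule ext) (simp only: power2_eq_square mult.assoc poisson_weight_Suc, simp add: algebra_simps)
  moreover have "(\<lambda>k. l * (real k * poisson_weight l k + poisson_weight l k)) sums (l * (l + 1))"
    by (intro sums_mult sums_add poisson_weight_mean poisson_weight_sums)
  ultimately have "(\<lambda>k. (real k)\<^sup>2 * poisson_weight l k) sums (l * (l + 1))"
    using sums_Suc_iff[of "\<lambda>k. (real k)\<^sup>2 * poisson_weight l k" "l * (l + 1)"] by simp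
  from sums_add[OF sums_diff[OF this sums_mult[OF poisson_weight_mean, of "2 * l"]]
      sums_mult[OF poisson_weight_sums, of "l\<^sup>2"]]
  have "(\<lambda>k. (real k)\<^sup>2 * poisson_weight l k - 2 * l * (real k * poisson_weight l k) + l\<^sup>2 * poisson_weight l k) sums
      (l * (l + 1) - 2 * l * l + l\<^sup>2 * 1)" .
  then show ?thesis by (simp add: power2_eq_square algebra_simps)
qed

text \<open>
The pathwise compensated integral. It has its meaning for functions that are integrable with respect to
the intensity; for these the first integral exists almost surely (\<open>AE_integrable_N\<close>).
\<close>

definition compensated ::
    "'h::{real_inner,banach,second_countable_topology} measure \<Rightarrow> ('w \<Rightarrow> ('h \<times> real) measure) \<Rightarrow>
      ('h \<times> real \<Rightarrow> 'h) \<Rightarrow> 'w \<Rightarrow> 'h" where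
  "compensated \<nu> N g \<omega> = (\<integral>p. g p \<partial>N \<omega>) - (\<integral>p. g p \<partial>intensity \<nu>)"

locale poisson_setting = prob_space M for M :: "'w measure" +
  fixes F :: "real \<Rightarrow> 'w measure"
    and \<nu> :: "'h::{real_inner,banach,second_countable_topology} measure"
    and N :: "'w \<Rightarrow> ('h \<times> real) measure"
  assumes basis: "usual_filtered_prob_space M F"
    and levy: "levy_measure \<nu>"
    and prm: "poisson_random_measure M F \<nu> N"
begin

abbreviation I where "I \<equiv> intensity \<nu>"

lemma subalg: "subalgebra M (F t)"
  using basis by (auto simp: usual_filtered_prob_space_def)

lemma sets_F_mono: "s \<le> t \<Longrightarrow> sets (F s) \<subseteq> sets (F t)"
  using basis by (auto simp: usual_filtered_prob_space_def filtration_def)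

lemma space_F: "space (F t) = space M"
  using subalg by (auto simp: subalgebra_def)

lemma sets_N: "\<omega> \<in> space M \<Longrightarrow> sets (N \<omega>) = sets I"
  using prm by (auto simp: poisson_random_measure_def)

lemma space_N: "\<omega> \<in> space M \<Longrightarrow> space (N \<omega>) = space I"
  using sets_N sets_eq_imp_space_eq by blast

lemma measurable_N: "\<omega> \<in> space M \<Longrightarrow> f \<in> measurable I S \<longleftrightarrow> f \<in> measurable (N \<omega>) S"
  using sets_N measurable_cong_sets by blast

lemma N_natural: "\<omega> \<in> space M \<Longrightarrow> B \<in> sets I \<Longrightarrow> emeasure (N \<omega>) B \<noteq> \<infinity> \<Longrightarrow>
    \<exists>k::nat. emeasure (N \<omega>) B = of_nat k"
  using prm by (force simp: poisson_random_measure_def)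

lemma emeasure_N_measurable: "B \<in> sets I \<Longrightarrow> (\<lambda>\<omega>. emeasure (N \<omega>) B) \<in> borel_measurable M"
  using prm by (auto simp: poisson_random_measure_def)

lemma prob_N: "B \<in> sets I \<Longrightarrow> emeasure I B < \<infinity> \<Longrightarrow>
    prob {\<omega>\<in>space M. emeasure (N \<omega>) B = of_nat k} = poisson_weight (measure I B) k"
  using prm by (auto simp: poisson_random_measure_def poisson_weight_def)

lemma poisson_weight_nonneg: "0 \<le> l \<Longrightarrow> 0 \<le> poisson_weight l k"
  by (simp add: poisson_weight_def)

lemma AE_N_natural:
  assumes B: "B \<in> sets I" "emeasure I B < \<infinity>"
  shows "AE \<omega> in M. \<exists>k::nat. emeasure (N \<omega>) B = of_nat k"
proof -
  let ?A = "\<lambda>k::nat. {\<omega>\<in>space M. emeasure (N \<omega>) B = of_nat k}"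
  have A: "?A k \<in> events" for k using emeasure_N_measurable[OF B(1)] by measurable
  have "(\<lambda>k. prob (?A k)) sums prob (\<Union>k. ?A k)"
    using A by (intro finite_measure_UNION) (auto simp: disjoint_family_on_def)
  then have "prob (\<Union>k. ?A k) = 1"
    using poisson_weight_sums sums_unique2 by (auto simp: prob_N[OF B])
  then have "AE \<omega> in M. \<omega> \<in> (\<Union>k. ?A k)"
    using A by (subst prob_eq_1[symmetric]) auto
  then show ?thesis by eventually_elim auto
qed

text \<open>
Almost surely the number of points in \<open>B\<close> is finite, hence one of the countably many values whose
probabilities are known. All moments of the Poisson law are instances.
\<close>

lemma nn_integral_of_count:
  fixes h :: "ennreal \<Rightarrow> ennreal"
  assumes B: "B \<in> sets I" "emeasure I B < \<infinity>"
  shows "(\<integral>\<^sup>+\<omega>. h (emeasure (N \<omega>) B) \<partial>M) = (\<Sum>k. h (of_nat k) * ennreal (poisson_weight (measure I B) k))"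
proof -
  let ?A = "\<lambda>k::nat. {\<omega>\<in>space M. emeasure (N \<omega>) B = of_nat k}"
  have A[measurable]: "?A k \<in> events" for k using emeasure_N_measurable[OF B(1)] by measurable
  have "(\<integral>\<^sup>+\<omega>. h (emeasure (N \<omega>) B) \<partial>M) = (\<integral>\<^sup>+\<omega>. (\<Sum>k. h (of_nat k) * indicator (?A k) \<omega>) \<partial>M)"
    using AE_N_natural[OF B] AE_space
  proof (intro nn_integral_cong_AE, eventually_elim)
    fix \<omega> assume "\<exists>k::nat. emeasure (N \<omega>) B = of_nat k" and w: "\<omega> \<in> space M"
    then obtain k :: nat where k: "emeasure (N \<omega>) B = of_nat k" by blast
    have "(\<Sum>j. h (of_nat j) * indicator (?A j) \<omega>) = (\<Sum>j\<in>{k}. h (of_nat j) * indicator (?A j) \<omega>)"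
      using k by (intro suminf_finite) auto
    then show "h (emeasure (N \<omega>) B) = (\<Sum>j. h (of_nat j) * indicator (?A j) \<omega>)"
      using k w by simp
  qed
  also have "\<dots> = (\<Sum>k. h (of_nat k) * emeasure M (?A k))"
    by (subst nn_integral_suminf) (auto simp: nn_integral_cmult)
  finally show ?thesis by (simp add: emeasure_eq_measure prob_N[OF B])
qed

lemma expectation_count: "B \<in> sets I \<Longrightarrow> (\<integral>\<^sup>+\<omega>. emeasure (N \<omega>) B \<partial>M) = emeasure I B"
proof (cases "emeasure I B < \<infinity>")
  case True
  assume B: "B \<in> sets I"
  let ?l = "measure I B"
  have "(\<integral>\<^sup>+\<omega>. emeasure (N \<omega>) B \<partial>M) = (\<Sum>k. ennreal (real k * poisson_weight ?l k))"
    using nn_integral_of_count[OF B True, of "\<lambda>x. x"]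
    by (simp add: ennreal_of_nat_eq_real_of_nat ennreal_mult poisson_weight_nonneg)
  also have "\<dots> = ennreal ?l"
    using poisson_weight_mean[of ?l] by (intro suminf_ennreal_eq) (auto simp: poisson_weight_nonneg)
  finally show ?thesis using True by (simp add: emeasure_eq_ennreal_measure less_top)
next
  case False
  assume B: "B \<in> sets I"
  then have "AE \<omega> in M. emeasure (N \<omega>) B = \<infinity>"
    using False prm by (auto simp: poisson_random_measure_def less_top)
  then have "(\<integral>\<^sup>+\<omega>. emeasure (N \<omega>) B \<partial>M) = (\<integral>\<^sup>+\<omega>. \<infinity> \<partial>M)" by (intro nn_integral_cong_AE)
  also have "\<dots> = emeasure I B" using False by (simp add: emeasure_space_1 top.not_eq_extremum[symmetric])
  finally show ?thesis .
qed

text \<open>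
Measurability is proved with respect to an arbitrary \<open>\<sigma>\<close>-algebra \<open>G\<close> that knows the points in a region
\<open>R\<close>. The past of a time, with \<open>R\<close> a time slab before it, and the \<open>\<sigma>\<close>-algebra of the points after a
time, with \<open>R\<close> a time slab after it, are both needed.
\<close>

lemma measurable_nn_integral_N:
  assumes G: "space G = space M" and R: "R \<in> sets I"
    and meas: "\<And>B. B \<in> sets I \<Longrightarrow> B \<subseteq> R \<Longrightarrow> (\<lambda>\<omega>. emeasure (N \<omega>) B) \<in> borel_measurable G"
    and f: "f \<in> borel_measurable I"
  shows "(\<lambda>\<omega>. \<integral>\<^sup>+p. f p * indicator R p \<partial>N \<omega>) \<in> borel_measurable G"
  using f
proof (induction rule: borel_measurable_induct)
  case (cong f g)
  have "(\<integral>\<^sup>+p. f p * indicator R p \<partial>N \<omega>) = (\<integral>\<^sup>+p. g p * indicator R p \<partial>N \<omega>)" if "\<omega> \<in> space G" for \<omega>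
    using cong(3) that G by (intro nn_integral_cong) (simp add: space_N)
  from measurable_cong[THEN iffD2, OF this cong(4)] show ?case .
next
  case (set A)
  have eq: "(\<integral>\<^sup>+p. indicator A p * indicator R p \<partial>N \<omega>) = emeasure (N \<omega>) (A \<inter> R)" if "\<omega> \<in> space G" for \<omega>
    using set that R G by (simp add: sets_N flip: indicator_inter_arith)
  have "(\<lambda>\<omega>. emeasure (N \<omega>) (A \<inter> R)) \<in> borel_measurable G" using set R by (intro meas) auto
  from measurable_cong[THEN iffD2, OF eq this] show ?case .
next
  case (mult u c)
  have [measurable]: "u \<in> borel_measurable (N \<omega>)" "R \<in> sets (N \<omega>)" if "\<omega> \<in> space G" for \<omega>
    using that mult(2) R G measurable_N[of \<omega> u] sets_N[of \<omega>] by auto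
  have eq: "(\<integral>\<^sup>+p. c * u p * indicator R p \<partial>N \<omega>) = c * (\<integral>\<^sup>+p. u p * indicator R p \<partial>N \<omega>)" if "\<omega> \<in> space G" for \<omega>
    using that by (subst nn_integral_cmult[symmetric]) (auto simp: mult.assoc)
  have "(\<lambda>\<omega>. c * (\<integral>\<^sup>+p. u p * indicator R p \<partial>N \<omega>)) \<in> borel_measurable G"
    using mult(4) by measurable
  from measurable_cong[THEN iffD2, OF eq this] show ?case .
next
  case (add u v)
  have [measurable]: "u \<in> borel_measurable (N \<omega>)" "v \<in> borel_measurable (N \<omega>)" "R \<in> sets (N \<omega>)"
    if "\<omega> \<in> space G" for \<omega>
    using that add(1,3) R G measurable_N[of \<omega> u] measurable_N[of \<omega> v] sets_N[of \<omega>] by auto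
  have eq: "(\<integral>\<^sup>+p. (v p + u p) * indicator R p \<partial>N \<omega>) =
      (\<integral>\<^sup>+p. v p * indicator R p \<partial>N \<omega>) + (\<integral>\<^sup>+p. u p * indicator R p \<partial>N \<omega>)" if "\<omega> \<in> space G" for \<omega>
    using that by (subst nn_integral_add[symmetric]) (auto simp: distrib_right)
  have "(\<lambda>\<omega>. (\<integral>\<^sup>+p. v p * indicator R p \<partial>N \<omega>) + (\<integral>\<^sup>+p. u p * indicator R p \<partial>N \<omega>)) \<in> borel_measurable G"
    using add by (intro borel_measurable_add)
  from measurable_cong[THEN iffD2, OF eq this] show ?case .
next
  case (seq U)
  have [measurable]: "U i \<in> borel_measurable (N \<omega>)" "R \<in> sets (N \<omega>)" if "\<omega> \<in> space G" for \<omega> i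
    using that seq(1) R G measurable_N[of \<omega> "U i"] sets_N[of \<omega>] by auto
  have eq: "(\<integral>\<^sup>+p. (SUP i. U i) p * indicator R p \<partial>N \<omega>) = (SUP i. \<integral>\<^sup>+p. U i p * indicator R p \<partial>N \<omega>)"
    if "\<omega> \<in> space G" for \<omega>
  proof -
    have "incseq (\<lambda>i p. U i p * indicator R p)"
      using seq(3) by (auto simp: incseq_def le_fun_def intro!: mult_right_mono)
    from nn_integral_monotone_convergence_SUP[OF this, of "N \<omega>"] that
    show ?thesis by (simp add: SUP_mult_right_ennreal SUP_apply image_comp)
  qed
  have "(\<lambda>\<omega>. SUP i. \<integral>\<^sup>+p. U i p * indicator R p \<partial>N \<omega>) \<in> borel_measurable G"
    using seq(5) by measurable
  from measurable_cong[THEN iffD2, OF eq this] show ?case by simp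
qed

lemma measurable_nn_integral_N':
  assumes f: "f \<in> borel_measurable I"
  shows "(\<lambda>\<omega>. \<integral>\<^sup>+p. f p \<partial>N \<omega>) \<in> borel_measurable M"
proof -
  have "(\<lambda>\<omega>. \<integral>\<^sup>+p. f p * indicator (space I) p \<partial>N \<omega>) \<in> borel_measurable M"
    using f by (intro measurable_nn_integral_N emeasure_N_measurable) auto
  also have "?this \<longleftrightarrow> ?thesis"
    by (intro measurable_cong nn_integral_cong) (auto simp: space_N)
  finally show ?thesis .
qed

text \<open>
Campbell's formula for nonnegative functions: both sides agree on indicator functions, also on those of
infinite measure.
\<close>

lemma campbell:
  assumes f: "f \<in> borel_measurable I"
  shows "(\<integral>\<^sup>+\<omega>. (\<integral>\<^sup>+p. f p \<partial>N \<omega>) \<partial>M) = (\<integral>\<^sup>+p. f p \<partial>I)"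
  using f
proof (induction rule: borel_measurable_induct)
  case (cong f g)
  have "(\<integral>\<^sup>+\<omega>. (\<integral>\<^sup>+p. f p \<partial>N \<omega>) \<partial>M) = (\<integral>\<^sup>+\<omega>. (\<integral>\<^sup>+p. g p \<partial>N \<omega>) \<partial>M)"
    using cong by (intro nn_integral_cong) (auto simp: space_N)
  moreover have "(\<integral>\<^sup>+p. f p \<partial>I) = (\<integral>\<^sup>+p. g p \<partial>I)" using cong by (intro nn_integral_cong) auto
  ultimately show ?case using cong by simp
next
  case (set A)
  have "(\<integral>\<^sup>+\<omega>. (\<integral>\<^sup>+p. indicator A p \<partial>N \<omega>) \<partial>M) = (\<integral>\<^sup>+\<omega>. emeasure (N \<omega>) A \<partial>M)"
    using set by (intro nn_integral_cong) (simp add: sets_N)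
  then show ?case using set by (simp add: expectation_count)
next
  case (mult u c)
  note [measurable] = measurable_nn_integral_N'[OF mult(2)]
  have "(\<integral>\<^sup>+\<omega>. (\<integral>\<^sup>+p. c * u p \<partial>N \<omega>) \<partial>M) = (\<integral>\<^sup>+\<omega>. c * (\<integral>\<^sup>+p. u p \<partial>N \<omega>) \<partial>M)"
    using mult by (intro nn_integral_cong nn_integral_cmult) (auto simp: measurable_N[symmetric])
  also have "\<dots> = c * (\<integral>\<^sup>+p. u p \<partial>I)" by (subst nn_integral_cmult) (auto simp: mult)
  finally show ?case using mult by (simp add: nn_integral_cmult)
next
  case (add u v)
  note [measurable] = measurable_nn_integral_N'[OF add(1)] measurable_nn_integral_N'[OF add(3)]
  have "(\<integral>\<^sup>+\<omega>. (\<integral>\<^sup>+p. v p + u p \<partial>N \<omega>) \<partial>M) = (\<integral>\<^sup>+\<omega>. (\<integral>\<^sup>+p. v p \<partial>N \<omega>) + (\<integral>\<^sup>+p. u p \<partial>N \<omega>) \<partial>M)"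
    using add by (intro nn_integral_cong nn_integral_add) (auto simp: measurable_N[symmetric])
  also have "\<dots> = (\<integral>\<^sup>+p. v p \<partial>I) + (\<integral>\<^sup>+p. u p \<partial>I)" by (subst nn_integral_add) (auto simp: add)
  finally show ?case using add by (simp add: nn_integral_add)
next
  case (seq U)
  note [measurable] = measurable_nn_integral_N'[OF seq(1)]
  have "(\<integral>\<^sup>+\<omega>. (\<integral>\<^sup>+p. (SUP i. U i) p \<partial>N \<omega>) \<partial>M) = (\<integral>\<^sup>+\<omega>. (SUP i. \<integral>\<^sup>+p. U i p \<partial>N \<omega>) \<partial>M)"
    using seq by (intro nn_integral_cong)
      (auto simp: measurable_N[symmetric] image_comp intro!: nn_integral_monotone_convergence_SUP)
  also have "\<dots> = (SUP i. \<integral>\<^sup>+\<omega>. (\<integral>\<^sup>+p. U i p \<partial>N \<omega>) \<partial>M)"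
    using seq(3) by (intro nn_integral_monotone_convergence_SUP)
      (auto simp: incseq_def le_fun_def intro!: nn_integral_mono)
  also have "\<dots> = (SUP i. \<integral>\<^sup>+p. U i p \<partial>I)" by (simp add: seq)
  also have "\<dots> = (\<integral>\<^sup>+p. (SUP i. U i) p \<partial>I)"
    using seq nn_integral_monotone_convergence_SUP[of U I] by (simp add: image_comp SUP_apply)
  finally show ?case .
qed

lemma AE_integrable_N:
  fixes g :: "'h \<times> real \<Rightarrow> 'b::{banach,second_countable_topology}"
  assumes g: "integrable I g"
  shows "AE \<omega> in M. integrable (N \<omega>) g"
proof -
  have gm: "(\<lambda>p. ennreal (norm (g p))) \<in> borel_measurable I" using g by measurable
  have "(\<integral>\<^sup>+\<omega>. (\<integral>\<^sup>+p. norm (g p) \<partial>N \<omega>) \<partial>M) \<noteq> \<infinity>"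
    using g by (subst campbell[OF gm]) (auto simp: integrable_iff_bounded)
  from nn_integral_noteq_infinite[OF measurable_nn_integral_N'[OF gm] this]
  show ?thesis using AE_space
    by eventually_elim (use g in \<open>auto simp: integrable_iff_bounded measurable_N less_top\<close>)
qed

lemma integral_simple_N:
  fixes s :: "'h \<times> real \<Rightarrow> 'b::{banach,second_countable_topology}"
  assumes s: "simple_function I s" and K: "sets K = sets I" and int: "integrable K s"
  shows "integral\<^sup>L K s = (\<Sum>y\<in>s ` space I - {0}. measure K {p\<in>space I. s p = y} *\<^sub>R y)"
proof -
  have sp: "space K = space I" by (rule sets_eq_imp_space_eq[OF K])
  have "simple_function K s" using s simple_function_cong_algebra[OF K sp] by blast
  moreover have "(\<integral>\<^sup>+p. norm (s p) \<partial>K) < \<infinity>" using int by (simp add: integrable_iff_bounded)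
  ultimately have sb: "Bochner_Integration.simple_bochner_integrable K s" by (rule simple_bochner_integrableI_bounded)
  have fin: "finite (s ` space I)" using s by (simp add: simple_function_def)
  have "integral\<^sup>L K s = (\<Sum>y\<in>s ` space I. measure K {p\<in>space I. s p = y} *\<^sub>R y)"
    using simple_bochner_integrable_eq_integral[OF sb] by (simp add: simple_bochner_integral_def sp)
  also have "\<dots> = (\<Sum>y\<in>s ` space I - {0}. measure K {p\<in>space I. s p = y} *\<^sub>R y)"
    using fin by (intro sum.mono_neutral_right) auto
  finally show ?thesis .
qed

text \<open>
On the measurable set where the function is integrable its integral is the limit, by dominated
convergence, of integrals of simple functions, and these are finite combinations of numbers of points.
Off this set the Bochner integral has the default value \<open>0\<close>.
\<close>

lemma measurable_integral_N:
  fixes g :: "'h \<times> real \<Rightarrow> 'b::{banach,second_countable_topology}"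
  assumes G: "space G = space M" and R: "R \<in> sets I"
    and meas: "\<And>B. B \<in> sets I \<Longrightarrow> B \<subseteq> R \<Longrightarrow> (\<lambda>\<omega>. emeasure (N \<omega>) B) \<in> borel_measurable G"
    and g: "g \<in> borel_measurable I" and g0: "\<And>p. p \<in> space I \<Longrightarrow> p \<notin> R \<Longrightarrow> g p = 0"
  shows "(\<lambda>\<omega>. \<integral>p. g p \<partial>N \<omega>) \<in> borel_measurable G"
proof -
  obtain s where s: "\<And>i. simple_function I (s i)" "\<And>p. p \<in> space I \<Longrightarrow> (\<lambda>i. s i p) \<longlonglongrightarrow> g p"
    "\<And>i p. p \<in> space I \<Longrightarrow> norm (s i p) \<le> 2 * norm (g p)"
    using borel_measurable_implies_sequence_metric[OF g, of 0] unfolding dist_0_norm dist_norm diff_0_right by blast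
  define T where "T i \<omega> = (\<Sum>y\<in>s i ` space I - {0}. measure (N \<omega>) {p\<in>space I. s i p = y} *\<^sub>R y)" for i \<omega>
  define U where "U = {\<omega>\<in>space G. (\<integral>\<^sup>+p. ennreal (norm (g p)) * indicator R p \<partial>N \<omega>) < \<infinity>}"
  have "(\<lambda>\<omega>. \<integral>\<^sup>+p. ennreal (norm (g p)) * indicator R p \<partial>N \<omega>) \<in> borel_measurable G"
    using g by (intro measurable_nn_integral_N[OF G R meas]) auto
  then have U[measurable]: "U \<in> sets G"
    unfolding U_def by (rule borel_measurable_less) simp
  have [measurable]: "(\<lambda>\<omega>. measure (N \<omega>) {p\<in>space I. s i p = y}) \<in> borel_measurable G" if "y \<noteq> 0" for i y
  proof -
    have "{p\<in>space I. s i p = y} \<subseteq> R"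
      using s(3)[of _ i] g0 that by force
    moreover have "{p\<in>space I. s i p = y} \<in> sets I"
      using simple_functionD(2)[OF s(1)[of i], of "{y}"] by (simp add: vimage_def Int_def conj_commute)
    ultimately show ?thesis unfolding measure_def by (intro measurable_compose[OF meas]) auto
  qed
  have T[measurable]: "T i \<in> borel_measurable G" for i
    unfolding T_def by measurable
  have "(\<lambda>\<omega>. indicator U \<omega> *\<^sub>R (\<integral>p. g p \<partial>N \<omega>)) \<in> borel_measurable G"
  proof (rule borel_measurable_LIMSEQ_metric)
    show "(\<lambda>\<omega>. indicator U \<omega> *\<^sub>R T i \<omega>) \<in> borel_measurable G" for i by measurable
    fix \<omega> assume w: "\<omega> \<in> space G"
    then have wM: "\<omega> \<in> space M" using G by simp
    show "(\<lambda>i. indicator U \<omega> *\<^sub>R T i \<omega>) \<longlonglongrightarrow> indicator U \<omega> *\<^sub>R (\<integral>p. g p \<partial>N \<omega>)"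
    proof (cases "\<omega> \<in> U")
      case True
      have "(\<integral>\<^sup>+p. norm (g p) \<partial>N \<omega>) = (\<integral>\<^sup>+p. ennreal (norm (g p)) * indicator R p \<partial>N \<omega>)"
        using g0 wM by (intro nn_integral_cong) (auto simp: space_N indicator_def)
      then have int: "integrable (N \<omega>) g"
        using g True wM by (auto simp: integrable_iff_bounded measurable_N[symmetric] U_def)
      have sm: "s i \<in> borel_measurable (N \<omega>)" for i
        using borel_measurable_simple_function[OF s(1)] wM by (simp add: measurable_N[symmetric])
      have ints: "integrable (N \<omega>) (s i)" for i
        using s(3) wM sm
        by (intro Bochner_Integration.integrable_bound[OF integrable_mult_right[OF integrable_norm[OF int], of 2]])
          (auto simp: space_N)
      have "(\<lambda>i. integral\<^sup>L (N \<omega>) (s i)) \<longlonglongrightarrow> integral\<^sup>L (N \<omega>) g"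
        using int sm s wM by (intro integral_dominated_convergence[where w="\<lambda>p. 2 * norm (g p)"])
          (auto simp: space_N)
      moreover have "integral\<^sup>L (N \<omega>) (s i) = T i \<omega>" for i
        unfolding T_def by (rule integral_simple_N[OF s(1) sets_N[OF wM] ints])
      ultimately show ?thesis using True by simp
    qed simp
  qed
  moreover have "indicator U \<omega> *\<^sub>R (\<integral>p. g p \<partial>N \<omega>) = (\<integral>p. g p \<partial>N \<omega>)" if w: "\<omega> \<in> space G" for \<omega>
  proof (cases "\<omega> \<in> U")
    case False
    then have "\<not> (\<integral>\<^sup>+p. ennreal (norm (g p)) * indicator R p \<partial>N \<omega>) < \<infinity>" using w by (auto simp: U_def)
    moreover have "(\<integral>\<^sup>+p. ennreal (norm (g p)) * indicator R p \<partial>N \<omega>) = (\<integral>\<^sup>+p. norm (g p) \<partial>N \<omega>)"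
      using g0 w G by (intro nn_integral_cong) (auto simp: space_N indicator_def)
    ultimately have "\<not> integrable (N \<omega>) g" by (auto simp: integrable_iff_bounded)
    then show ?thesis by (simp add: not_integrable_integral_eq)
  qed simp
  ultimately show ?thesis by (simp cong: measurable_cong)
qed

lemma measurable_compensated:
  assumes g: "g \<in> borel_measurable I"
  shows "compensated \<nu> N g \<in> borel_measurable M"
proof -
  have "(\<lambda>\<omega>. \<integral>p. g p \<partial>N \<omega>) \<in> borel_measurable M"
    by (rule measurable_integral_N[where R="space I"]) (use g in \<open>auto intro: emeasure_N_measurable\<close>)
  then show ?thesis unfolding compensated_def[abs_def] by measurable
qed

lemma AE_compensated_diff:
  assumes "integrable I f" "integrable I g"
  shows "AE \<omega> in M. compensated \<nu> N (\<lambda>p. f p - g p) \<omega> = compensated \<nu> N f \<omega> - compensated \<nu> N g \<omega>"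
  using AE_integrable_N[OF assms(1)] AE_integrable_N[OF assms(2)]
  by eventually_elim (use assms in \<open>simp add: compensated_def\<close>)

section \<open>The Ito isometry\<close>

definition centred :: "('h \<times> real) set \<Rightarrow> 'w \<Rightarrow> real" where
  "centred B \<omega> = measure (N \<omega>) B - measure I B"

lemma centred_measurable: "B \<in> sets I \<Longrightarrow> centred B \<in> borel_measurable M"
  unfolding centred_def[abs_def] measure_def
  by (intro borel_measurable_diff borel_measurable_const measurable_compose[OF emeasure_N_measurable]) auto

lemma nn_integral_centred_square:
  assumes B: "B \<in> sets I" "emeasure I B < \<infinity>"
  shows "(\<integral>\<^sup>+\<omega>. ennreal ((centred B \<omega>)\<^sup>2) \<partial>M) = ennreal (measure I B)"
proof -
  let ?l = "measure I B"
  have enn2real_of_nat: "enn2real (of_nat k) = real k" for k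
    by (simp add: ennreal_of_nat_eq_real_of_nat)
  have "(\<integral>\<^sup>+\<omega>. ennreal ((centred B \<omega>)\<^sup>2) \<partial>M) = (\<Sum>k. ennreal ((real k - ?l)\<^sup>2 * poisson_weight ?l k))"
    using nn_integral_of_count[OF B, of "\<lambda>x. ennreal ((enn2real x - ?l)\<^sup>2)"]
    by (simp add: centred_def measure_def enn2real_of_nat ennreal_mult poisson_weight_nonneg)
  also have "\<dots> = ennreal ?l"
    using poisson_weight_variance[of ?l] by (intro suminf_ennreal_eq) (auto simp: poisson_weight_nonneg)
  finally show ?thesis .
qed

lemma centred_moments:
  assumes B: "B \<in> sets I" "emeasure I B < \<infinity>"
  shows "integrable M (\<lambda>\<omega>. (centred B \<omega>)\<^sup>2)" "expectation (\<lambda>\<omega>. (centred B \<omega>)\<^sup>2) = measure I B"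
    and "integrable M (centred B)" "expectation (centred B) = 0"
proof -
  note [measurable] = centred_measurable[OF B(1)] emeasure_N_measurable[OF B(1)]
  show sq: "integrable M (\<lambda>\<omega>. (centred B \<omega>)\<^sup>2)"
    using nn_integral_centred_square[OF B] by (intro integrableI_nonneg) auto
  show "expectation (\<lambda>\<omega>. (centred B \<omega>)\<^sup>2) = measure I B"
    using nn_integral_centred_square[OF B] by (subst integral_eq_nn_integral) auto
  show int: "integrable M (centred B)"
    by (rule square_integrable_imp_integrable[OF _ sq]) measurable
  have "(\<integral>\<^sup>+\<omega>. ennreal (measure (N \<omega>) B) \<partial>M) = (\<integral>\<^sup>+\<omega>. emeasure (N \<omega>) B \<partial>M)"
    using AE_N_natural[OF B]
    by (intro nn_integral_cong_AE, eventually_elim) (auto simp: measure_def ennreal_of_nat_eq_real_of_nat)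
  then have "expectation (\<lambda>\<omega>. measure (N \<omega>) B) = measure I B"
    unfolding expectation_count[OF B(1)] by (subst integral_eq_nn_integral) (auto simp: measure_def)
  moreover have "integrable M (\<lambda>\<omega>. measure (N \<omega>) B)"
    using Bochner_Integration.integrable_add[OF int, of "\<lambda>_. measure I B"] by (simp add: centred_def)
  ultimately show "expectation (centred B) = 0"
    by (simp add: centred_def[abs_def] prob_space)
qed

text \<open>
Independence is given for sequences of sets; two sets are completed by the empty set.
\<close>

lemma indep_counts:
  assumes "B \<in> sets I" "B' \<in> sets I" "B \<inter> B' = {}"
  shows "indep_vars (\<lambda>_. borel) (\<lambda>i \<omega>. emeasure (N \<omega>) (if i = 0 then B else B')) {0, 1::nat}"
proof -
  let ?f = "\<lambda>i::nat. if i = 0 then B else if i = 1 then B' else {}"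
  have "range ?f \<subseteq> sets I" "disjoint_family ?f"
    using assms by (auto simp: disjoint_family_on_def)
  then have "indep_vars (\<lambda>_. borel) (\<lambda>i \<omega>. emeasure (N \<omega>) (?f i)) UNIV"
    using prm unfolding poisson_random_measure_def by blast
  then have "indep_vars (\<lambda>_. borel) (\<lambda>i \<omega>. emeasure (N \<omega>) (?f i)) {0, 1}"
    by (rule indep_vars_subset) simp
  also have "?this \<longleftrightarrow> ?thesis"
    by (intro indep_vars_cong) auto
  finally show ?thesis .
qed

lemma centred_uncorrelated:
  assumes B: "B \<in> sets I" "emeasure I B < \<infinity>" and B': "B' \<in> sets I" "emeasure I B' < \<infinity>"
    and dis: "B \<inter> B' = {}"
  shows "integrable M (\<lambda>\<omega>. centred B \<omega> * centred B' \<omega>)" "expectation (\<lambda>\<omega>. centred B \<omega> * centred B' \<omega>) = 0"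
proof -
  let ?X = "\<lambda>i::nat. centred (if i = 0 then B else B')"
  have "indep_vars (\<lambda>_. borel) (\<lambda>i \<omega>. enn2real (emeasure (N \<omega>) (if i = 0 then B else B'))
      - measure I (if i = 0 then B else B')) {0, 1::nat}"
    by (rule indep_vars_compose2[OF indep_counts[OF B(1) B'(1) dis]]) measurable
  then have ind: "indep_vars (\<lambda>_. borel) ?X {0, 1}"
    by (simp add: centred_def[abs_def] measure_def)
  have int: "integrable M (?X i)" for i using centred_moments(3)[OF B] centred_moments(3)[OF B'] by simp
  show "integrable M (\<lambda>\<omega>. centred B \<omega> * centred B' \<omega>)"
    using indep_vars_integrable[OF _ ind int] by simp
  show "expectation (\<lambda>\<omega>. centred B \<omega> * centred B' \<omega>) = 0"
    using indep_vars_lebesgue_integral[OF _ ind int] centred_moments(4)[OF B] by simp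
qed

text \<open>
The compensated integral of a simple function is a combination of the centred numbers of points in its
level sets. These are uncorrelated, and the variance of a Poisson variable is its mean.
\<close>

lemma isometry_simple:
  assumes s: "simple_function I s" and int: "integrable I s"
  shows "(\<integral>\<^sup>+\<omega>. ennreal ((norm (compensated \<nu> N s \<omega>))\<^sup>2) \<partial>M) = (\<integral>\<^sup>+p. ennreal ((norm (s p))\<^sup>2) \<partial>I)"
proof -
  define Y where "Y = s ` space I - {0}"
  define A where "A y = {p\<in>space I. s p = y}" for y
  have fin: "finite Y" using s by (auto simp: Y_def simple_function_def)
  have A: "A y \<in> sets I" for y
    using simple_functionD(2)[OF s, of "{y}"] by (simp add: A_def vimage_def Int_def conj_commute)
  have finA: "emeasure I (A y) < \<infinity>" if "y \<in> Y" for y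
  proof -
    have "ennreal (norm y) * emeasure I (A y) = (\<integral>\<^sup>+p. ennreal (norm y) * indicator (A y) p \<partial>I)"
      using A by (simp add: nn_integral_cmult_indicator)
    also have "\<dots> \<le> (\<integral>\<^sup>+p. norm (s p) \<partial>I)"
      by (intro nn_integral_mono) (auto simp: A_def indicator_def)
    also have "\<dots> < \<infinity>" using int by (simp add: integrable_iff_bounded)
    finally show ?thesis using that by (auto simp: Y_def ennreal_mult_less_top)
  qed
  have emA: "emeasure I (A y) = ennreal (measure I (A y))" if "y \<in> Y" for y
    using finA[OF that] by (intro emeasure_eq_ennreal_measure) auto
  have Cs: "AE \<omega> in M. compensated \<nu> N s \<omega> = (\<Sum>y\<in>Y. centred (A y) \<omega> *\<^sub>R y)"
    using AE_integrable_N[OF int] AE_space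
    by eventually_elim
      (simp add: compensated_def integral_simple_N[OF s sets_N] integral_simple_N[OF s refl int]
        centred_def scaleR_diff_left sum_subtractf Y_def A_def)
  have sq: "(norm (\<Sum>y\<in>Y. centred (A y) \<omega> *\<^sub>R y))\<^sup>2 =
      (\<Sum>y\<in>Y. \<Sum>y'\<in>Y. (y \<bullet> y') * (centred (A y) \<omega> * centred (A y') \<omega>))" for \<omega>
    by (simp add: power2_norm_eq_inner inner_sum_left inner_sum_right sum_distrib_left inner_commute mult_ac)
  have ints: "integrable M (\<lambda>\<omega>. centred (A y) \<omega> * centred (A y') \<omega>)"
    and exps: "expectation (\<lambda>\<omega>. centred (A y) \<omega> * centred (A y') \<omega>) = (if y = y' then measure I (A y) else 0)"
    if "y \<in> Y" "y' \<in> Y" for y y'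
  proof -
    have "A y \<inter> A y' = {}" if "y \<noteq> y'" using that by (auto simp: A_def)
    then show "integrable M (\<lambda>\<omega>. centred (A y) \<omega> * centred (A y') \<omega>)"
      "expectation (\<lambda>\<omega>. centred (A y) \<omega> * centred (A y') \<omega>) = (if y = y' then measure I (A y) else 0)"
      using centred_uncorrelated[OF A finA A finA, of y y'] centred_moments(1,2)[OF A finA, of y] that
      by (cases "y = y'"; simp add: power2_eq_square)+
  qed
  have "(\<integral>\<^sup>+\<omega>. ennreal ((norm (compensated \<nu> N s \<omega>))\<^sup>2) \<partial>M) =
      (\<integral>\<^sup>+\<omega>. ennreal ((norm (\<Sum>y\<in>Y. centred (A y) \<omega> *\<^sub>R y))\<^sup>2) \<partial>M)"
    using Cs by (intro nn_integral_cong_AE, eventually_elim) simp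
  also have "\<dots> = ennreal (expectation (\<lambda>\<omega>. (norm (\<Sum>y\<in>Y. centred (A y) \<omega> *\<^sub>R y))\<^sup>2))"
  proof (rule nn_integral_eq_integral)
    show "integrable M (\<lambda>\<omega>. (norm (\<Sum>y\<in>Y. centred (A y) \<omega> *\<^sub>R y))\<^sup>2)"
      unfolding sq by (intro Bochner_Integration.integrable_sum integrable_mult_right ints)
  qed simp
  also have "expectation (\<lambda>\<omega>. (norm (\<Sum>y\<in>Y. centred (A y) \<omega> *\<^sub>R y))\<^sup>2) =
      (\<Sum>y\<in>Y. \<Sum>y'\<in>Y. (y \<bullet> y') * (if y = y' then measure I (A y) else 0))"
    unfolding sq by (simp add: ints exps Bochner_Integration.integral_sum Bochner_Integration.integrable_sum cong: sum.cong)
  also have "\<dots> = (\<Sum>y\<in>Y. (norm y)\<^sup>2 * measure I (A y))"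
    using fin by (intro sum.cong refl) (simp add: if_distrib power2_norm_eq_inner cong: if_cong)
  also have "ennreal \<dots> = (\<Sum>y\<in>Y. ennreal ((norm y)\<^sup>2) * emeasure I (A y))"
    by (subst sum_ennreal[symmetric]) (auto simp: ennreal_mult emA intro!: sum.cong)
  also have "\<dots> = (\<integral>\<^sup>+p. (\<Sum>y\<in>Y. ennreal ((norm y)\<^sup>2) * indicator (A y) p) \<partial>I)"
    using A by (subst nn_integral_sum) (auto simp: nn_integral_cmult_indicator)
  also have "\<dots> = (\<integral>\<^sup>+p. ennreal ((norm (s p))\<^sup>2) \<partial>I)"
  proof (intro nn_integral_cong)
    fix p assume p: "p \<in> space I"
    have "(\<Sum>y\<in>Y. ennreal ((norm y)\<^sup>2) * indicator (A y) p) = (\<Sum>y\<in>Y. if y = s p then ennreal ((norm y)\<^sup>2) else 0)"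
      using p by (intro sum.cong) (auto simp: A_def)
    also have "\<dots> = ennreal ((norm (s p))\<^sup>2)"
      using fin p by (auto simp: Y_def)
    finally show "(\<Sum>y\<in>Y. ennreal ((norm y)\<^sup>2) * indicator (A y) p) = ennreal ((norm (s p))\<^sup>2)" .
  qed
  finally show ?thesis .
qed

text \<open>
The simple functions that approximate \<open>g\<close> are dominated by \<open>2 * norm (g p)\<close>. Hence for almost every
\<open>\<omega>\<close> their compensated integrals converge by dominated convergence with respect to \<open>N \<omega>\<close>, and Fatou's
lemma gives the bound.
\<close>

lemma isometry_le:
  assumes g: "integrable I g"
  shows "(\<integral>\<^sup>+\<omega>. ennreal ((norm (compensated \<nu> N g \<omega>))\<^sup>2) \<partial>M) \<le> (\<integral>\<^sup>+p. ennreal ((norm (g p))\<^sup>2) \<partial>I)"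
proof (cases "(\<integral>\<^sup>+p. ennreal ((norm (g p))\<^sup>2) \<partial>I) = \<infinity>")
  case False
  have gm[measurable]: "g \<in> borel_measurable I" using g by simp
  obtain s where s: "\<And>i. simple_function I (s i)" "\<And>p. p \<in> space I \<Longrightarrow> (\<lambda>i. s i p) \<longlonglongrightarrow> g p"
    "\<And>i p. p \<in> space I \<Longrightarrow> norm (s i p) \<le> 2 * norm (g p)"
    using borel_measurable_implies_sequence_metric[OF gm, of 0] unfolding dist_0_norm dist_norm diff_0_right by blast
  have sm[measurable]: "s i \<in> borel_measurable I" for i by (rule borel_measurable_simple_function[OF s(1)])
  have conv: "integrable K (s i)" "(\<lambda>i. integral\<^sup>L K (s i)) \<longlonglongrightarrow> integral\<^sup>L K g"
    if K: "sets K = sets I" and gK: "integrable K g" for K i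
  proof -
    have sp: "space K = space I" by (rule sets_eq_imp_space_eq[OF K])
    have m: "s i \<in> borel_measurable K" for i using sm measurable_cong_sets[OF K refl] by blast
    show "integrable K (s i)"
      by (rule Bochner_Integration.integrable_bound[OF integrable_mult_right[OF integrable_norm[OF gK], of 2]])
        (use m s(3) sp in auto)
    show "(\<lambda>i. integral\<^sup>L K (s i)) \<longlonglongrightarrow> integral\<^sup>L K g"
      by (rule integral_dominated_convergence[where w="\<lambda>p. 2 * norm (g p)"])
        (use gK m s sp in auto)
  qed
  have "AE \<omega> in M. (\<lambda>i. compensated \<nu> N (s i) \<omega>) \<longlonglongrightarrow> compensated \<nu> N g \<omega>"
    using AE_integrable_N[OF g] AE_space
    by eventually_elim (auto simp: compensated_def intro!: tendsto_diff conv sets_N g)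
  then have "(\<integral>\<^sup>+\<omega>. ennreal ((norm (compensated \<nu> N g \<omega>))\<^sup>2) \<partial>M) =
      (\<integral>\<^sup>+\<omega>. liminf (\<lambda>i. ennreal ((norm (compensated \<nu> N (s i) \<omega>))\<^sup>2)) \<partial>M)"
    by (intro nn_integral_cong_AE, eventually_elim)
      (intro lim_imp_Liminf[symmetric] tendsto_ennrealI tendsto_power tendsto_norm, auto)
  also have "\<dots> \<le> liminf (\<lambda>i. \<integral>\<^sup>+\<omega>. ennreal ((norm (compensated \<nu> N (s i) \<omega>))\<^sup>2) \<partial>M)"
    using measurable_compensated[OF sm] by (intro nn_integral_liminf) measurable
  also have "\<dots> = liminf (\<lambda>i. \<integral>\<^sup>+p. ennreal ((norm (s i p))\<^sup>2) \<partial>I)"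
    by (simp add: isometry_simple[OF s(1) conv(1)[OF refl g]])
  also have "(\<lambda>i. \<integral>\<^sup>+p. ennreal ((norm (s i p))\<^sup>2) \<partial>I) \<longlonglongrightarrow> (\<integral>\<^sup>+p. ennreal ((norm (g p))\<^sup>2) \<partial>I)"
  proof (rule nn_integral_dominated_convergence[where w="\<lambda>p. ennreal (4 * (norm (g p))\<^sup>2)"])
    show "AE p in I. ennreal ((norm (s i p))\<^sup>2) \<le> ennreal (4 * (norm (g p))\<^sup>2)" for i
    proof (intro AE_I2 ennreal_leI)
      fix p assume "p \<in> space I"
      from power_mono[OF s(3)[OF this], of i 2] show "(norm (s i p))\<^sup>2 \<le> 4 * (norm (g p))\<^sup>2"
        by (simp add: power_mult_distrib)
    qed
    show "(\<integral>\<^sup>+p. ennreal (4 * (norm (g p))\<^sup>2) \<partial>I) < \<infinity>"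
      using False by (simp add: ennreal_mult nn_integral_cmult ennreal_mult_less_top less_top)
    show "AE p in I. (\<lambda>i. ennreal ((norm (s i p))\<^sup>2)) \<longlonglongrightarrow> ennreal ((norm (g p))\<^sup>2)"
      by (intro AE_I2 tendsto_ennrealI tendsto_power tendsto_norm s)
  qed measurable
  then have "liminf (\<lambda>i. \<integral>\<^sup>+p. ennreal ((norm (s i p))\<^sup>2) \<partial>I) = (\<integral>\<^sup>+p. ennreal ((norm (g p))\<^sup>2) \<partial>I)"
    by (intro lim_imp_Liminf) auto
  finally show ?thesis .
qed simp

section \<open>Jumps of prescribed size\<close>

lemma sets_nu: "sets \<nu> = sets borel"
  and nu_min: "(\<integral>\<^sup>+z. ennreal (min ((norm z)\<^sup>2) 1) \<partial>\<nu>) < \<infinity>"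
  using levy by (auto simp: levy_measure_def)

lemma measurable_nu: "f \<in> measurable borel S \<Longrightarrow> f \<in> measurable \<nu> S"
  using sets_nu measurable_cong_sets by blast

lemma sets_I_times: "A \<in> sets borel \<Longrightarrow> 0 \<le> u \<Longrightarrow> A \<times> {u<..v} \<in> sets I"
  unfolding intensity_def by (intro pair_measureI) (auto simp: sets_nu sets_restrict_space_iff)

text \<open>
Jump sizes and times separate: a time slab contributes its length.
\<close>

lemma nn_integral_I_times:
  assumes A: "A \<in> sets borel" and h: "h \<in> borel_measurable borel" and uv: "0 \<le> u" "u \<le> v"
  shows "(\<integral>\<^sup>+p. h (fst p) * indicator (A \<times> {u<..v}) p \<partial>I) = ennreal (v - u) * (\<integral>\<^sup>+z. h z * indicator A z \<partial>\<nu>)"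
proof -
  let ?T = "restrict_space lborel {0::real..}"
  interpret T: sigma_finite_measure ?T
    by (rule sigma_finite_measure_restrict_space) (auto intro: lborel.sigma_finite_measure_axioms)
  have T: "{u<..v} \<in> sets ?T" using uv by (auto simp: sets_restrict_space_iff)
  have eT: "emeasure ?T {u<..v} = ennreal (v - u)"
    using uv by (subst emeasure_restrict_space) auto
  note [measurable] = measurable_nu[OF h] T
  have [measurable]: "A \<in> sets \<nu>" using A sets_nu by simp
  have "(\<integral>\<^sup>+p. h (fst p) * indicator (A \<times> {u<..v}) p \<partial>I) =
      (\<integral>\<^sup>+z. \<integral>\<^sup>+s. h z * indicator A z * indicator {u<..v} s \<partial>?T \<partial>\<nu>)"
    unfolding intensity_def
    by (subst T.nn_integral_fst[symmetric]) (auto simp: indicator_times mult.assoc)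
  also have "\<dots> = (\<integral>\<^sup>+z. ennreal (v - u) * (h z * indicator A z) \<partial>\<nu>)"
    using T by (intro nn_integral_cong) (subst nn_integral_cmult_indicator, auto simp: eT mult.commute)
  also have "\<dots> = ennreal (v - u) * (\<integral>\<^sup>+z. h z * indicator A z \<partial>\<nu>)"
    by (rule nn_integral_cmult) measurable
  finally show ?thesis .
qed

lemma emeasure_I_times:
  assumes "A \<in> sets borel" "0 \<le> u" "u \<le> v"
  shows "emeasure I (A \<times> {u<..v}) = ennreal (v - u) * emeasure \<nu> A"
  using nn_integral_I_times[OF assms(1) _ assms(2,3), of "\<lambda>_. 1"] sets_I_times[OF assms(1,2), of v] assms(1) sets_nu
  by simp

lemma nu_away_finite:
  assumes "\<kappa> > 0"
  shows "emeasure \<nu> {z. \<kappa> < norm z} < \<infinity>"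
proof -
  let ?c = "min (\<kappa>\<^sup>2) 1"
  have A: "{z. \<kappa> < norm z} \<in> sets \<nu>" unfolding sets_nu by measurable
  have "ennreal ?c * emeasure \<nu> {z. \<kappa> < norm z} = (\<integral>\<^sup>+z. ennreal ?c * indicator {z. \<kappa> < norm z} z \<partial>\<nu>)"
    using A by (simp add: nn_integral_cmult_indicator)
  also have "\<dots> \<le> (\<integral>\<^sup>+z. ennreal (min ((norm z)\<^sup>2) 1) \<partial>\<nu>)"
    using assms by (intro nn_integral_mono) (auto simp: indicator_def intro!: ennreal_leI min.mono min.coboundedI1 power_mono)
  also note nu_min
  finally have "ennreal ?c * emeasure \<nu> {z. \<kappa> < norm z} < \<infinity>" .
  moreover have "?c > 0" using assms by simp
  ultimately show ?thesis by (auto simp: ennreal_mult_less_top)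
qed

lemma nu_small_square_finite: "(\<integral>\<^sup>+z. ennreal ((norm z)\<^sup>2) * indicator {z. 0 < norm z \<and> norm z \<le> 1} z \<partial>\<nu>) < \<infinity>"
proof -
  have "(\<integral>\<^sup>+z. ennreal ((norm z)\<^sup>2) * indicator {z. 0 < norm z \<and> norm z \<le> 1} z \<partial>\<nu>) \<le>
      (\<integral>\<^sup>+z. ennreal (min ((norm z)\<^sup>2) 1) \<partial>\<nu>)"
    by (intro nn_integral_mono) (auto simp: indicator_def min_def power_le_one)
  from this nu_min show ?thesis by (rule le_less_trans)
qed

lemma nu_small_square_tendsto:
  assumes e: "e \<longlonglongrightarrow> 0" and e1: "\<And>k::nat. e k \<le> 1"
  shows "(\<lambda>k. \<integral>\<^sup>+z. ennreal ((norm z)\<^sup>2) * indicator {z. 0 < norm z \<and> norm z \<le> e k} z \<partial>\<nu>) \<longlonglongrightarrow> 0"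
proof -
  note [measurable_cong] = sets_nu
  have "(\<lambda>k. \<integral>\<^sup>+z. ennreal ((norm z)\<^sup>2) * indicator {z. 0 < norm z \<and> norm z \<le> e k} z \<partial>\<nu>) \<longlonglongrightarrow> (\<integral>\<^sup>+z. 0 \<partial>\<nu>)"
  proof (rule nn_integral_dominated_convergence[OF _ _ _ _ nu_small_square_finite])
    show "AE z in \<nu>. ennreal ((norm z)\<^sup>2) * indicator {z. 0 < norm z \<and> norm z \<le> e k} z
        \<le> ennreal ((norm z)\<^sup>2) * indicator {z. 0 < norm z \<and> norm z \<le> 1} z" for k
      using e1[of k] by (intro AE_I2 mult_left_mono) (auto simp: indicator_def)
    show "AE z in \<nu>. (\<lambda>k. ennreal ((norm z)\<^sup>2) * indicator {z. 0 < norm z \<and> norm z \<le> e k} z) \<longlonglongrightarrow> 0"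
    proof (intro AE_I2 tendsto_eventually)
      fix z
      show "\<forall>\<^sub>F k in sequentially. ennreal ((norm z)\<^sup>2) * indicator {z. 0 < norm z \<and> norm z \<le> e k} z = 0"
      proof (cases "z = 0")
        case False
        then have "\<forall>\<^sub>F k in sequentially. e k < norm z" using order_tendstoD(2)[OF e] by simp
        then show ?thesis by eventually_elim simp
      qed simp
    qed
  qed measurable
  then show ?thesis by simp
qed

definition jumps :: "'h set \<Rightarrow> real \<Rightarrow> real \<Rightarrow> 'h \<times> real \<Rightarrow> 'h" where
  "jumps A u v p = indicator (A \<times> {u<..v}) p *\<^sub>R fst p"

lemma jumps_measurable:
  assumes "A \<in> sets borel" "0 \<le> u"
  shows "jumps A u v \<in> borel_measurable I"
proof -
  note [measurable] = sets_I_times[OF assms]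
  have [measurable]: "fst \<in> measurable I borel"
    unfolding intensity_def using measurable_fst measurable_cong_sets[OF refl sets_nu] by blast
  show ?thesis unfolding jumps_def[abs_def] by measurable
qed

lemma nn_integral_norm_jumps:
  assumes A: "A \<in> sets borel" and uv: "0 \<le> u" "u \<le> v"
  shows "(\<integral>\<^sup>+p. ennreal (norm (jumps A u v p)) \<partial>I) = ennreal (v - u) * (\<integral>\<^sup>+z. ennreal (norm z) * indicator A z \<partial>\<nu>)"
    and "(\<integral>\<^sup>+p. ennreal ((norm (jumps A u v p))\<^sup>2) \<partial>I) = ennreal (v - u) * (\<integral>\<^sup>+z. ennreal ((norm z)\<^sup>2) * indicator A z \<partial>\<nu>)"
proof -
  have "ennreal (norm (jumps A u v p)) = ennreal (norm (fst p)) * indicator (A \<times> {u<..v}) p"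
    "ennreal ((norm (jumps A u v p))\<^sup>2) = ennreal ((norm (fst p))\<^sup>2) * indicator (A \<times> {u<..v}) p" for p
    by (auto simp: jumps_def indicator_def)
  then show "(\<integral>\<^sup>+p. ennreal (norm (jumps A u v p)) \<partial>I) = ennreal (v - u) * (\<integral>\<^sup>+z. ennreal (norm z) * indicator A z \<partial>\<nu>)"
    "(\<integral>\<^sup>+p. ennreal ((norm (jumps A u v p))\<^sup>2) \<partial>I) = ennreal (v - u) * (\<integral>\<^sup>+z. ennreal ((norm z)\<^sup>2) * indicator A z \<partial>\<nu>)"
    using nn_integral_I_times[OF A _ uv, of "\<lambda>z. ennreal (norm z)"]
      nn_integral_I_times[OF A _ uv, of "\<lambda>z. ennreal ((norm z)\<^sup>2)"] by simp_all
qed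

lemma integrable_jumps:
  assumes \<kappa>: "\<kappa> > 0" and uv: "0 \<le> u" "u \<le> v"
  shows "integrable I (jumps {z. \<kappa> < norm z \<and> norm z \<le> 1} u v)"
    and "norm (\<integral>p. jumps {z. \<kappa> < norm z \<and> norm z \<le> 1} u v p \<partial>I) \<le> (v - u) * measure \<nu> {z. \<kappa> < norm z}"
proof -
  let ?A = "{z::'h. \<kappa> < norm z \<and> norm z \<le> 1}" and ?K = "{z::'h. \<kappa> < norm z}"
  have A: "?A \<in> sets borel" and K: "?K \<in> sets \<nu>" unfolding sets_nu by measurable
  have fin: "emeasure \<nu> ?K = ennreal (measure \<nu> ?K)"
    using nu_away_finite[OF \<kappa>] by (intro emeasure_eq_ennreal_measure) auto
  have "(\<integral>\<^sup>+z. ennreal (norm z) * indicator ?A z \<partial>\<nu>) \<le> (\<integral>\<^sup>+z. indicator ?K z \<partial>\<nu>)"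
    by (intro nn_integral_mono) (auto simp: indicator_def)
  then have le: "(\<integral>\<^sup>+p. ennreal (norm (jumps ?A u v p)) \<partial>I) \<le> ennreal ((v - u) * measure \<nu> ?K)"
    using K fin uv unfolding nn_integral_norm_jumps(1)[OF A uv]
    by (subst ennreal_mult) (auto intro!: mult_left_mono)
  then show int: "integrable I (jumps ?A u v)"
    using jumps_measurable[OF A uv(1)] by (auto simp: integrable_iff_bounded intro: le_less_trans)
  have "ennreal (norm (\<integral>p. jumps ?A u v p \<partial>I)) \<le> (\<integral>\<^sup>+p. ennreal (norm (jumps ?A u v p)) \<partial>I)"
    by (rule integral_norm_bound_ennreal[OF int])
  also note le
  finally show "norm (\<integral>p. jumps ?A u v p \<partial>I) \<le> (v - u) * measure \<nu> ?K"
    using uv by (simp add: ennreal_le_iff)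
qed

text \<open>
No moment of \<open>\<nu>\<close> is assumed on \<open>A\<close>, so that integrability does not come from Campbell's formula. It comes
from counting: almost surely there are finitely many points in \<open>A\<close>, and the number of those with jump size
larger than \<open>n\<close> is an integer that tends to \<open>0\<close>, hence vanishes for some \<open>n\<close>.
\<close>

lemma AE_integrable_N_jumps:
  assumes A: "A \<in> sets borel" "emeasure \<nu> A < \<infinity>" and uv: "0 \<le> u" "u \<le> v"
  shows "AE \<omega> in M. integrable (N \<omega>) (jumps A u v)"
proof -
  let ?S = "A \<times> {u<..v}"
  have S: "?S \<in> sets I" using A uv by (intro sets_I_times) auto
  have "emeasure I ?S < \<infinity>"
    using A uv by (simp add: emeasure_I_times ennreal_mult_less_top)
  from AE_N_natural[OF S this] AE_space show ?thesis
  proof eventually_elim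
    fix \<omega> assume nat: "\<exists>k::nat. emeasure (N \<omega>) ?S = of_nat k" and w: "\<omega> \<in> space M"
    then have fin: "emeasure (N \<omega>) ?S < \<infinity>" by (auto simp: ennreal_of_nat_eq_real_of_nat)
    let ?T = "\<lambda>n::nat. (A \<inter> {z. real n < norm z}) \<times> {u<..v}"
    have T: "?T n \<in> sets I" for n using A uv by (intro sets_I_times) auto
    have Tfin: "emeasure (N \<omega>) (?T n) < \<infinity>" for n
      using emeasure_mono[of "?T n" ?S "N \<omega>"] S fin sets_N[OF w] by (auto intro: le_less_trans)
    have "(\<lambda>n. emeasure (N \<omega>) (?T n)) \<longlonglongrightarrow> emeasure (N \<omega>) (\<Inter>n. ?T n)"
      using T less_imp_neq[OF Tfin] sets_N[OF w] by (intro Lim_emeasure_decseq) (auto simp: decseq_def)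
    moreover have "(\<Inter>n. ?T n) = {}"
    proof -
      have "\<exists>n::nat. \<not> real n < norm z" for z :: 'h
        using reals_Archimedean2[of "norm z"] by (meson less_asym)
      then show ?thesis by blast
    qed
    ultimately have "(\<lambda>n. emeasure (N \<omega>) (?T n)) \<longlonglongrightarrow> 0" by simp
    then have "eventually (\<lambda>n. emeasure (N \<omega>) (?T n) < 1) sequentially"
      by (rule order_tendstoD) simp
    then obtain n where n: "emeasure (N \<omega>) (?T n) < 1" using eventually_happens by force
    \<comment> \<open>A number of points below \<open>1\<close> is \<open>0\<close>.\<close>
    obtain k :: nat where k: "emeasure (N \<omega>) (?T n) = of_nat k"
      using N_natural[OF w T less_imp_neq[OF Tfin]] by blast
    with n have "emeasure (N \<omega>) (?T n) = 0" by (auto simp: ennreal_of_nat_eq_real_of_nat)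
    then have null: "AE p in N \<omega>. p \<notin> ?T n"
      using T sets_N[OF w] by (intro AE_not_in) (auto simp: null_sets_def)
    have m: "jumps A u v \<in> borel_measurable (N \<omega>)"
      using jumps_measurable[OF A(1) uv(1)] measurable_N[OF w] by blast
    show "integrable (N \<omega>) (jumps A u v)"
    proof (rule Bochner_Integration.integrable_bound[OF _ m])
      show "integrable (N \<omega>) (\<lambda>p. real n * indicator ?S p)"
        using S fin sets_N[OF w] by (intro integrable_mult_right integrable_real_indicator) auto
      show "AE p in N \<omega>. norm (jumps A u v p) \<le> norm (real n * indicator ?S p)"
        using null by eventually_elim (auto simp: jumps_def indicator_def not_less)
    qed
  qed
qed

text \<open>
By the isometry the approximations \<open>g n\<close> that define the compensated integral can be traded for any other
integrable function \<open>h\<close>, with an error that depends on the \<open>L\<^sup>2\<close> distance of \<open>h\<close> and \<open>f\<close> only. The factor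
\<open>4\<close> is due to using \<open>(a + b)\<^sup>2 \<le> 2 * a\<^sup>2 + 2 * b\<^sup>2\<close> twice.
\<close>

lemma compensated_integral_approx:
  assumes Z: "compensated_integral_is M \<nu> N f Z" and f: "f \<in> borel_measurable I" and h: "integrable I h"
  shows "(\<integral>\<^sup>+\<omega>. ennreal ((norm (compensated \<nu> N h \<omega> - Z \<omega>))\<^sup>2) \<partial>M) \<le> 4 * (\<integral>\<^sup>+p. ennreal ((norm (h p - f p))\<^sup>2) \<partial>I)"
proof -
  have [measurable]: "Z \<in> borel_measurable M" using Z by (simp add: compensated_integral_is_def)
  note [measurable] = f
  obtain g where g: "\<And>n::nat. integrable I (g n)"
    and gf: "(\<lambda>n. \<integral>\<^sup>+p. ennreal ((norm (g n p - f p))\<^sup>2) \<partial>I) \<longlonglongrightarrow> 0"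
    and gZ: "(\<lambda>n. \<integral>\<^sup>+\<omega>. ennreal ((norm (compensated \<nu> N (g n) \<omega> - Z \<omega>))\<^sup>2) \<partial>M) \<longlonglongrightarrow> 0"
    using Z unfolding compensated_integral_is_def compensated_def by blast
  have [measurable]: "g n \<in> borel_measurable I" for n using g[of n] by simp
  have [measurable]: "h \<in> borel_measurable I" using h by simp
  have [measurable]: "compensated \<nu> N (g n) \<in> borel_measurable M" for n by (rule measurable_compensated) simp
  have [measurable]: "compensated \<nu> N (\<lambda>p. h p - g n p) \<in> borel_measurable M" for n
    by (rule measurable_compensated) measurable
  have sq: "(norm (a + b))\<^sup>2 \<le> 2 * (norm a)\<^sup>2 + 2 * (norm b)\<^sup>2" for a b :: 'h
  proof -
    have "(norm (a + b))\<^sup>2 \<le> (norm a + norm b)\<^sup>2" by (intro power_mono norm_triangle_ineq) simp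
    also have "\<dots> \<le> 2 * (norm a)\<^sup>2 + 2 * (norm b)\<^sup>2"
      using sum_squares_bound[of "norm a" "norm b"] by (simp add: power2_sum)
    finally show ?thesis .
  qed
  have sqe: "ennreal ((norm (a + b))\<^sup>2) \<le> 2 * ennreal ((norm a)\<^sup>2) + 2 * ennreal ((norm b)\<^sup>2)" for a b :: 'h
    using ennreal_leI[OF sq[of a b]] by (simp add: ennreal_plus ennreal_mult del: ennreal_plus[symmetric])
  let ?a = "\<integral>\<^sup>+p. ennreal ((norm (h p - f p))\<^sup>2) \<partial>I"
  let ?b = "\<lambda>n. \<integral>\<^sup>+p. ennreal ((norm (g n p - f p))\<^sup>2) \<partial>I"
  let ?c = "\<lambda>n. \<integral>\<^sup>+\<omega>. ennreal ((norm (compensated \<nu> N (g n) \<omega> - Z \<omega>))\<^sup>2) \<partial>M"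
  have bound: "(\<integral>\<^sup>+\<omega>. ennreal ((norm (compensated \<nu> N h \<omega> - Z \<omega>))\<^sup>2) \<partial>M) \<le> 2 * (2 * ?a + 2 * ?b n) + 2 * ?c n" for n
  proof -
    have "(\<integral>\<^sup>+\<omega>. ennreal ((norm (compensated \<nu> N h \<omega> - Z \<omega>))\<^sup>2) \<partial>M) \<le>
        (\<integral>\<^sup>+\<omega>. 2 * ennreal ((norm (compensated \<nu> N (\<lambda>p. h p - g n p) \<omega>))\<^sup>2)
           + 2 * ennreal ((norm (compensated \<nu> N (g n) \<omega> - Z \<omega>))\<^sup>2) \<partial>M)"
      using AE_compensated_diff[OF h g[of n]]
    proof (intro nn_integral_mono_AE, eventually_elim)
      fix \<omega> assume "compensated \<nu> N (\<lambda>p. h p - g n p) \<omega> = compensated \<nu> N h \<omega> - compensated \<nu> N (g n) \<omega>"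
      then have "compensated \<nu> N h \<omega> - Z \<omega> =
          compensated \<nu> N (\<lambda>p. h p - g n p) \<omega> + (compensated \<nu> N (g n) \<omega> - Z \<omega>)" by simp
      then show "ennreal ((norm (compensated \<nu> N h \<omega> - Z \<omega>))\<^sup>2) \<le>
          2 * ennreal ((norm (compensated \<nu> N (\<lambda>p. h p - g n p) \<omega>))\<^sup>2)
           + 2 * ennreal ((norm (compensated \<nu> N (g n) \<omega> - Z \<omega>))\<^sup>2)"
        using sqe by metis
    qed
    also have "\<dots> = 2 * (\<integral>\<^sup>+\<omega>. ennreal ((norm (compensated \<nu> N (\<lambda>p. h p - g n p) \<omega>))\<^sup>2) \<partial>M) + 2 * ?c n"
      by (subst nn_integral_add) (auto simp: nn_integral_cmult)
    also have "(\<integral>\<^sup>+\<omega>. ennreal ((norm (compensated \<nu> N (\<lambda>p. h p - g n p) \<omega>))\<^sup>2) \<partial>M) \<le>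
        (\<integral>\<^sup>+p. ennreal ((norm (h p - g n p))\<^sup>2) \<partial>I)"
      using h g by (intro isometry_le) simp
    also have "\<dots> \<le> (\<integral>\<^sup>+p. 2 * ennreal ((norm (h p - f p))\<^sup>2) + 2 * ennreal ((norm (g n p - f p))\<^sup>2) \<partial>I)"
    proof (intro nn_integral_mono)
      fix p
      show "ennreal ((norm (h p - g n p))\<^sup>2) \<le> 2 * ennreal ((norm (h p - f p))\<^sup>2) + 2 * ennreal ((norm (g n p - f p))\<^sup>2)"
        using sqe[of "h p - f p" "f p - g n p"] by (simp add: norm_minus_commute[of "f p"])
    qed
    also have "\<dots> = 2 * ?a + 2 * ?b n"
      by (subst nn_integral_add) (auto simp: nn_integral_cmult)
    finally show ?thesis by (simp add: add_right_mono mult_left_mono)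
  qed
  have "(\<lambda>n. 2 * (2 * ?a + 2 * ?b n) + 2 * ?c n) \<longlonglongrightarrow> 2 * (2 * ?a + 2 * 0) + 2 * 0"
    by (intro tendsto_add tendsto_const ennreal_tendsto_cmult gf gZ) auto
  from LIMSEQ_le_const[OF this, of "\<integral>\<^sup>+\<omega>. ennreal ((norm (compensated \<nu> N h \<omega> - Z \<omega>))\<^sup>2) \<partial>M"] bound
  show ?thesis by (simp add: mult.assoc[symmetric])
qed

end

section \<open>Increments of the Levy process\<close>

locale poisson_levy = poisson_setting M F \<nu> N
  for M :: "'w measure" and F and \<nu> :: "'h::{real_inner,banach,second_countable_topology} measure" and N +
  fixes L :: "real \<Rightarrow> 'w \<Rightarrow> 'h"
  assumes levy_process: "levy_process_of M \<nu> N L"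
begin

text \<open>
Here the approximation is truncation away from \<open>0\<close>, and the error tends to \<open>0\<close> with \<open>e\<close>, since
\<open>\<parallel>z\<parallel>\<^sup>2\<close> is integrable near \<open>0\<close>.
\<close>

lemma small_jump_approximation:
  assumes Z: "compensated_integral_is M \<nu> N (jumps {z. 0 < norm z \<and> norm z \<le> 1} 0 t) Z"
    and t: "0 \<le> t" and e: "0 < e" "e \<le> 1"
  shows "(\<integral>\<^sup>+\<omega>. ennreal ((norm (compensated \<nu> N (jumps {z. e < norm z \<and> norm z \<le> 1} 0 t) \<omega> - Z \<omega>))\<^sup>2) \<partial>M)
    \<le> 4 * (ennreal t * (\<integral>\<^sup>+z. ennreal ((norm z)\<^sup>2) * indicator {z. 0 < norm z \<and> norm z \<le> e} z \<partial>\<nu>))"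
proof -
  have A: "{z::'h. 0 < norm z \<and> norm z \<le> 1} \<in> sets borel" "{z::'h. 0 < norm z \<and> norm z \<le> e} \<in> sets borel"
    by measurable
  have eq: "norm (jumps {z. e < norm z \<and> norm z \<le> 1} 0 t p - jumps {z. 0 < norm z \<and> norm z \<le> 1} 0 t p)
      = norm (jumps {z. 0 < norm z \<and> norm z \<le> e} 0 t p)" for p :: "'h \<times> real"
    using e by (auto simp: jumps_def indicator_def)
  show ?thesis
    using compensated_integral_approx[OF Z jumps_measurable[OF A(1) order_refl] integrable_jumps(1)[OF e(1) order_refl t]]
    unfolding eq nn_integral_norm_jumps(2)[OF A(2) order_refl t] by simp
qed

text \<open>
The Levy-Ito decomposition of an increment at the level \<open>\<kappa>\<close>: jumps larger than \<open>\<kappa>\<close> are summed pathwise,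
at the price of the drift that compensates those between \<open>\<kappa>\<close> and \<open>1\<close>, and \<open>W\<close> is the compensated sum of
the jumps up to \<open>\<kappa>\<close>. \<open>W\<close> is exhibited as an almost sure limit of integrals over the time slab from \<open>u\<close> to
\<open>v\<close>; this shows that, up to null sets, the increment depends only on the points in this slab. The cut-offs
\<open>e k\<close> come from a subsequence along which the \<open>L\<^sup>2\<close> convergence is almost sure.
\<close>

lemma levy_increment_limit:
  assumes uv: "0 \<le> u" "u \<le> v" and \<kappa>: "0 < \<kappa>" "\<kappa> \<le> 1"
  obtains e :: "nat \<Rightarrow> real" where "\<And>k. 0 < e k" "\<And>k. e k \<le> \<kappa>"
    "AE \<omega> in M. \<exists>W. (\<lambda>k. compensated \<nu> N (jumps {z. e k < norm z \<and> norm z \<le> \<kappa>} u v) \<omega>) \<longlonglongrightarrow> W \<and>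
       integrable (N \<omega>) (jumps {z. \<kappa> < norm z} u v) \<and>
       L v \<omega> - L u \<omega> = W + (\<integral>p. jumps {z. \<kappa> < norm z} u v p \<partial>N \<omega>)
         - (\<integral>p. jumps {z. \<kappa> < norm z \<and> norm z \<le> 1} u v p \<partial>I)"
proof -
  define small where "small = {z::'h. 0 < norm z \<and> norm z \<le> 1}"
  define big where "big = {z::'h. 1 < norm z}"
  have v0: "0 \<le> v" using uv by simp
  have jumps_eq: "(\<lambda>(z, s). indicator (A \<times> {0<..t}) (z, s) *\<^sub>R z) = jumps A 0 t" for A :: "'h set" and t
    by (auto simp: jumps_def fun_eq_iff)
  have ex: "\<exists>Z. compensated_integral_is M \<nu> N (jumps small 0 t) Z \<and>
      (AE \<omega> in M. L t \<omega> = Z \<omega> + (\<integral>p. jumps big 0 t p \<partial>N \<omega>))" if "0 \<le> t" for t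
    using levy_process that unfolding levy_process_of_def jumps_eq small_def big_def by blast
  obtain Zv where Zv: "compensated_integral_is M \<nu> N (jumps small 0 v) Zv"
    "AE \<omega> in M. L v \<omega> = Zv \<omega> + (\<integral>p. jumps big 0 v p \<partial>N \<omega>)" using ex[OF v0] by blast
  obtain Zu where Zu: "compensated_integral_is M \<nu> N (jumps small 0 u) Zu"
    "AE \<omega> in M. L u \<omega> = Zu \<omega> + (\<integral>p. jumps big 0 u p \<partial>N \<omega>)" using ex[OF uv(1)] by blast
  define e0 where "e0 k = \<kappa> / real (Suc k)" for k
  have e0: "0 < e0 k" "e0 k \<le> \<kappa>" "e0 k \<le> 1" for k
    using \<kappa> by (auto simp: e0_def divide_simps)
  have e0_lim: "e0 \<longlonglongrightarrow> 0"
    unfolding e0_def[abs_def] by (rule LIMSEQ_Suc) (rule lim_const_over_n)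
  define f where "f k t = jumps {z::'h. e0 k < norm z \<and> norm z \<le> 1} 0 t" for k t
  define mid where "mid = jumps {z::'h. \<kappa> < norm z \<and> norm z \<le> 1} u v"
  define a where "a k = (\<integral>\<^sup>+z. ennreal ((norm z)\<^sup>2) * indicator {z. 0 < norm z \<and> norm z \<le> e0 k} z \<partial>\<nu>)" for k
  have a0: "a \<longlonglongrightarrow> 0" unfolding a_def[abs_def] by (rule nu_small_square_tendsto[OF e0_lim e0(3)])
  have f_int: "integrable I (f k t)" if "0 \<le> t" for k t
    unfolding f_def by (rule integrable_jumps(1)[OF e0(1) order_refl that])
  have mid_int: "integrable I mid"
    unfolding mid_def by (rule integrable_jumps(1)[OF \<kappa>(1) uv])
  define \<delta> where "\<delta> k \<omega> = (norm (compensated \<nu> N (f k v) \<omega> - Zv \<omega>))\<^sup>2 + (norm (compensated \<nu> N (f k u) \<omega> - Zu \<omega>))\<^sup>2" for k \<omega>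
  have [measurable]: "Zv \<in> borel_measurable M" "Zu \<in> borel_measurable M"
    using Zv Zu by (auto simp: compensated_integral_is_def)
  have [measurable]: "compensated \<nu> N (f k v) \<in> borel_measurable M" "compensated \<nu> N (f k u) \<in> borel_measurable M" for k
    using f_int[OF v0, of k] f_int[OF uv(1), of k] by (auto intro: measurable_compensated)
  have \<delta>m[measurable]: "\<delta> k \<in> borel_measurable M" for k unfolding \<delta>_def[abs_def] by measurable
  have \<delta>0: "0 \<le> \<delta> k \<omega>" for k \<omega> by (simp add: \<delta>_def)
  have \<delta>_le: "(\<integral>\<^sup>+\<omega>. ennreal (\<delta> k \<omega>) \<partial>M) \<le> 4 * (ennreal v * a k) + 4 * (ennreal u * a k)" for k
  proof -
    have "(\<integral>\<^sup>+\<omega>. ennreal (\<delta> k \<omega>) \<partial>M) = (\<integral>\<^sup>+\<omega>. ennreal ((norm (compensated \<nu> N (f k v) \<omega> - Zv \<omega>))\<^sup>2) \<partial>M)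
        + (\<integral>\<^sup>+\<omega>. ennreal ((norm (compensated \<nu> N (f k u) \<omega> - Zu \<omega>))\<^sup>2) \<partial>M)"
      unfolding \<delta>_def by (subst nn_integral_add[symmetric]) auto
    also have "\<dots> \<le> 4 * (ennreal v * a k) + 4 * (ennreal u * a k)"
      unfolding f_def a_def
      by (intro add_mono small_jump_approximation Zv(1)[unfolded small_def] Zu(1)[unfolded small_def] v0 uv e0)
    finally show ?thesis .
  qed
  have a_le: "a k \<le> (\<integral>\<^sup>+z. ennreal ((norm z)\<^sup>2) * indicator {z. 0 < norm z \<and> norm z \<le> 1} z \<partial>\<nu>)" for k
    unfolding a_def using e0(3)[of k] by (intro nn_integral_mono mult_left_mono) (auto simp: indicator_def)
  have a_fin: "a k < \<infinity>" for k using le_less_trans[OF a_le nu_small_square_finite] .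
  have \<delta>_fin: "(\<integral>\<^sup>+\<omega>. ennreal (\<delta> k \<omega>) \<partial>M) < \<infinity>" for k
    using a_fin[of k] by (intro le_less_trans[OF \<delta>_le]) (auto simp: ennreal_mult_less_top)
  have \<delta>_int: "integrable M (\<delta> k)" for k
    using \<delta>_fin[of k] \<delta>0 by (intro integrableI_nonneg) auto
  have "(\<lambda>k. \<integral>\<^sup>+\<omega>. ennreal (\<delta> k \<omega>) \<partial>M) \<longlonglongrightarrow> 0"
  proof (rule tendsto_sandwich[OF _ _ tendsto_const])
    have "(\<lambda>k. 4 * (ennreal v * a k) + 4 * (ennreal u * a k)) \<longlonglongrightarrow> 4 * (ennreal v * 0) + 4 * (ennreal u * 0)"
      by (intro tendsto_add ennreal_tendsto_cmult a0) auto
    then show "(\<lambda>k. 4 * (ennreal v * a k) + 4 * (ennreal u * a k)) \<longlonglongrightarrow> 0" by simp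
  qed (use \<delta>_le in auto)
  moreover have "(\<integral>\<^sup>+\<omega>. ennreal (\<delta> k \<omega>) \<partial>M) = ennreal (\<integral>\<omega>. norm (\<delta> k \<omega>) \<partial>M)" for k
    using \<delta>_int[of k] \<delta>0 by (subst nn_integral_eq_integral[symmetric]) auto
  ultimately have "(\<lambda>k. \<integral>\<omega>. norm (\<delta> k \<omega>) \<partial>M) \<longlonglongrightarrow> 0"
    by (simp add: ennreal_tendsto_0_iff)
  \<comment> \<open>\<open>\<delta> k\<close> joins the squared errors at the times \<open>u\<close> and \<open>v\<close>, so that one subsequence serves for both.\<close>
  from tendsto_L1_AE_subseq[OF \<delta>_int this] obtain r :: "nat \<Rightarrow> nat" where
    r: "strict_mono r" "AE \<omega> in M. (\<lambda>n. \<delta> (r n) \<omega>) \<longlonglongrightarrow> 0" by blast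
  define w where "w k = jumps {z::'h. e0 k < norm z \<and> norm z \<le> \<kappa>} u v" for k
  have w_eq: "w k = (\<lambda>p. (f k v p - f k u p) - mid p)" for k
    using uv e0[of k] \<kappa> by (auto simp: w_def f_def mid_def jumps_def indicator_def fun_eq_iff)
  have "AE \<omega> in M. \<forall>k. compensated \<nu> N (w k) \<omega> =
      compensated \<nu> N (f k v) \<omega> - compensated \<nu> N (f k u) \<omega> - compensated \<nu> N mid \<omega>"
    unfolding AE_all_countable
  proof
    fix k
    have "integrable I (\<lambda>p. f k v p - f k u p)" using f_int[OF v0] f_int[OF uv(1)] by simp
    from AE_compensated_diff[OF this mid_int] AE_compensated_diff[OF f_int[OF v0] f_int[OF uv(1)], of k k]
    show "AE \<omega> in M. compensated \<nu> N (w k) \<omega> =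
        compensated \<nu> N (f k v) \<omega> - compensated \<nu> N (f k u) \<omega> - compensated \<nu> N mid \<omega>"
      by eventually_elim (simp add: w_eq)
  qed
  moreover have "AE \<omega> in M. integrable (N \<omega>) (jumps big 0 v)" "AE \<omega> in M. integrable (N \<omega>) (jumps big 0 u)"
    "AE \<omega> in M. integrable (N \<omega>) (jumps big u v)"
    using uv v0 nu_away_finite[of 1] unfolding big_def by (intro AE_integrable_N_jumps; auto)+
  moreover note AE_integrable_N[OF mid_int]
  ultimately have "AE \<omega> in M. \<exists>W. (\<lambda>k. compensated \<nu> N (w (r k)) \<omega>) \<longlonglongrightarrow> W \<and>
       integrable (N \<omega>) (jumps {z. \<kappa> < norm z} u v) \<and>
       L v \<omega> - L u \<omega> = W + (\<integral>p. jumps {z. \<kappa> < norm z} u v p \<partial>N \<omega>) - (\<integral>p. mid p \<partial>I)"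
    using r(2) Zv(2) Zu(2)
  proof eventually_elim
    case (elim \<omega>)
    have "(\<lambda>n. compensated \<nu> N (f (r n) v) \<omega>) \<longlonglongrightarrow> Zv \<omega>" "(\<lambda>n. compensated \<nu> N (f (r n) u) \<omega>) \<longlonglongrightarrow> Zu \<omega>"
    proof -
      have sq: "x \<longlonglongrightarrow> c" if "\<And>n. (norm (x n - c))\<^sup>2 \<le> \<delta> (r n) \<omega>" for x and c :: 'h
      proof -
        have "(\<lambda>n. (norm (x n - c))\<^sup>2) \<longlonglongrightarrow> 0"
          by (rule tendsto_sandwich[OF _ _ tendsto_const elim(6)]) (use that in auto)
        then have "(\<lambda>n. norm (x n - c)) \<longlonglongrightarrow> 0" by (simp add: power_tendsto_0_iff)
        then show ?thesis using LIM_zero_iff tendsto_norm_zero_iff by blast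
      qed
      show "(\<lambda>n. compensated \<nu> N (f (r n) v) \<omega>) \<longlonglongrightarrow> Zv \<omega>" "(\<lambda>n. compensated \<nu> N (f (r n) u) \<omega>) \<longlonglongrightarrow> Zu \<omega>"
        by (rule sq; simp add: \<delta>_def)+
    qed
    then have "(\<lambda>k. compensated \<nu> N (w (r k)) \<omega>) \<longlonglongrightarrow> Zv \<omega> - Zu \<omega> - compensated \<nu> N mid \<omega>"
      using elim(1) by (auto intro!: tendsto_intros)
    moreover have big: "jumps big u v = (\<lambda>p. jumps big 0 v p - jumps big 0 u p)"
      using uv by (auto simp: jumps_def indicator_def fun_eq_iff)
    moreover have K: "jumps {z. \<kappa> < norm z} u v = (\<lambda>p. mid p + jumps big u v p)"
      using \<kappa> by (auto simp: jumps_def mid_def big_def indicator_def fun_eq_iff)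
    have "integrable (N \<omega>) (jumps {z. \<kappa> < norm z} u v)"
      unfolding K using elim by simp
    moreover have "(\<integral>p. jumps {z. \<kappa> < norm z} u v p \<partial>N \<omega>) = (\<integral>p. mid p \<partial>N \<omega>) + (\<integral>p. jumps big u v p \<partial>N \<omega>)"
      unfolding K using elim by simp
    moreover have "(\<integral>p. jumps big u v p \<partial>N \<omega>) = (\<integral>p. jumps big 0 v p \<partial>N \<omega>) - (\<integral>p. jumps big 0 u p \<partial>N \<omega>)"
      unfolding big using elim by simp
    ultimately show ?case
      using elim by (intro exI[of _ "Zv \<omega> - Zu \<omega> - compensated \<nu> N mid \<omega>"]) (simp add: compensated_def)
  qed
  then show thesis
    using e0 by (intro that[of "\<lambda>k. e0 (r k)"]) (auto simp: w_def mid_def)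
qed

lemma integral_single_jump:
  assumes w: "\<omega> \<in> space M" and int: "integrable (N \<omega>) (jumps K u v)" and K: "K \<in> sets borel"
    and B: "B \<in> sets borel" "B \<subseteq> K" "B \<subseteq> cball b r" and u: "0 \<le> u"
    and one: "emeasure (N \<omega>) (B \<times> {u<..v}) = 1" and none: "emeasure (N \<omega>) ((K - B) \<times> {u<..v}) = 0"
  shows "norm ((\<integral>p. jumps K u v p \<partial>N \<omega>) - b) \<le> r"
proof -
  let ?S = "B \<times> {u<..v}"
  have S[measurable]: "?S \<in> sets (N \<omega>)" using sets_I_times[OF B(1) u] sets_N[OF w] by simp
  have "(K - B) \<times> {u<..v} \<in> null_sets (N \<omega>)"
    using none sets_I_times[of "K - B" u v] K B u sets_N[OF w] by (auto simp: null_sets_def)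
  then have null: "AE p in N \<omega>. p \<notin> (K - B) \<times> {u<..v}" by (rule AE_not_in)
  have meas: "jumps B u v \<in> borel_measurable (N \<omega>)" "jumps K u v \<in> borel_measurable (N \<omega>)"
    using jumps_measurable[OF B(1) u] jumps_measurable[OF K u] measurable_N[OF w] by blast+
  have intB: "integrable (N \<omega>) (jumps B u v)"
    by (rule Bochner_Integration.integrable_bound[OF int meas(1)])
      (use B in \<open>auto simp: jumps_def indicator_def\<close>)
  have "(\<integral>p. jumps K u v p \<partial>N \<omega>) = (\<integral>p. jumps B u v p \<partial>N \<omega>)"
  proof (rule integral_cong_AE[OF meas(2,1)])
    show "AE p in N \<omega>. jumps K u v p = jumps B u v p"
      using null by eventually_elim (use B(2) in \<open>auto simp: jumps_def indicator_def\<close>)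
  qed
  moreover have "(\<integral>p. indicator ?S p *\<^sub>R b \<partial>N \<omega>) = b"
    using one by (simp add: measure_def)
  moreover have intb: "integrable (N \<omega>) (\<lambda>p. indicator ?S p *\<^sub>R b)"
    using one by simp
  ultimately have "(\<integral>p. jumps K u v p \<partial>N \<omega>) - b = (\<integral>p. jumps B u v p - indicator ?S p *\<^sub>R b \<partial>N \<omega>)"
    using intB by simp
  also have "norm \<dots> \<le> (\<integral>p. norm (jumps B u v p - indicator ?S p *\<^sub>R b) \<partial>N \<omega>)"
    by (rule integral_norm_bound)
  also have "\<dots> \<le> (\<integral>p. indicator ?S p *\<^sub>R r \<partial>N \<omega>)"
  proof (rule integral_mono)
    show "integrable (N \<omega>) (\<lambda>p. norm (jumps B u v p - indicator ?S p *\<^sub>R b))" using intB intb by simp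
    show "integrable (N \<omega>) (\<lambda>p. indicator ?S p *\<^sub>R r)" using one by simp
    show "norm (jumps B u v p - indicator ?S p *\<^sub>R b) \<le> indicator ?S p *\<^sub>R r" for p
      using B(3) by (cases p) (auto simp: jumps_def indicator_def dist_norm norm_minus_commute)
  qed
  also have "\<dots> = r" using one by (simp add: measure_def)
  finally show ?thesis .
qed

text \<open>
The numbers of points in \<open>B\<close> and in \<open>K - B\<close> are independent Poisson variables.
\<close>

lemma prob_one_jump:
  assumes B: "B \<in> sets borel" "B \<subseteq> K" and K: "K \<in> sets borel" "emeasure \<nu> K < \<infinity>" and uv: "0 \<le> u" "u \<le> v"
  shows "prob {\<omega>\<in>space M. emeasure (N \<omega>) (B \<times> {u<..v}) = 1 \<and> emeasure (N \<omega>) ((K - B) \<times> {u<..v}) = 0}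
    = (v - u) * measure \<nu> B * exp (- ((v - u) * measure \<nu> K))"
proof -
  let ?B = "B \<times> {u<..v}" and ?C = "(K - B) \<times> {u<..v}"
  have C: "K - B \<in> sets borel" using K B by auto
  have fin: "emeasure \<nu> B < \<infinity>" "emeasure \<nu> (K - B) < \<infinity>"
    using emeasure_mono[of B K \<nu>] emeasure_mono[of "K - B" K \<nu>] B K sets_nu
    by (auto intro: le_less_trans)
  have sets: "?B \<in> sets I" "?C \<in> sets I" using B C uv by (auto intro: sets_I_times)
  have finI: "emeasure I ?B < \<infinity>" "emeasure I ?C < \<infinity>"
    using fin uv B(1) C by (auto simp: emeasure_I_times ennreal_mult_less_top)
  have mI: "measure I ?B = (v - u) * measure \<nu> B" "measure I ?C = (v - u) * measure \<nu> (K - B)"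
    using uv B(1) C by (auto simp: measure_def emeasure_I_times enn2real_mult)
  have diff: "measure \<nu> (K - B) = measure \<nu> K - measure \<nu> B"
    using B K sets_nu by (intro measure_Diff) auto
  let ?X = "\<lambda>i \<omega>. emeasure (N \<omega>) (if i = (0::nat) then ?B else ?C)"
  let ?A = "\<lambda>i::nat. {of_nat (if i = 0 then 1 else 0)} :: ennreal set"
  have "prob (\<Inter>i\<in>{0,1}. ?X i -` ?A i \<inter> space M) = (\<Prod>i\<in>{0,1}. prob (?X i -` ?A i \<inter> space M))"
    using sets by (intro indep_varsD_finite[OF indep_counts]) auto
  also have "(\<Inter>i\<in>{0,1}. ?X i -` ?A i \<inter> space M) =
      {\<omega>\<in>space M. emeasure (N \<omega>) ?B = 1 \<and> emeasure (N \<omega>) ?C = 0}" by auto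
  also have "(\<Prod>i\<in>{0,1}. prob (?X i -` ?A i \<inter> space M)) =
      prob {\<omega>\<in>space M. emeasure (N \<omega>) ?B = of_nat 1} * prob {\<omega>\<in>space M. emeasure (N \<omega>) ?C = of_nat 0}"
    by (simp add: vimage_def Int_def conj_commute)
  also have "\<dots> = poisson_weight (measure I ?B) 1 * poisson_weight (measure I ?C) 0"
    by (simp only: prob_N[OF sets(1) finI(1)] prob_N[OF sets(2) finI(2)])
  also have "\<dots> = (v - u) * measure \<nu> B * exp (- ((v - u) * measure \<nu> K))"
    by (simp add: poisson_weight_def mI diff mult_exp_exp algebra_simps)
  finally show ?thesis .
qed

text \<open>
The points in a time slab are known at the end of the slab, and they belong to the future of its
beginning.
\<close>

lemma counts_measurable_between:
  assumes uv: "0 \<le> u" "u \<le> v" and B: "B \<in> sets I" "B \<subseteq> UNIV \<times> {u<..v}"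
  shows "(\<lambda>\<omega>. emeasure (N \<omega>) B) \<in> borel_measurable (F v)"
    and "(\<lambda>\<omega>. emeasure (N \<omega>) B) \<in> borel_measurable (sigma (space M)
      {{\<omega>\<in>space M. emeasure (N \<omega>) B \<in> C} | B C. B \<in> sets I \<and> B \<subseteq> UNIV \<times> {u<..} \<and> C \<in> sets borel})"
proof -
  have "B \<subseteq> UNIV \<times> {0..v}" "0 \<le> v" using B uv by auto
  then show "(\<lambda>\<omega>. emeasure (N \<omega>) B) \<in> borel_measurable (F v)"
    using prm B(1) unfolding poisson_random_measure_def by blast
  have B': "B \<subseteq> UNIV \<times> {u<..}" using B by auto
  let ?G = "{{\<omega>\<in>space M. emeasure (N \<omega>) B \<in> C} | B C. B \<in> sets I \<and> B \<subseteq> UNIV \<times> {u<..} \<and> C \<in> sets borel}"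
  have G: "?G \<subseteq> Pow (space M)" by auto
  show "(\<lambda>\<omega>. emeasure (N \<omega>) B) \<in> borel_measurable (sigma (space M) ?G)"
  proof (rule measurableI)
    fix C :: "ennreal set" assume C: "C \<in> sets borel"
    have "(\<lambda>\<omega>. emeasure (N \<omega>) B) -` C \<inter> space (sigma (space M) ?G) = {\<omega>\<in>space M. emeasure (N \<omega>) B \<in> C}"
      by (auto simp: space_measure_of_conv)
    also have "\<dots> \<in> ?G" using B(1) B' C by blast
    finally show "(\<lambda>\<omega>. emeasure (N \<omega>) B) -` C \<inter> space (sigma (space M) ?G) \<in> sets (sigma (space M) ?G)"
      using G by (auto simp: sets_measure_of intro: sigma_sets.Basic)
  qed simp
qed

text \<open>
An event that is determined by the points in a slab is adapted at the end of the slab and independent of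
the past of its beginning. The premise quantifies over all \<open>\<sigma>\<close>-algebras that know these points, so that
one measurability proof serves for both claims.
\<close>

lemma increment_event_adapted_indep:
  assumes uv: "0 \<le> u" "u \<le> v"
    and D: "\<And>G. space G = space M \<Longrightarrow>
      (\<And>B. B \<in> sets I \<Longrightarrow> B \<subseteq> UNIV \<times> {u<..v} \<Longrightarrow> (\<lambda>\<omega>. emeasure (N \<omega>) B) \<in> borel_measurable G) \<Longrightarrow> D \<in> sets G"
  shows "D \<in> sets (F v)" "K \<in> sets (F u) \<Longrightarrow> prob (K \<inter> D) = prob K * prob D"
proof -
  show "D \<in> sets (F v)"
    using counts_measurable_between(1)[OF uv] by (intro D space_F)
  let ?G = "{{\<omega>\<in>space M. emeasure (N \<omega>) B \<in> C} | B C. B \<in> sets I \<and> B \<subseteq> UNIV \<times> {u<..} \<and> C \<in> sets borel}"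
  have "D \<in> sets (sigma (space M) ?G)"
    using counts_measurable_between(2)[OF uv] by (intro D) (auto simp: space_measure_of_conv)
  moreover have "?G \<subseteq> Pow (space M)" by auto
  ultimately have DG: "D \<in> sigma_sets (space M) ?G" by (simp add: sets_measure_of)
  have "indep_set (sets (F u)) (sigma_sets (space M) ?G)"
    using prm uv(1) unfolding poisson_random_measure_def by blast
  then show "prob (K \<inter> D) = prob K * prob D" if "K \<in> sets (F u)"
    by (rule indep_setD[OF _ that DG])
qed

text \<open>
Chebyshev's inequality and the isometry. The failure probability is proportional to \<open>v - u\<close>, with a
factor \<open>m\<close> that is small if \<open>\<kappa>\<close> is.
\<close>

lemma prob_small_jumps_ge:
  assumes uv: "0 \<le> u" "u \<le> v" and e: "0 < e" and \<kappa>: "\<kappa> \<le> 1" and \<rho>: "0 < \<rho>" and m: "0 \<le> m"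
    and small: "(\<integral>\<^sup>+z. ennreal ((norm z)\<^sup>2) * indicator {z. 0 < norm z \<and> norm z \<le> \<kappa>} z \<partial>\<nu>) \<le> ennreal (m * \<rho>\<^sup>2)"
  shows "1 - m * (v - u) \<le> prob {\<omega>\<in>space M. norm (compensated \<nu> N (jumps {z. e < norm z \<and> norm z \<le> \<kappa>} u v) \<omega>) < \<rho>}"
proof -
  let ?A = "{z::'h. e < norm z \<and> norm z \<le> \<kappa>}"
  have A: "?A \<in> sets borel" by measurable
  define W where "W = compensated \<nu> N (jumps ?A u v)"
  have int: "integrable I (jumps ?A u v)"
    by (rule Bochner_Integration.integrable_bound[OF integrable_jumps(1)[OF e uv] jumps_measurable[OF A uv(1)]])
      (use \<kappa> in \<open>auto simp: jumps_def indicator_def\<close>)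
  then have [measurable]: "W \<in> borel_measurable M" unfolding W_def by (intro measurable_compensated) simp
  have "emeasure M {\<omega>\<in>space M. 1 \<le> ennreal (1 / \<rho>\<^sup>2) * ennreal ((norm (W \<omega>))\<^sup>2)} \<le>
      ennreal (1 / \<rho>\<^sup>2) * (\<integral>\<^sup>+\<omega>. ennreal ((norm (W \<omega>))\<^sup>2) * indicator (space M) \<omega> \<partial>M)"
    by (rule nn_integral_Markov_inequality) measurable
  also have "(\<integral>\<^sup>+\<omega>. ennreal ((norm (W \<omega>))\<^sup>2) * indicator (space M) \<omega> \<partial>M) = (\<integral>\<^sup>+\<omega>. ennreal ((norm (W \<omega>))\<^sup>2) \<partial>M)"
    by (intro nn_integral_cong) simp
  also have "\<dots> \<le> ennreal (v - u) * (\<integral>\<^sup>+z. ennreal ((norm z)\<^sup>2) * indicator ?A z \<partial>\<nu>)"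
    unfolding W_def nn_integral_norm_jumps(2)[OF A uv, symmetric] by (rule isometry_le[OF int])
  also have "(\<integral>\<^sup>+z. ennreal ((norm z)\<^sup>2) * indicator ?A z \<partial>\<nu>) \<le>
      (\<integral>\<^sup>+z. ennreal ((norm z)\<^sup>2) * indicator {z. 0 < norm z \<and> norm z \<le> \<kappa>} z \<partial>\<nu>)"
    using e by (intro nn_integral_mono mult_left_mono) (auto simp: indicator_def)
  also note small
  finally have "emeasure M {\<omega>\<in>space M. 1 \<le> ennreal (1 / \<rho>\<^sup>2) * ennreal ((norm (W \<omega>))\<^sup>2)} \<le>
      ennreal (1 / \<rho>\<^sup>2) * (ennreal (v - u) * ennreal (m * \<rho>\<^sup>2))"
    by (simp add: mult_left_mono)
  also have "\<dots> = ennreal (m * (v - u))"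
    using \<rho> uv m by (simp add: ennreal_mult[symmetric])
  also have "{\<omega>\<in>space M. 1 \<le> ennreal (1 / \<rho>\<^sup>2) * ennreal ((norm (W \<omega>))\<^sup>2)} = {\<omega>\<in>space M. \<not> norm (W \<omega>) < \<rho>}"
  proof -
    have "1 \<le> ennreal (1 / \<rho>\<^sup>2) * ennreal ((norm x)\<^sup>2) \<longleftrightarrow> \<not> norm x < \<rho>" for x :: 'h
    proof -
      have "1 \<le> ennreal (1 / \<rho>\<^sup>2) * ennreal ((norm x)\<^sup>2) \<longleftrightarrow> 1 \<le> (norm x)\<^sup>2 / \<rho>\<^sup>2"
        by (subst ennreal_mult[symmetric]) (auto simp flip: ennreal_1 simp: ennreal_le_iff)
      also have "\<dots> \<longleftrightarrow> \<rho>\<^sup>2 \<le> (norm x)\<^sup>2" using \<rho> by (simp add: divide_simps)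
      also have "\<dots> \<longleftrightarrow> \<rho> \<le> norm x" using \<rho> by (simp add: abs_le_square_iff[symmetric])
      finally show ?thesis by auto
    qed
    then show ?thesis by simp
  qed
  finally have "prob {\<omega>\<in>space M. \<not> norm (W \<omega>) < \<rho>} \<le> m * (v - u)"
    using m uv by (simp add: emeasure_eq_measure)
  moreover have "prob {\<omega>\<in>space M. \<not> norm (W \<omega>) < \<rho>} = 1 - prob {\<omega>\<in>space M. norm (W \<omega>) < \<rho>}"
    by (rule prob_neg) measurable
  ultimately show ?thesis by (simp add: W_def)
qed

text \<open>
The probability that a short interval sees exactly one jump from a small ball around \<open>b\<close> and no other
jump larger than \<open>\<kappa>\<close> is at least \<open>mB * (v - u) / 2\<close>, where \<open>mB\<close> is the \<open>\<nu>\<close>-measure of the ball. The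
jumps up to \<open>\<kappa>\<close> spoil this with a probability of at most \<open>mB * (v - u) / 4\<close> once \<open>\<kappa>\<close> is small, and the
compensating drift is small if \<open>v - u\<close> is. The event \<open>D\<close> is written in terms of the points in the slab,
not in terms of the increment of \<open>L\<close> itself, in order to be exactly measurable for the past of \<open>v\<close> and
exactly independent of the past of \<open>u\<close>.
\<close>

lemma levy_increment_event:
  assumes b: "b \<noteq> 0" and supp: "\<forall>r>0. 0 < emeasure \<nu> (ball b r)" and \<rho>: "0 < \<rho>"
  shows "\<exists>c>0. \<exists>d>0. \<forall>u v. 0 \<le> u \<and> u \<le> v \<and> v - u \<le> d \<longrightarrow>
    (\<exists>D\<in>sets (F v). (\<forall>K\<in>sets (F u). prob (K \<inter> D) = prob K * prob D) \<and>
      (AE \<omega> in M. \<omega> \<in> D \<longrightarrow> L v \<omega> - L u \<omega> \<in> cball b \<rho>) \<and> c * (v - u) \<le> prob D)"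
proof -
  define r where "r = min (\<rho> / 4) (norm b / 2)"
  have r: "0 < r" "r \<le> \<rho> / 4" "r \<le> norm b / 2" using b \<rho> by (auto simp: r_def)
  define B where "B = ball b r"
  have B_away: "B \<subseteq> {z. norm b / 2 < norm z}"
  proof
    fix z assume "z \<in> B"
    then have "norm (b - z) < norm b / 2" using r by (simp add: B_def dist_norm)
    then show "z \<in> {z. norm b / 2 < norm z}" using norm_triangle_sub[of b z] by simp
  qed
  have B: "B \<in> sets borel" by (simp add: B_def)
  have Bfin: "emeasure \<nu> B < \<infinity>"
  proof (rule le_less_trans[OF emeasure_mono[OF B_away] nu_away_finite])
    show "{z. norm b / 2 < norm z} \<in> sets \<nu>" unfolding sets_nu by measurable
  qed (use b in simp)
  define mB where "mB = measure \<nu> B"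
  have mB: "0 < mB" using supp[rule_format, OF r(1)] Bfin by (simp add: mB_def B_def measure_def enn2real_positive_iff)
  define e where "e k = min 1 (norm b / 2) / real (Suc k)" for k
  have e_le: "e k \<le> min 1 (norm b / 2) / 1" for k
    unfolding e_def by (rule divide_left_mono) (use b in auto)
  have e_pos: "0 < e k" for k using b by (simp add: e_def)
  have e: "0 < e k" "e k \<le> 1" "e k \<le> norm b / 2" for k
    using e_le[of k] e_pos[of k] by simp_all
  have "e \<longlonglongrightarrow> 0"
    unfolding e_def[abs_def] by (rule LIMSEQ_Suc) (rule lim_const_over_n)
  \<comment> \<open>The bound leaves to the small jumps a failure probability of \<open>mB / 4 * (v - u)\<close> at the distance \<open>\<rho> / 4\<close>.\<close>
  from order_tendstoD(2)[OF nu_small_square_tendsto[OF this e(2)], of "ennreal (mB / 4 * (\<rho> / 4)\<^sup>2)"]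
  obtain k where k: "(\<integral>\<^sup>+z. ennreal ((norm z)\<^sup>2) * indicator {z. 0 < norm z \<and> norm z \<le> e k} z \<partial>\<nu>) < ennreal (mB / 4 * (\<rho> / 4)\<^sup>2)"
    using mB \<rho> eventually_happens by (force simp: zero_less_mult_iff)
  define \<kappa> where "\<kappa> = e k"
  have \<kappa>: "0 < \<kappa>" "\<kappa> \<le> 1" "\<kappa> \<le> norm b / 2" using e by (auto simp: \<kappa>_def)
  note small = k[folded \<kappa>_def, THEN less_imp_le]
  define K where "K = {z::'h. \<kappa> < norm z}"
  have K: "K \<in> sets borel" unfolding K_def by measurable
  have Kfin: "emeasure \<nu> K < \<infinity>" unfolding K_def by (rule nu_away_finite[OF \<kappa>(1)])
  have BK: "B \<subseteq> K" using B_away \<kappa> by (auto simp: K_def)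
  define mK where "mK = measure \<nu> K"
  have "mB \<le> mK"
    unfolding mB_def mK_def using BK Kfin K sets_nu by (intro measure_mono_fmeasurable) (auto simp: fmeasurable_def B)
  with mB have mK: "0 < mK" by simp
  \<comment> \<open>The first bound gives \<open>exp (- ((v - u) * mK)) \<ge> 1 / 2\<close>, the second one a drift of at most \<open>\<rho> / 4\<close>.\<close>
  define d where "d = min (1 / (2 * mK)) (\<rho> / (4 * mK))"
  have cd: "0 < mB / 4" "0 < d" using mB mK \<rho> by (auto simp: d_def)
  have main: "\<exists>D\<in>sets (F v). (\<forall>K\<in>sets (F u). prob (K \<inter> D) = prob K * prob D) \<and>
      (AE \<omega> in M. \<omega> \<in> D \<longrightarrow> L v \<omega> - L u \<omega> \<in> cball b \<rho>) \<and> mB / 4 * (v - u) \<le> prob D"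
    if uv: "0 \<le> u" "u \<le> v" and vd: "v - u \<le> d" for u v
  proof -
    have d1: "(v - u) * mK \<le> 1 / 2" and d2: "(v - u) * mK \<le> \<rho> / 4"
      using vd mK by (auto simp: d_def field_simps)
    obtain e' :: "nat \<Rightarrow> real" where e': "\<And>k. 0 < e' k" "\<And>k. e' k \<le> \<kappa>"
      and lim: "AE \<omega> in M. \<exists>W. (\<lambda>k. compensated \<nu> N (jumps {z. e' k < norm z \<and> norm z \<le> \<kappa>} u v) \<omega>) \<longlonglongrightarrow> W \<and>
       integrable (N \<omega>) (jumps {z. \<kappa> < norm z} u v) \<and>
       L v \<omega> - L u \<omega> = W + (\<integral>p. jumps {z. \<kappa> < norm z} u v p \<partial>N \<omega>)
         - (\<integral>p. jumps {z. \<kappa> < norm z \<and> norm z \<le> 1} u v p \<partial>I)"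
      using levy_increment_limit[OF uv \<kappa>(1,2)] by blast
    define W where "W k = compensated \<nu> N (jumps {z::'h. e' k < norm z \<and> norm z \<le> \<kappa>} u v)" for k
    define S where "S k = {\<omega>\<in>space M. norm (W k \<omega>) < \<rho> / 4}" for k
    define E where "E = {\<omega>\<in>space M. emeasure (N \<omega>) (B \<times> {u<..v}) = 1 \<and> emeasure (N \<omega>) ((K - B) \<times> {u<..v}) = 0}"
    \<comment> \<open>Infinitely many \<open>W k\<close> below \<open>\<rho> / 4\<close> are enough to bound the limit, and this event keeps the uniform
      lower bound for the probabilities of the \<open>S k\<close>.\<close>
    define D where "D = E \<inter> (\<Inter>n. \<Union>k\<in>{n..}. S k)"
    have meas: "E \<in> sets G \<and> S k \<in> sets G"
      if G: "space G = space M"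
        and Gm: "\<And>B. B \<in> sets I \<Longrightarrow> B \<subseteq> UNIV \<times> {u<..v} \<Longrightarrow> (\<lambda>\<omega>. emeasure (N \<omega>) B) \<in> borel_measurable G" for G k
    proof
      have [measurable]: "(\<lambda>\<omega>. emeasure (N \<omega>) (B \<times> {u<..v})) \<in> borel_measurable G"
        "(\<lambda>\<omega>. emeasure (N \<omega>) ((K - B) \<times> {u<..v})) \<in> borel_measurable G"
        using B K uv by (auto intro!: Gm sets_I_times)
      show "E \<in> sets G" unfolding E_def G[symmetric] by measurable
      have A: "{z::'h. e' k < norm z \<and> norm z \<le> \<kappa>} \<in> sets borel" by measurable
      have [measurable]: "(\<lambda>\<omega>. \<integral>p. jumps {z. e' k < norm z \<and> norm z \<le> \<kappa>} u v p \<partial>N \<omega>) \<in> borel_measurable G"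
        by (rule measurable_integral_N[OF G _ Gm jumps_measurable[OF A uv(1)]])
          (use uv in \<open>auto simp: jumps_def indicator_def intro!: sets_I_times split: if_splits\<close>)
      show "S k \<in> sets G" unfolding S_def W_def compensated_def G[symmetric] by measurable
    qed
    have D: "D \<in> sets G"
      if "space G = space M"
        "\<And>B. B \<in> sets I \<Longrightarrow> B \<subseteq> UNIV \<times> {u<..v} \<Longrightarrow> (\<lambda>\<omega>. emeasure (N \<omega>) B) \<in> borel_measurable G" for G
      using meas[OF that] unfolding D_def by (intro sets.Int sets.countable_INT' sets.countable_UN') auto
    have EM: "E \<in> events" and SM: "S k \<in> events" for k using meas[OF refl emeasure_N_measurable] by auto
    have SIM: "(\<Inter>n. \<Union>k\<in>{n..}. S k) \<in> events"
      using SM by (intro sets.countable_INT' sets.countable_UN') auto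
    have "1 - mB / 4 * (v - u) \<le> prob (S k)" for k
      unfolding S_def W_def using small mB \<rho> by (intro prob_small_jumps_ge uv e' \<kappa>) auto
    then have "1 - mB / 4 * (v - u) \<le> prob (\<Inter>n. \<Union>k\<in>{n..}. S k)"
      by (intro prob_limsup_ge SM)
    moreover have "prob E = (v - u) * mB * exp (- ((v - u) * mK))"
      unfolding E_def mB_def mK_def by (rule prob_one_jump[OF B BK K Kfin uv])
    moreover have "(v - u) * mB * exp (- ((v - u) * mK)) \<ge> (v - u) * mB * (1 / 2)"
      using exp_ge_add_one_self[of "- ((v - u) * mK)"] d1 mB uv by (intro mult_left_mono) auto
    moreover have "prob E \<le> prob D + (1 - prob (\<Inter>n. \<Union>k\<in>{n..}. S k))"
    proof -
      have "E \<subseteq> D \<union> (space M - (\<Inter>n. \<Union>k\<in>{n..}. S k))" by (auto simp: D_def E_def)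
      then have "prob E \<le> prob (D \<union> (space M - (\<Inter>n. \<Union>k\<in>{n..}. S k)))"
        using EM SIM by (intro finite_measure_mono) (auto simp: D_def)
      also have "\<dots> \<le> prob D + prob (space M - (\<Inter>n. \<Union>k\<in>{n..}. S k))"
        using EM SIM by (intro measure_subadditive) (auto simp: D_def)
      finally show ?thesis using prob_compl[OF SIM] by simp
    qed
    moreover have "mB / 4 * (v - u) = (v - u) * mB * (1 / 2) - (v - u) * mB / 4"
      "mB / 4 * (v - u) = (v - u) * mB / 4" by (simp_all add: field_simps)
    ultimately have P: "mB / 4 * (v - u) \<le> prob D" by linarith
    have "AE \<omega> in M. \<omega> \<in> D \<longrightarrow> L v \<omega> - L u \<omega> \<in> cball b \<rho>"
      using lim
    proof (eventually_elim, intro impI)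
      fix \<omega>
      assume "\<exists>W. (\<lambda>k. compensated \<nu> N (jumps {z. e' k < norm z \<and> norm z \<le> \<kappa>} u v) \<omega>) \<longlonglongrightarrow> W \<and>
        integrable (N \<omega>) (jumps {z. \<kappa> < norm z} u v) \<and>
        L v \<omega> - L u \<omega> = W + (\<integral>p. jumps {z. \<kappa> < norm z} u v p \<partial>N \<omega>)
         - (\<integral>p. jumps {z. \<kappa> < norm z \<and> norm z \<le> 1} u v p \<partial>I)"
        and wD: "\<omega> \<in> D"
      then obtain V where V: "(\<lambda>k. W k \<omega>) \<longlonglongrightarrow> V" "integrable (N \<omega>) (jumps K u v)"
        "L v \<omega> - L u \<omega> = V + (\<integral>p. jumps K u v p \<partial>N \<omega>) - (\<integral>p. jumps {z. \<kappa> < norm z \<and> norm z \<le> 1} u v p \<partial>I)"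
        unfolding W_def K_def by blast
      have "norm V \<le> \<rho> / 4"
      proof (rule ccontr)
        assume "\<not> ?thesis"
        then have "\<forall>\<^sub>F k in sequentially. \<rho> / 4 < norm (W k \<omega>)"
          by (intro order_tendstoD(1)[OF tendsto_norm[OF V(1)]]) simp
        then obtain n where n: "\<And>k. n \<le> k \<Longrightarrow> \<rho> / 4 < norm (W k \<omega>)" by (auto simp: eventually_sequentially)
        obtain k where "n \<le> k" "\<omega> \<in> S k" using wD by (auto simp: D_def)
        with n[of k] show False by (simp add: S_def)
      qed
      moreover have "norm ((\<integral>p. jumps K u v p \<partial>N \<omega>) - b) \<le> r"
        using wD by (intro integral_single_jump[OF _ V(2) K B BK _ uv(1)]) (auto simp: D_def E_def B_def)
      moreover have "norm (\<integral>p. jumps {z. \<kappa> < norm z \<and> norm z \<le> 1} u v p \<partial>I) \<le> \<rho> / 4"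
        using integrable_jumps(2)[OF \<kappa>(1) uv] d2 by (simp add: mK_def K_def)
      moreover have "norm (L v \<omega> - L u \<omega> - b) \<le> norm V + norm ((\<integral>p. jumps K u v p \<partial>N \<omega>) - b)
          + norm (\<integral>p. jumps {z. \<kappa> < norm z \<and> norm z \<le> 1} u v p \<partial>I)"
      proof -
        have triangle: "norm (x + y - z) \<le> norm x + norm y + norm z" for x y z :: 'h
          using norm_triangle_ineq4[of "x + y" z] norm_triangle_ineq[of x y] by linarith
        have eq: "L v \<omega> - L u \<omega> - b = V + ((\<integral>p. jumps K u v p \<partial>N \<omega>) - b)
            - (\<integral>p. jumps {z. \<kappa> < norm z \<and> norm z \<le> 1} u v p \<partial>I)"
          using V(3) by simp
        show ?thesis unfolding eq by (rule triangle)
      qed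
      ultimately have "norm (L v \<omega> - L u \<omega> - b) \<le> \<rho> / 4 + r + \<rho> / 4" by linarith
      then show "L v \<omega> - L u \<omega> \<in> cball b \<rho>"
        using r \<rho> by (simp add: dist_norm norm_minus_commute)
    qed
    with P increment_event_adapted_indep[OF uv D] show ?thesis by blast
  qed
  show ?thesis
    by (rule exI[where x="mB / 4"], rule conjI[OF cd(1)], rule exI[where x=d], rule conjI[OF cd(2)])
      (use main in blast)
qed

section \<open>One jump of the solution\<close>

lemma stay_event_measurable:
  fixes X :: "real \<Rightarrow> 'w \<Rightarrow> 'h"
  assumes X: "adapted F X" and t: "0 \<le> t"
  shows "{\<omega>\<in>space M. \<forall>q\<in>\<rat>. 0 \<le> q \<and> q < t \<longrightarrow> X q \<omega> \<in> ball h \<eta>} \<in> sets (F t)"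
proof -
  let ?Q = "{q::real\<in>\<rat>. 0 \<le> q \<and> q < t}"
  have "countable ?Q" by (rule countable_subset[OF _ countable_rat]) auto
  moreover have "{\<omega>\<in>space M. X q \<omega> \<notin> ball h \<eta>} \<in> sets (F t)" if q: "q \<in> ?Q" for q
  proof -
    have [measurable]: "X q \<in> borel_measurable (F q)" using X q by (simp add: adapted_def)
    have "space (F q) - {\<omega>\<in>space (F q). X q \<omega> \<in> ball h \<eta>} \<in> sets (F q)"
      by (intro sets.Diff sets.top measurable_Collect_ball) measurable
    also have "space (F q) - {\<omega>\<in>space (F q). X q \<omega> \<in> ball h \<eta>} = {\<omega>\<in>space M. X q \<omega> \<notin> ball h \<eta>}"
      by (auto simp: space_F)
    finally have "{\<omega>\<in>space M. X q \<omega> \<notin> ball h \<eta>} \<in> sets (F q)" .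
    with sets_F_mono[of q t] q show ?thesis by auto
  qed
  ultimately have "space (F t) - (\<Union>q\<in>?Q. {\<omega>\<in>space M. X q \<omega> \<notin> ball h \<eta>}) \<in> sets (F t)"
    by (intro sets.Diff sets.countable_UN' sets.top) auto
  also have "space (F t) - (\<Union>q\<in>?Q. {\<omega>\<in>space M. X q \<omega> \<notin> ball h \<eta>}) =
      {\<omega>\<in>space M. \<forall>q\<in>\<rat>. 0 \<le> q \<and> q < t \<longrightarrow> X q \<omega> \<in> ball h \<eta>}"
    by (auto simp: space_F)
  finally show ?thesis .
qed

text \<open>
The single jump. On the grid with \<open>m n\<close> cells of \<open>[0, S]\<close>, the event \<open>E n\<close> says that in some cell the
process has stayed in the ball up to the beginning of the cell and \<open>L\<close> makes an increment close to \<open>b\<close>. The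
first success bound for \<open>E n\<close> does not depend on \<open>n\<close>, because \<open>m n\<close> cells of success probability at least
\<open>c * (S / m n)\<close> add up to \<open>c * S\<close>.
\<close>

lemma reaches_by_jump:
  fixes J :: "'v::banach \<Rightarrow>\<^sub>L 'h" and X :: "real \<Rightarrow> 'w \<Rightarrow> 'h"
  assumes J: "gelfand_triple J" and X: "is_solution J M F A L x X"
    and stay: "0 < prob {\<omega>\<in>space M. \<forall>q\<in>\<rat>. 0 \<le> q \<and> q < T \<longrightarrow> X q \<omega> \<in> ball h \<eta>}" and T: "0 < T"
    and supp: "\<forall>r>0. 0 < emeasure \<nu> (ball b r)"
    and \<rho>: "0 < \<rho>" "\<rho> < norm b" and \<epsilon>: "\<eta> + \<rho> < \<epsilon>" and s: "0 < s"
  shows "\<exists>q\<in>\<rat>. 0 < q \<and> q < s \<and> 0 < prob {\<omega>\<in>space M. X q \<omega> \<in> ball (h + b) \<epsilon>}"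
proof -
  have adapted: "adapted F X" and paths: "cadlag_paths M X" using X by (auto simp: is_solution_def)
  have L_paths: "cadlag_paths M L" using levy_process by (simp add: levy_process_of_def)
  \<comment> \<open>\<open>S < s\<close> leaves room for a rational time after a jump at \<open>S\<close>.\<close>
  define S where "S = min (s / 2) T"
  have S: "0 < S" "S < s" "S \<le> T" using s T by (auto simp: S_def)
  have "b \<noteq> 0" using \<rho> by auto
  from levy_increment_event[OF this supp \<rho>(1)] obtain c d where c: "0 < c" "0 < d"
    and ex: "\<forall>u v. 0 \<le> u \<and> u \<le> v \<and> v - u \<le> d \<longrightarrow>
    (\<exists>D\<in>sets (F v). (\<forall>K\<in>sets (F u). prob (K \<inter> D) = prob K * prob D) \<and>
      (AE \<omega> in M. \<omega> \<in> D \<longrightarrow> L v \<omega> - L u \<omega> \<in> cball b \<rho>) \<and> c * (v - u) \<le> prob D)"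
    by (elim exE conjE)
  define D where "D u v = (SOME D. D \<in> sets (F v) \<and> (\<forall>K\<in>sets (F u). prob (K \<inter> D) = prob K * prob D) \<and>
      (AE \<omega> in M. \<omega> \<in> D \<longrightarrow> L v \<omega> - L u \<omega> \<in> cball b \<rho>) \<and> c * (v - u) \<le> prob D)" for u v
  have D: "D u v \<in> sets (F v) \<and> (\<forall>K\<in>sets (F u). prob (K \<inter> D u v) = prob K * prob (D u v)) \<and>
      (AE \<omega> in M. \<omega> \<in> D u v \<longrightarrow> L v \<omega> - L u \<omega> \<in> cball b \<rho>) \<and> c * (v - u) \<le> prob (D u v)"
    if "0 \<le> u" "u \<le> v" "v - u \<le> d" for u v
    unfolding D_def
    by (rule someI_ex, rule ex[rule_format, unfolded Bex_def]) (use that in simp)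
  obtain m0 :: nat where m0: "S / d \<le> real m0" using real_arch_simple by blast
  \<comment> \<open>The shift by \<open>m0\<close> keeps the mesh below \<open>d\<close> from the first grid on.\<close>
  define m where "m n = Suc (n + m0)" for n
  define u where "u n j = S * real j / real (m n)" for n j
  have u_0: "0 \<le> u n j" for n j using S by (simp add: u_def)
  have u_step: "u n (Suc j) - u n j = S / real (m n)" for n j
    by (simp add: u_def diff_divide_distrib[symmetric] algebra_simps)
  have step: "0 < S / real (m n)" "S / real (m n) \<le> d" for n
  proof -
    show "0 < S / real (m n)" using S by (simp add: m_def)
    have "S \<le> d * real m0" using m0 c by (simp add: field_simps)
    also have "\<dots> \<le> d * real (m n)" using c by (intro mult_left_mono) (auto simp: m_def)
    finally show "S / real (m n) \<le> d" by (simp add: m_def field_simps)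
  qed
  have u_mono: "u n i \<le> u n j" if "i \<le> j" for n i j
    using that S by (simp add: u_def divide_right_mono mult_left_mono)
  have u_m: "u n (m n) = S" for n by (simp add: u_def m_def)
  note Du = D[OF u_0 u_mono[OF le_SucI[OF order_refl]], unfolded u_step, OF step(2)]
  define C where "C t = {\<omega>\<in>space M. \<forall>q\<in>\<rat>. 0 \<le> q \<and> q < t \<longrightarrow> X q \<omega> \<in> ball h \<eta>}" for t
  have C: "C t \<in> sets (F t)" if "0 \<le> t" for t unfolding C_def by (rule stay_event_measurable[OF adapted that])
  have C_anti: "C t' \<subseteq> C t" if "t \<le> t'" for t t' using that by (auto simp: C_def)
  have F_ev: "K \<in> events" if "K \<in> sets (F t)" for K t using that subalg by (auto simp: subalgebra_def)
  have "0 < prob (C T)" using stay by (simp add: C_def)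
  also have "\<dots> \<le> prob (C S)" using S C[of S] F_ev by (intro finite_measure_mono C_anti) auto
  finally have p: "0 < prob (C S)" .
  define E where "E n = (\<Union>j<m n. C (u n j) \<inter> D (u n j) (u n (Suc j)))" for n
  have E_ev: "E n \<in> events" for n
  proof -
    have "C (u n j) \<in> events" "D (u n j) (u n (Suc j)) \<in> events" for j
      using F_ev[OF C[OF u_0]] Du[of n j] by (blast intro: F_ev)+
    then show ?thesis unfolding E_def by (intro sets.finite_UN sets.Int) auto
  qed
  have E_ge: "c * S * prob (C S) / (1 + c * S) \<le> prob (E n)" for n
  proof -
    have "m n * (c * (S / m n)) * (prob (C (u n (m n))) - prob (E n)) \<le> prob (E n)"
      unfolding E_def
    proof (rule prob_first_success_ge[where G="\<lambda>j. F (u n j)"])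
      show "c * (S / real (m n)) \<le> prob (D (u n j) (u n (Suc j)))" for j using Du by blast
      show "0 \<le> c * (S / real (m n))" using c S by simp
      show "sets (F (u n i)) \<subseteq> sets (F (u n j))" if "i \<le> j" for i j by (intro sets_F_mono u_mono that)
      show "C (u n (m n)) \<subseteq> C (u n j)" if "j \<le> m n" for j by (intro C_anti u_mono that)
    qed (use Du subalg C u_0 in auto)
    moreover have "m n * (c * (S / m n)) = c * S" by (simp add: m_def)
    ultimately have "c * S * (prob (C S) - prob (E n)) \<le> prob (E n)" by (simp only: u_m)
    moreover have "0 < c * S" using c S by simp
    ultimately show ?thesis by (simp add: field_simps)
  qed
  have "c * S * prob (C S) / (1 + c * S) \<le> prob (\<Inter>n. \<Union>k\<in>{n..}. E k)"
    by (rule prob_limsup_ge[OF E_ev E_ge])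
  moreover have "0 < c * S * prob (C S) / (1 + c * S)" using c S p by (simp add: add_pos_pos)
  ultimately have pos: "0 < prob (\<Inter>n. \<Union>k\<in>{n..}. E k)" by linarith
  have "AE \<omega> in M. \<forall>n j. \<omega> \<in> D (u n j) (u n (Suc j)) \<longrightarrow> L (u n (Suc j)) \<omega> - L (u n j) \<omega> \<in> cball b \<rho>"
    unfolding AE_all_countable using Du by blast
  with solution_jump_eq[OF J X] AE_space
  have "AE \<omega> in M. \<omega> \<in> (\<Inter>n. \<Union>k\<in>{n..}. E k) \<longrightarrow>
      (\<exists>q\<in>{q\<in>\<rat>. 0 < q \<and> q < s}. \<omega> \<in> {\<omega>\<in>space M. X q \<omega> \<in> ball (h + b) \<epsilon>})"
  proof eventually_elim
    case (elim \<omega>)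
    show ?case
    proof
      assume mem: "\<omega> \<in> (\<Inter>n. \<Union>k\<in>{n..}. E k)"
      have "\<exists>n j. k \<le> n \<and> j < m n \<and> \<omega> \<in> C (u n j) \<and> \<omega> \<in> D (u n j) (u n (Suc j))" for k
        using mem by (auto simp: E_def) blast
      then obtain n j where nj: "\<And>k. k \<le> n k" "\<And>k. j k < m (n k)" "\<And>k. \<omega> \<in> C (u (n k) (j k))"
        "\<And>k. \<omega> \<in> D (u (n k) (j k)) (u (n k) (Suc (j k)))" by metis
      have "\<exists>q\<in>\<rat>. 0 < q \<and> q < s \<and> X q \<omega> \<in> ball (h + b) \<epsilon>"
      proof (rule jump_lands_in_ball[where u="\<lambda>k. u (n k) (j k)" and v="\<lambda>k. u (n k) (Suc (j k))"
            and L="\<lambda>t. L t \<omega>" and S=S and \<eta>=\<eta> and \<rho>=\<rho>])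
        show "cadlag (\<lambda>t. X t \<omega>)" "cadlag (\<lambda>t. L t \<omega>)"
          using paths L_paths elim(2) by (auto simp: cadlag_paths_def)
        show "0 \<le> u (n k) (j k) \<and> u (n k) (j k) < u (n k) (Suc (j k)) \<and> u (n k) (Suc (j k)) \<le> S" for k
          using u_0 u_step[of "n k" "j k"] step(1)[of "n k"] u_mono[of "Suc (j k)" "m (n k)" "n k"] nj(2)[of k]
          by (auto simp: u_m)
        show "(\<lambda>k. u (n k) (Suc (j k)) - u (n k) (j k)) \<longlonglongrightarrow> 0"
          unfolding u_step
        proof (rule tendsto_sandwich[OF _ _ tendsto_const])
          show "(\<lambda>k. S / real (Suc k)) \<longlonglongrightarrow> 0" by (rule LIMSEQ_Suc) (rule lim_const_over_n)
          have "Suc k \<le> m (n k)" for k using nj(1)[of k] by (simp add: m_def)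
          then show "\<forall>\<^sub>F k in sequentially. S / real (m (n k)) \<le> S / real (Suc k)"
            using S by (intro always_eventually allI divide_left_mono of_nat_mono) (auto simp: m_def)
          show "\<forall>\<^sub>F k in sequentially. 0 \<le> S / real (m (n k))"
            by (intro always_eventually allI less_imp_le step(1))
        qed
        show "X q \<omega> \<in> ball h \<eta>" if "q \<in> \<rat>" "0 \<le> q" "q < u (n k) (j k)" for k q
          using nj(3)[of k] that by (auto simp: C_def)
      qed (use elim nj(4) \<rho> \<epsilon> S in auto)
      then show "\<exists>q\<in>{q\<in>\<rat>. 0 < q \<and> q < s}. \<omega> \<in> {\<omega>\<in>space M. X q \<omega> \<in> ball (h + b) \<epsilon>}"
        using elim(2) by auto
    qed
  qed
  then have "\<exists>q\<in>{q\<in>\<rat>. 0 < q \<and> q < s}. 0 < prob {\<omega>\<in>space M. X q \<omega> \<in> ball (h + b) \<epsilon>}"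
  proof (rule exists_prob_pos[OF _ _ pos, rotated 2])
    show "countable {q::real\<in>\<rat>. 0 < q \<and> q < s}" by (rule countable_subset[OF _ countable_rat]) auto
    fix q assume "q \<in> {q::real\<in>\<rat>. 0 < q \<and> q < s}"
    then have "X q \<in> borel_measurable (F q)" using adapted by (simp add: adapted_def)
    then have [measurable]: "X q \<in> borel_measurable M" using measurable_from_subalg[OF subalg] by blast
    show "{\<omega>\<in>space M. X q \<omega> \<in> ball (h + b) \<epsilon>} \<in> events" by (rule measurable_Collect_ball) measurable
  qed
  then show ?thesis by blast
qed

text \<open>
Integrating the Markov property at the deterministic time \<open>v\<close>, the probability of being in \<open>B\<close> at
\<open>v + q\<close> is the mean of the transition probability from the state at \<open>v\<close>. If it vanished for all \<open>q \<in> Q\<close>,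
then almost surely no \<open>q\<close> would lead from the state at \<open>v\<close> to \<open>B\<close>. Countability of \<open>Q\<close> allows the waiting
time \<open>q\<close> to depend on the starting point in \<open>U\<close>.
\<close>

lemma markov_positive:
  fixes X :: "'h \<Rightarrow> real \<Rightarrow> 'w \<Rightarrow> 'h"
  assumes markov: "strong_markov M F X" and adapted: "\<And>y. adapted F (X y)"
    and v: "0 \<le> v" and U: "0 < transition_prob M X v x U"
    and Q: "countable Q" "\<And>q. q \<in> Q \<Longrightarrow> 0 \<le> q" and B: "B \<in> sets borel"
    and reach: "\<And>y. y \<in> U \<Longrightarrow> \<exists>q\<in>Q. 0 < transition_prob M X q y B"
  shows "\<exists>q\<in>Q. 0 < transition_prob M X (v + q) x B"
proof (rule ccontr)
  assume neg: "\<not> ?thesis"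
  have meas: "X y t \<in> borel_measurable M" if "0 \<le> t" for y t
    using adapted[of y] that measurable_from_subalg[OF subalg] by (auto simp: adapted_def)
  interpret filt: filtration "space M" F using basis by (simp add: usual_filtered_prob_space_def)
  define G where "G = filt.pre_sigma (\<lambda>_. v)"
  have stop: "stopping_time F (\<lambda>_. v)" by (rule stopping_time_const)
  have "subalgebra M G"
    unfolding subalgebra_def
  proof
    show "space G = space M" unfolding G_def by (rule filt.space_pre_sigma)
    show "sets G \<subseteq> sets M"
    proof
      fix A assume "A \<in> sets G"
      from filt.sets_pre_sigmaD[OF stop this[unfolded G_def], of v] have "A \<in> sets (F v)" by simp
      then show "A \<in> sets M" using subalg by (auto simp: subalgebra_def)
    qed
  qed
  then interpret G: finite_measure_subalgebra M G by unfold_locales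
  have zero: "AE \<omega> in M. transition_prob M X q (X x v \<omega>) B = 0" if q: "q \<in> Q" for q
  proof -
    have q0: "0 \<le> q" using Q q by blast
    define f where "f \<omega> = (indicator B (X x (v + q) \<omega>) :: real)" for \<omega>
    have [measurable]: "X x (v + q) \<in> borel_measurable M" "X x v \<in> borel_measurable M" using v q0 by (auto intro: meas)
    note [measurable] = B
    have fm: "f \<in> borel_measurable M" unfolding f_def[abs_def] by measurable
    have f: "integrable M f" by (rule integrable_const_bound[OF _ fm, where B=1]) (simp add: f_def)
    have eq: "AE \<omega> in M. real_cond_exp M G f \<omega> = transition_prob M X q (X x v \<omega>) B"
      using markov stop v q0 B unfolding strong_markov_def G_def f_def[abs_def] by blast
    have "(\<lambda>y. transition_prob M X q y B) \<in> borel_measurable borel"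
      using markov q0 B by (simp add: strong_markov_def)
    then have tm: "(\<lambda>\<omega>. transition_prob M X q (X x v \<omega>) B) \<in> borel_measurable M"
      by (rule measurable_compose[rotated]) measurable
    have ti: "integrable M (\<lambda>\<omega>. transition_prob M X q (X x v \<omega>) B)"
      by (rule integrable_const_bound[OF _ tm, where B=1]) (simp add: transition_prob_def)
    have "(\<integral>\<omega>. transition_prob M X q (X x v \<omega>) B \<partial>M) = (\<integral>\<omega>. real_cond_exp M G f \<omega> \<partial>M)"
      by (rule integral_cong_AE[OF tm]) (use eq in \<open>auto elim: eventually_mono\<close>)
    also have "\<dots> = (\<integral>\<omega>. f \<omega> \<partial>M)" by (rule G.real_cond_exp_int(2)[OF f])
    also have "\<dots> = (\<integral>\<omega>. indicator {\<omega>\<in>space M. X x (v + q) \<omega> \<in> B} \<omega> \<partial>M)"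
      by (intro Bochner_Integration.integral_cong) (auto simp: f_def indicator_def)
    also have "\<dots> = prob {\<omega>\<in>space M. X x (v + q) \<omega> \<in> B}" by simp
    also have "\<dots> = 0" using neg q by (auto simp: transition_prob_def zero_less_measure_iff)
    finally show ?thesis
      using integral_nonneg_eq_0_iff_AE[OF ti] by (simp add: transition_prob_def)
  qed
  have "AE \<omega> in M. \<forall>q\<in>Q. transition_prob M X q (X x v \<omega>) B = 0"
    using zero by (intro AE_ball_countable[THEN iffD2, OF Q(1)]) blast
  then have "AE \<omega> in M. \<omega> \<notin> {\<omega>\<in>space M. X x v \<omega> \<in> U}"
  proof eventually_elim
    case (elim \<omega>)
    then show ?case using reach[of "X x v \<omega>"] by auto
  qed
  moreover have "{\<omega>\<in>space M. X x v \<omega> \<in> U} \<in> events"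
    using U measure_notin_sets unfolding transition_prob_def by fastforce
  ultimately have "prob {\<omega>\<in>space M. X x v \<omega> \<in> U} = 0" by (simp add: prob_eq_0)
  with U show False by (simp add: transition_prob_def)
qed

end

section \<open>Irreducibility\<close>

lemma exit_time_ge_imp_in_ball:
  assumes "ennreal t \<le> exit_time X \<eta> y h \<omega>" "0 \<le> q" "q < t"
  shows "X y q \<omega> \<in> ball h \<eta>"
proof (rule ccontr)
  assume "X y q \<omega> \<notin> ball h \<eta>"
  then have "exit_time X \<eta> y h \<omega> \<le> ennreal q"
    unfolding exit_time_def using assms(2) by (intro Inf_lower) auto
  with assms(1) have "ennreal t \<le> ennreal q" by (rule order_trans)
  with assms(2,3) show False by (simp add: ennreal_le_iff)
qed

locale jump_driven_markov = poisson_levy M F \<nu> N L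
  for M :: "'w measure" and F and \<nu> :: "'h::{real_inner,banach,second_countable_topology} measure" and N and L +
  fixes J :: "'v::banach \<Rightarrow>\<^sub>L 'h" and A :: "'v \<Rightarrow> ('v \<Rightarrow>\<^sub>L real)" and X :: "'h \<Rightarrow> real \<Rightarrow> 'w \<Rightarrow> 'h"
  assumes triple: "gelfand_triple J"
    and solution: "is_solution J M F A L x (X x)"
    and markov: "strong_markov M F X"
    and stays: "\<exists>\<eta>h>0. \<forall>\<eta>\<in>{0<..\<eta>h}. \<exists>\<epsilon>\<in>{0<..\<eta>/2}. \<exists>t>0.
      (INF h'\<in>ball h \<epsilon>. measure M {\<omega>\<in>space M. exit_time X \<eta> h' h \<omega> \<ge> ennreal t}) > 0"
begin

abbreviation P :: "'h \<Rightarrow> real \<Rightarrow> 'h set \<Rightarrow> real" where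
  "P x t B \<equiv> transition_prob M X t x B"

lemma adapted_X: "adapted F (X x)" and cadlag_X: "cadlag_paths M (X x)"
  using solution by (auto simp: is_solution_def)

lemma X_measurable: "0 \<le> t \<Longrightarrow> X x t \<in> borel_measurable M"
  using adapted_X[of x] measurable_from_subalg[OF subalg] by (auto simp: adapted_def)

lemma stays_near:
  assumes "0 < \<delta>"
  obtains \<eta> \<epsilon> t where "0 < \<eta>" "\<eta> \<le> \<delta>" "0 < \<epsilon>" "0 < t"
    "\<And>y. y \<in> ball h \<epsilon> \<Longrightarrow> 0 < prob {\<omega>\<in>space M. exit_time X \<eta> y h \<omega> \<ge> ennreal t}"
proof -
  obtain \<eta>h where \<eta>h: "0 < \<eta>h" and ex: "\<forall>\<eta>\<in>{0<..\<eta>h}. \<exists>\<epsilon>\<in>{0<..\<eta>/2}. \<exists>t>0.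
      (INF h'\<in>ball h \<epsilon>. measure M {\<omega>\<in>space M. exit_time X \<eta> h' h \<omega> \<ge> ennreal t}) > 0"
    using stays[of h] by blast
  define \<eta> where "\<eta> = min \<eta>h \<delta>"
  have \<eta>: "0 < \<eta>" "\<eta> \<le> \<delta>" "\<eta> \<in> {0<..\<eta>h}" using \<eta>h assms by (auto simp: \<eta>_def)
  obtain \<epsilon> t where \<epsilon>: "0 < \<epsilon>" and t: "0 < t"
    and inf: "(INF h'\<in>ball h \<epsilon>. prob {\<omega>\<in>space M. exit_time X \<eta> h' h \<omega> \<ge> ennreal t}) > 0"
    using bspec[OF ex \<eta>(3)] by auto
  have "0 < prob {\<omega>\<in>space M. exit_time X \<eta> y h \<omega> \<ge> ennreal t}" if "y \<in> ball h \<epsilon>" for y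
    by (rule less_le_trans[OF inf cINF_lower[OF _ that]]) (auto intro!: bdd_belowI2[where m=0])
  with \<eta> \<epsilon> t show thesis by (intro that)
qed

lemma remains_in_ball_until:
  assumes "0 < \<delta>"
  obtains \<epsilon> t where "0 < \<epsilon>" "0 < t" "\<And>y r. y \<in> ball h \<epsilon> \<Longrightarrow> 0 \<le> r \<Longrightarrow> r < t \<Longrightarrow> 0 < P y r (ball h \<delta>)"
proof -
  obtain \<eta> \<epsilon> t where \<eta>: "\<eta> \<le> \<delta>" and \<epsilon>: "0 < \<epsilon>" "0 < t"
    and ex: "\<And>y. y \<in> ball h \<epsilon> \<Longrightarrow> 0 < prob {\<omega>\<in>space M. exit_time X \<eta> y h \<omega> \<ge> ennreal t}"
    using stays_near[OF assms, of h] by metis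
  have "0 < P y r (ball h \<delta>)" if "y \<in> ball h \<epsilon>" "0 \<le> r" "r < t" for y r
  proof (rule less_le_trans[OF ex[OF that(1)]])
    show "prob {\<omega>\<in>space M. exit_time X \<eta> y h \<omega> \<ge> ennreal t} \<le> P y r (ball h \<delta>)"
      unfolding transition_prob_def
      using exit_time_ge_imp_in_ball[OF _ that(2,3), of X \<eta> y h] \<eta>
      by (intro finite_measure_mono measurable_Collect_ball X_measurable that) force
  qed
  with \<epsilon> show thesis by (rule that)
qed

text \<open>
The waiting time \<open>q\<close> may depend on the starting point \<open>y\<close>, but it is below any prescribed \<open>s\<close>, whereas
\<open>\<epsilon>\<close> depends neither on \<open>y\<close> nor on \<open>s\<close>: both are needed for composing jumps.
\<close>

lemma reaches_one_jump:
  assumes supp: "\<forall>r>0. 0 < emeasure \<nu> (ball b r)" and b: "b \<noteq> 0" and \<epsilon>': "0 < \<epsilon>'"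
  shows "\<exists>\<epsilon>>0. \<forall>y\<in>ball h \<epsilon>. \<forall>s>0. \<exists>q\<in>\<rat>. 0 < q \<and> q < s \<and> 0 < P y q (ball (h + b) \<epsilon>')"
proof -
  \<comment> \<open>\<open>\<rho> < norm b\<close> keeps the increments away from \<open>0\<close>, so that they indicate jumps.\<close>
  define \<rho> where "\<rho> = min (\<epsilon>' / 4) (norm b / 2)"
  have \<rho>: "0 < \<rho>" "\<rho> < norm b" "\<epsilon>' / 4 + \<rho> < \<epsilon>'" using b \<epsilon>' by (auto simp: \<rho>_def min_def)
  have "0 < \<epsilon>' / 4" using \<epsilon>' by simp
  from stays_near[OF this, of h] obtain \<eta> \<epsilon> t where \<eta>: "\<eta> \<le> \<epsilon>' / 4" and \<epsilon>: "0 < \<epsilon>" and t: "0 < t"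
    and ex: "\<And>y. y \<in> ball h \<epsilon> \<Longrightarrow> 0 < prob {\<omega>\<in>space M. exit_time X \<eta> y h \<omega> \<ge> ennreal t}"
    by metis
  have "\<exists>q\<in>\<rat>. 0 < q \<and> q < s \<and> 0 < P y q (ball (h + b) \<epsilon>')" if y: "y \<in> ball h \<epsilon>" and s: "0 < s" for y s
    unfolding transition_prob_def
  proof (rule reaches_by_jump[OF triple solution _ t supp \<rho>(1,2) _ s, where \<eta>=\<eta>])
    have "prob {\<omega>\<in>space M. exit_time X \<eta> y h \<omega> \<ge> ennreal t} \<le>
        prob {\<omega>\<in>space M. \<forall>q\<in>\<rat>. 0 \<le> q \<and> q < t \<longrightarrow> X y q \<omega> \<in> ball h \<eta>}"
    proof (rule finite_measure_mono)
      show "{\<omega>\<in>space M. exit_time X \<eta> y h \<omega> \<ge> ennreal t} \<subseteq>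
          {\<omega>\<in>space M. \<forall>q\<in>\<rat>. 0 \<le> q \<and> q < t \<longrightarrow> X y q \<omega> \<in> ball h \<eta>}"
        by (intro Collect_mono impI) (metis exit_time_ge_imp_in_ball)
      show "{\<omega>\<in>space M. \<forall>q\<in>\<rat>. 0 \<le> q \<and> q < t \<longrightarrow> X y q \<omega> \<in> ball h \<eta>} \<in> events"
        using stay_event_measurable[OF adapted_X less_imp_le[OF t]] subalg[of t] unfolding subalgebra_def by blast
    qed
    with ex[OF y] show "0 < prob {\<omega>\<in>space M. \<forall>q\<in>\<rat>. 0 \<le> q \<and> q < t \<longrightarrow> X y q \<omega> \<in> ball h \<eta>}" by linarith
    show "\<eta> + \<rho> < \<epsilon>'" using \<eta> \<rho> by linarith
  qed
  with \<epsilon> show ?thesis by blast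
qed

text \<open>
The radii are chosen backwards, from the last jump to the first; each jump is allowed half of the
remaining time.
\<close>

lemma reaches_sum_of_jumps:
  fixes n :: nat and b :: "nat \<Rightarrow> 'h"
  assumes "1 \<le> n" and "\<forall>i\<in>{1..n}. b i \<noteq> 0 \<and> (\<forall>r>0. 0 < emeasure \<nu> (ball (b i) r))" and "0 < \<epsilon>'"
  shows "\<exists>\<epsilon>>0. \<forall>y\<in>ball h \<epsilon>. \<forall>s>0. \<exists>q\<in>\<rat>. 0 < q \<and> q < s \<and> 0 < P y q (ball (h + (\<Sum>i=1..n. b i)) \<epsilon>')"
  using assms
proof (induction n arbitrary: \<epsilon>' rule: nat_induct_at_least)
  case base
  then show ?case using reaches_one_jump[of "b 1" \<epsilon>' h] by simp
next
  case (Suc n)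
  let ?g = "h + (\<Sum>i=1..n. b i)" and ?h = "h + (\<Sum>i=1..Suc n. b i)"
  have g: "?g + b (Suc n) = ?h" by (simp add: add.assoc)
  obtain \<epsilon>1 where \<epsilon>1: "0 < \<epsilon>1" and last: "\<And>y s. y \<in> ball ?g \<epsilon>1 \<Longrightarrow> 0 < s \<Longrightarrow>
      \<exists>q\<in>\<rat>. 0 < q \<and> q < s \<and> 0 < P y q (ball ?h \<epsilon>')"
    using reaches_one_jump[of "b (Suc n)" \<epsilon>' ?g, unfolded g] Suc.prems by auto
  obtain \<epsilon> where \<epsilon>: "0 < \<epsilon>" and first: "\<And>y s. y \<in> ball h \<epsilon> \<Longrightarrow> 0 < s \<Longrightarrow>
      \<exists>q\<in>\<rat>. 0 < q \<and> q < s \<and> 0 < P y q (ball ?g \<epsilon>1)"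
    using Suc.IH[OF _ \<epsilon>1] Suc.prems by auto
  have "\<exists>q\<in>\<rat>. 0 < q \<and> q < s \<and> 0 < P y q (ball ?h \<epsilon>')" if y: "y \<in> ball h \<epsilon>" and s: "0 < s" for y s
  proof -
    obtain q1 where q1: "q1 \<in> \<rat>" "0 < q1" "q1 < s / 2" "0 < P y q1 (ball ?g \<epsilon>1)"
      using first[OF y, of "s / 2"] s by auto
    let ?Q = "{q\<in>\<rat>. 0 < q \<and> q < s / 2}"
    have "countable ?Q" by (rule countable_subset[OF _ countable_rat]) auto
    moreover have "\<exists>q\<in>?Q. 0 < P y' q (ball ?h \<epsilon>')" if "y' \<in> ball ?g \<epsilon>1" for y'
      using last[OF that, of "s / 2"] s by auto
    ultimately have "\<exists>q\<in>?Q. 0 < P y (q1 + q) (ball ?h \<epsilon>')"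
      using q1 by (intro markov_positive[OF markov adapted_X, where U="ball ?g \<epsilon>1"]) auto
    then obtain q2 where q2: "q2 \<in> \<rat>" "0 < q2" "q2 < s / 2" "0 < P y (q1 + q2) (ball ?h \<epsilon>')" by blast
    with q1 show ?thesis by (intro bexI[of _ "q1 + q2"]) auto
  qed
  with \<epsilon> show ?case by blast
qed

text \<open>
The position \<open>h\<close> must be fixed before it is known how long the process stays near it and the later
positions, and hence before it is known how late before \<open>T\<close> the jumps have to begin. A support point of the
law of the left limit at \<open>T\<close> is approached with positive probability at times arbitrarily close to \<open>T\<close>,
which breaks this circle.
\<close>

lemma law_before_has_support_point:
  assumes T: "0 < T"
  obtains h where "\<And>r s. 0 < r \<Longrightarrow> s < T \<Longrightarrow> \<exists>v. 0 \<le> v \<and> s < v \<and> v < T \<and> 0 < P x v (ball h r)"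
proof -
  define v where "v n = T - T / real (Suc n)" for n
  have v: "0 \<le> v n" "v n < T" for n using T by (auto simp: v_def divide_simps)
  have "v \<longlonglongrightarrow> T - 0"
    unfolding v_def[abs_def] by (intro tendsto_intros LIMSEQ_Suc lim_const_over_n)
  then have v_lim: "v \<longlonglongrightarrow> T" by simp
  define Y where "Y \<omega> = lim (\<lambda>n. X x (v n) \<omega>)" for \<omega>
  have Y_lim: "(\<lambda>n. X x (v n) \<omega>) \<longlonglongrightarrow> Y \<omega>" if w: "\<omega> \<in> space M" for \<omega>
  proof -
    have "cadlag (\<lambda>t. X x t \<omega>)" using cadlag_X[of x] w by (simp add: cadlag_paths_def)
    then obtain l where l: "((\<lambda>t. X x t \<omega>) \<longlongrightarrow> l) (at_left T)"
      using T unfolding cadlag_def by blast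
    have "(\<lambda>n. X x (v n) \<omega>) \<longlonglongrightarrow> l"
      using v v_lim by (intro filterlim_compose[OF l] tendsto_imp_filterlim_at_left) auto
    then show ?thesis unfolding Y_def using limI by metis
  qed
  have Ym: "Y \<in> borel_measurable M"
    by (rule borel_measurable_LIMSEQ_metric[OF X_measurable[OF v(1)] Y_lim])
  interpret D: prob_space "distr M borel Y" by (rule prob_space_distr[OF Ym])
  have "emeasure (distr M borel Y) UNIV \<noteq> 0" using D.emeasure_space_1 by simp
  then obtain h where h: "\<And>r. 0 < r \<Longrightarrow> 0 < emeasure (distr M borel Y) (ball h r)"
    using support_point_exists[of "distr M borel Y" UNIV] by auto
  have "\<exists>v. 0 \<le> v \<and> s < v \<and> v < T \<and> 0 < P x v (ball h r)" if r: "0 < r" and s: "s < T" for r s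
  proof -
    have "0 < prob {\<omega>\<in>space M. Y \<omega> \<in> ball h r}"
      using h[OF r] Ym by (simp add: emeasure_distr emeasure_eq_measure vimage_def Int_def conj_commute)
    moreover have "AE \<omega> in M. \<omega> \<in> {\<omega>\<in>space M. Y \<omega> \<in> ball h r} \<longrightarrow>
        (\<exists>n\<in>{n. s < v n}. \<omega> \<in> {\<omega>\<in>space M. X x (v n) \<omega> \<in> ball h r})"
    proof (intro AE_I2 impI)
      fix \<omega> assume w: "\<omega> \<in> space M" and "\<omega> \<in> {\<omega>\<in>space M. Y \<omega> \<in> ball h r}"
      then have "\<forall>\<^sub>F n in sequentially. X x (v n) \<omega> \<in> ball h r"
        by (intro topological_tendstoD[OF Y_lim]) auto
      moreover have "\<forall>\<^sub>F n in sequentially. s < v n" by (rule order_tendstoD(1)[OF v_lim s])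
      ultimately have "\<forall>\<^sub>F n in sequentially. X x (v n) \<omega> \<in> ball h r \<and> s < v n" by (rule eventually_conj)
      then obtain n where "X x (v n) \<omega> \<in> ball h r \<and> s < v n" using eventually_happens by force
      with w show "\<exists>n\<in>{n. s < v n}. \<omega> \<in> {\<omega>\<in>space M. X x (v n) \<omega> \<in> ball h r}" by blast
    qed
    ultimately have "\<exists>n\<in>{n. s < v n}. 0 < prob {\<omega>\<in>space M. X x (v n) \<omega> \<in> ball h r}"
      by (intro exists_prob_pos measurable_Collect_ball X_measurable v) auto
    then show ?thesis using v by (auto simp: transition_prob_def)
  qed
  then show thesis by (rule that)
qed

theorem irreducible:
  assumes jumps_add_up: "\<And>h \<eta>h. \<eta>h > 0 \<Longrightarrow>
      \<exists>n\<ge>1. \<exists>\<eta> :: nat \<Rightarrow> real. \<exists>a :: nat \<Rightarrow> 'h.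
        (\<forall>i\<in>{1..n}. \<eta> i > 0 \<and> a i \<noteq> 0 \<and> 0 \<notin> cball (a i) (\<eta> i) \<and>
           emeasure \<nu> (ball (a i) (\<eta> i)) > 0) \<and>
        {\<Sum>i=1..n. g i | g. \<forall>i\<in>{1..n}. g i \<in> ball (a i) (\<eta> i)} \<subseteq> ball h \<eta>h"
  shows "irreducible_process M X"
  unfolding irreducible_process_def
proof (intro allI impI)
  fix T :: real and x :: 'h and B :: "'h set"
  assume T: "0 < T" and B: "open B \<and> B \<noteq> {}"
  then obtain y0 \<delta> where \<delta>: "0 < \<delta>" "ball y0 \<delta> \<subseteq> B" by (metis all_not_in_conv open_contains_ball)
  obtain h where h: "\<And>r s. 0 < r \<Longrightarrow> s < T \<Longrightarrow> \<exists>v. 0 \<le> v \<and> s < v \<and> v < T \<and> 0 < P x v (ball h r)"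
    using law_before_has_support_point[OF T] by blast
  obtain n :: nat and \<eta> :: "nat \<Rightarrow> real" and a where n: "1 \<le> n"
    and a: "\<forall>i\<in>{1..n}. \<eta> i > 0 \<and> a i \<noteq> 0 \<and> 0 \<notin> cball (a i) (\<eta> i) \<and> emeasure \<nu> (ball (a i) (\<eta> i)) > 0"
    and sub: "{\<Sum>i=1..n. g i | g. \<forall>i\<in>{1..n}. g i \<in> ball (a i) (\<eta> i)} \<subseteq> ball (y0 - h) \<delta>"
    using jumps_add_up[OF \<delta>(1), of "y0 - h"] by blast
  have "\<exists>b. b \<in> ball (a i) (\<eta> i) \<and> (\<forall>r>0. 0 < emeasure \<nu> (ball b r))" if "i \<in> {1..n}" for i
  proof -
    have "emeasure \<nu> (ball (a i) (\<eta> i)) \<noteq> 0" using bspec[OF a that] by (simp add: zero_less_iff_neq_zero)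
    from support_point_exists[OF sets_nu open_ball this] show ?thesis by metis
  qed
  then obtain b where b: "\<And>i. i \<in> {1..n} \<Longrightarrow> b i \<in> ball (a i) (\<eta> i) \<and> (\<forall>r>0. 0 < emeasure \<nu> (ball (b i) r))"
    by metis
  have b0: "b i \<noteq> 0" if "i \<in> {1..n}" for i
    using b[OF that] bspec[OF a that] by auto
  define z where "z = h + (\<Sum>i=1..n. b i)"
  have "(\<Sum>i=1..n. b i) \<in> ball (y0 - h) \<delta>" using sub b by blast
  then have "z \<in> ball y0 \<delta>" by (simp add: z_def dist_norm algebra_simps)
  then obtain \<delta>' where \<delta>': "0 < \<delta>'" "ball z \<delta>' \<subseteq> B"
    using \<delta>(2) by (meson open_ball openE order_trans)
  obtain \<epsilon> t where \<epsilon>: "0 < \<epsilon>" and t: "0 < t"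
    and stay: "\<And>y r. y \<in> ball z \<epsilon> \<Longrightarrow> 0 \<le> r \<Longrightarrow> r < t \<Longrightarrow> 0 < P y r (ball z \<delta>')"
    using remains_in_ball_until[OF \<delta>'(1)] by blast
  have "\<forall>i\<in>{1..n}. b i \<noteq> 0 \<and> (\<forall>r>0. 0 < emeasure \<nu> (ball (b i) r))" using b b0 by blast
  from reaches_sum_of_jumps[OF n this \<epsilon>, of h] obtain \<epsilon>0 where \<epsilon>0: "0 < \<epsilon>0"
    and reach: "\<And>y s. y \<in> ball h \<epsilon>0 \<Longrightarrow> 0 < s \<Longrightarrow> \<exists>q\<in>\<rat>. 0 < q \<and> q < s \<and> 0 < P y q (ball z \<epsilon>)"
    unfolding z_def by blast
  have "T - t < T" using t by simp
  from h[OF \<epsilon>0 this] obtain v where v: "0 \<le> v" "T - t < v" "v < T" "0 < P x v (ball h \<epsilon>0)" by blast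
  let ?Q = "{q\<in>\<rat>. 0 < q \<and> q < T - v}"
  have "\<exists>q\<in>?Q. 0 < P x (v + q) (ball z \<epsilon>)"
  proof (rule markov_positive[OF markov adapted_X v(1,4)])
    show "countable ?Q" by (rule countable_subset[OF _ countable_rat]) auto
    show "\<exists>q\<in>?Q. 0 < P y q (ball z \<epsilon>)" if "y \<in> ball h \<epsilon>0" for y
      using reach[OF that, of "T - v"] v by auto
  qed auto
  then obtain q where q: "0 < q" "q < T - v" "0 < P x (v + q) (ball z \<epsilon>)" by blast
  \<comment> \<open>After the last jump less than \<open>t\<close> is left until \<open>T\<close>, and the process stays.\<close>
  have "\<exists>r\<in>{T - v - q}. 0 < P x ((v + q) + r) (ball z \<delta>')"
    by (rule markov_positive[OF markov adapted_X, where U="ball z \<epsilon>"]) (use q v stay in auto)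
  then have "0 < P x T (ball z \<delta>')" by simp
  also have "\<dots> \<le> prob {\<omega>\<in>space M. X x T \<omega> \<in> B}"
    unfolding transition_prob_def using \<delta>'(2) X_measurable[of T x] T B measurable_sets[of "X x T" M borel B]
    by (intro finite_measure_mono) (auto simp: vimage_def Int_def conj_commute)
  finally show "0 < prob {\<omega>\<in>space M. X x T \<omega> \<in> B}" .
qed

end

theorem theorem2p2:
  fixes J :: "'v::banach \<Rightarrow>\<^sub>L 'h::{real_inner,banach,second_countable_topology}"
    and M :: "'w measure" and F :: "real \<Rightarrow> 'w measure"
    and \<nu> :: "'h measure" and N :: "'w \<Rightarrow> ('h \<times> real) measure"
    and L :: "real \<Rightarrow> 'w \<Rightarrow> 'h"
    and A :: "'v \<Rightarrow> ('v \<Rightarrow>\<^sub>L real)"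
    and X :: "'h \<Rightarrow> real \<Rightarrow> 'w \<Rightarrow> 'h"
  assumes triple: "gelfand_triple J"
    and basis: "usual_filtered_prob_space M F"
    and levy: "levy_measure \<nu>"
    and prm: "poisson_random_measure M F \<nu> N"
    and L: "levy_process_of M \<nu> N L"
    and A: "A \<in> borel_measurable borel"
    and cond1_exists: "\<And>x. is_solution J M F A L x (X x)"
    and cond1_unique: "\<And>x Y. is_solution J M F A L x Y \<Longrightarrow> indistinguishable M Y (X x)"
    and cond1_markov: "strong_markov M F X"
    and cond2: "\<And>h. \<exists>\<eta>h>0. \<forall>\<eta>\<in>{0<..\<eta>h}. \<exists>\<epsilon>\<in>{0<..\<eta>/2}. \<exists>t>0.
      (INF h'\<in>ball h \<epsilon>. measure M {\<omega>\<in>space M. exit_time X \<eta> h' h \<omega> \<ge> ennreal t}) > 0"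
    and cond3: "\<And>h \<eta>h. \<eta>h > 0 \<Longrightarrow>
      \<exists>n\<ge>1. \<exists>\<eta> :: nat \<Rightarrow> real. \<exists>a :: nat \<Rightarrow> 'h.
        (\<forall>i\<in>{1..n}. \<eta> i > 0 \<and> a i \<noteq> 0 \<and> 0 \<notin> cball (a i) (\<eta> i) \<and>
           emeasure \<nu> (ball (a i) (\<eta> i)) > 0) \<and>
        {\<Sum>i=1..n. g i | g. \<forall>i\<in>{1..n}. g i \<in> ball (a i) (\<eta> i)} \<subseteq> ball h \<eta>h"
  shows "irreducible_process M X"
proof -
  interpret prob_space M using basis by (simp add: usual_filtered_prob_space_def)
  interpret jump_driven_markov M F \<nu> N L J A X
    by unfold_locales (fact basis levy prm L triple cond1_exists cond1_markov cond2)+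
  show ?thesis by (rule irreducible[OF cond3])
qed

end
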